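(* Let $k\ge1$ be an integer, $H>\frac12$ and $\lambda>0$. The tempered Hermite process $Z^k_{H,\lambda}$ of order $k$ has stationary increments, and for every scale factor $c>0$ $$\left\{Z^k_{H,\lambda}(ct)\right\}_{t\in\mathbb R}\triangleq\left\{c^HZ^k_{H,c\lambda}(t)\right\}_{t\in\mathbb R},$$ where $\triangleq$ denotes equality of all finite-dimensional distributions.
   Context: Let $B=\{B(t),t\in\mathbb R\}$ be a two-sided real Brownian motion: a process with stationary independent increments with $B(t)$ Gaussian of mean zero and variance $|t|$. For $f\in L^2(\mathbb R^k)$, $\int_{\mathbb R^k}^{'}f(x_1,\ldots,x_k)B(dx_1)\cdots B(dx_k)$ denotes the $k$-fold multiple Wiener--Itô integral (the prime means that one does not integrate over the diagonals $x_i=x_j$, $i\neq j$). Conventions: $(x)_+=x\,I(x>0)$, and $(x)_+^{d-1}$ means $x^{d-1}$ if $x>0$ and $0$ if $x\le0$. For $t<0$, $\int_0^t=-\int_t^0$. For $H>\frac12$ and $\lambda>0$, the tempered Hermite process of order $k$ is $$Z^k_{H,\lambda}(t)=\int_{\mathbb R^k}^{'}\int_0^t\prod_{i=1}^k\left((s-y_i)_+^{d-1}e^{-\lambda(s-y_i)_+}\right)ds\,B(dy_1)\cdots B(dy_k),\qquad d=\frac12-\frac{1-H}{k}.$$ *)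

theory Defs
  imports "HOL-Probability.Probability"
begin

text \<open>
  The measurability clauses matter: \<^const>\<open>distr\<close> along a non-measurable map is a junk value.
\<close>

definition fdd_equal ::
  "'a measure \<Rightarrow> ('t \<Rightarrow> 'a \<Rightarrow> real) \<Rightarrow> 'b measure \<Rightarrow> ('t \<Rightarrow> 'b \<Rightarrow> real) \<Rightarrow> bool" where
  "fdd_equal M X N Y \<longleftrightarrow>
     (\<forall>t. X t \<in> borel_measurable M) \<and> (\<forall>t. Y t \<in> borel_measurable N) \<and>
     (\<forall>J. finite J \<longrightarrow>
        distr M (Pi\<^sub>M J (\<lambda>_. borel)) (\<lambda>\<omega>. \<lambda>t\<in>J. X t \<omega>) =
        distr N (Pi\<^sub>M J (\<lambda>_. borel)) (\<lambda>\<omega>. \<lambda>t\<in>J. Y t \<omega>))"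

definition stationary_increments :: "'a measure \<Rightarrow> (real \<Rightarrow> 'a \<Rightarrow> real) \<Rightarrow> bool" where
  "stationary_increments M X \<longleftrightarrow>
     (\<forall>h. fdd_equal M (\<lambda>t \<omega>. X (t + h) \<omega> - X h \<omega>) M (\<lambda>t \<omega>. X t \<omega> - X 0 \<omega>))"

text \<open>
  At \<open>t = 0\<close> the Gaussian law is degenerate and has no density, hence the separate clause.
  Path continuity is not required.
\<close>

locale two_sided_brownian_motion = prob_space M
  for M :: "'a measure" and B :: "real \<Rightarrow> 'a \<Rightarrow> real" +
  assumes measurable_BM: "B t \<in> borel_measurable M"
    and stationary_BM: "stationary_increments M B"
    and independent_BM:
      "strict_mono_on {..n} \<tau> \<Longrightarrow>
         indep_vars (\<lambda>_. borel) (\<lambda>i \<omega>. B (\<tau> (Suc i)) \<omega> - B (\<tau> i) \<omega>) {..<n}"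
    and gaussian_BM:
      "t \<noteq> 0 \<Longrightarrow> distributed M lborel (B t) (normal_density 0 (sqrt \<bar>t\<bar>))"
    and zero_BM: "AE \<omega> in M. B 0 \<omega> = 0"

text \<open>
  Points of \<open>\<real>\<^sup>k\<close> are functions on \<open>{..<k}\<close>, with Lebesgue measure the \<open>k\<close>-fold product of
  \<^const>\<open>lborel\<close>.
\<close>

abbreviation lborel_pow :: "nat \<Rightarrow> (nat \<Rightarrow> real) measure" where
  "lborel_pow k \<equiv> Pi\<^sub>M {..<k} (\<lambda>_. lborel)"

definition square_integrable :: "'a measure \<Rightarrow> ('a \<Rightarrow> real) \<Rightarrow> bool" where
  "square_integrable M f \<longleftrightarrow> f \<in> borel_measurable M \<and> integrable M (\<lambda>x. (f x)\<^sup>2)"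

definition L2_tendsto :: "'a measure \<Rightarrow> (nat \<Rightarrow> 'a \<Rightarrow> real) \<Rightarrow> ('a \<Rightarrow> real) \<Rightarrow> bool" where
  "L2_tendsto M F f \<longleftrightarrow> (\<lambda>m. \<integral>\<^sup>+x. ennreal ((F m x - f x)\<^sup>2) \<partial>M) \<longlonglongrightarrow> 0"

text \<open>
  The grid \<open>t 0 < \<dots> < t n\<close> has cells \<open>(t j, t (j+1)]\<close>. Only injective multi-indices \<open>p\<close> are
  summed, so the step function vanishes on every box \<open>\<Prod>i. (t (p i), t (p i + 1)]\<close> that meets a
  diagonal.
\<close>

definition offdiag_indices :: "nat \<Rightarrow> nat \<Rightarrow> (nat \<Rightarrow> nat) set" where
  "offdiag_indices k n = {p \<in> {..<k} \<rightarrow>\<^sub>E {..<n}. inj_on p {..<k}}"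

definition offdiag_step ::
  "nat \<Rightarrow> nat \<Rightarrow> (nat \<Rightarrow> real) \<Rightarrow> ((nat \<Rightarrow> nat) \<Rightarrow> real) \<Rightarrow> (nat \<Rightarrow> real) \<Rightarrow> real" where
  "offdiag_step k n t a x =
     (\<Sum>p\<in>offdiag_indices k n. a p * (\<Prod>i<k. indicator {t (p i)<..t (Suc (p i))} (x i)))"

definition offdiag_step_integral ::
  "(real \<Rightarrow> 'a \<Rightarrow> real) \<Rightarrow> nat \<Rightarrow> nat \<Rightarrow> (nat \<Rightarrow> real) \<Rightarrow> ((nat \<Rightarrow> nat) \<Rightarrow> real) \<Rightarrow> 'a \<Rightarrow> real" where
  "offdiag_step_integral B k n t a \<omega> =
     (\<Sum>p\<in>offdiag_indices k n. a p * (\<Prod>i<k. (B (t (Suc (p i))) \<omega> - B (t (p i)) \<omega>)))"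

text \<open>
  The multiple Wiener--Ito integral is the \<open>L\<^sup>2\<close>-extension of the integral of off-diagonal step
  functions. It is determined only up to almost sure equality; \<open>wiener_ito\<close> selects a version.
\<close>

definition is_wiener_ito ::
  "'a measure \<Rightarrow> (real \<Rightarrow> 'a \<Rightarrow> real) \<Rightarrow> nat \<Rightarrow> ((nat \<Rightarrow> real) \<Rightarrow> real) \<Rightarrow> ('a \<Rightarrow> real) \<Rightarrow> bool" where
  "is_wiener_ito M B k f X \<longleftrightarrow>
     square_integrable (lborel_pow k) f \<and> square_integrable M X \<and>
     (\<exists>n t a. (\<forall>m. strict_mono_on {..n m} (t m)) \<and>
        L2_tendsto (lborel_pow k) (\<lambda>m. offdiag_step k (n m) (t m) (a m)) f \<and>
        L2_tendsto M (\<lambda>m. offdiag_step_integral B k (n m) (t m) (a m)) X)"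

definition wiener_ito ::
  "'a measure \<Rightarrow> (real \<Rightarrow> 'a \<Rightarrow> real) \<Rightarrow> nat \<Rightarrow> ((nat \<Rightarrow> real) \<Rightarrow> real) \<Rightarrow> 'a \<Rightarrow> real" where
  "wiener_ito M B k f = (SOME X. is_wiener_ito M B k f X)"

definition pos_part :: "real \<Rightarrow> real" where
  "pos_part x = (if x > 0 then x else 0)"

definition pos_powr :: "real \<Rightarrow> real \<Rightarrow> real" where
  "pos_powr x a = (if x > 0 then x powr a else 0)"

definition hermite_exponent :: "nat \<Rightarrow> real \<Rightarrow> real" where
  "hermite_exponent k H = 1 / 2 - (1 - H) / real k"

text \<open>
  The interval integral carries the sign convention for \<open>t < 0\<close>. The integrand may fail to be
  integrable for \<open>y\<close> in a null set (for example on diagonals); there the integral is \<open>0\<close>.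
\<close>

definition tempered_hermite_kernel ::
  "nat \<Rightarrow> real \<Rightarrow> real \<Rightarrow> real \<Rightarrow> (nat \<Rightarrow> real) \<Rightarrow> real" where
  "tempered_hermite_kernel k H lam t y =
     (LBINT s=0..t. (\<Prod>i<k. pos_powr (s - y i) (hermite_exponent k H - 1) *
                             exp (- lam * pos_part (s - y i))))"

definition tempered_hermite ::
  "'a measure \<Rightarrow> (real \<Rightarrow> 'a \<Rightarrow> real) \<Rightarrow> nat \<Rightarrow> real \<Rightarrow> real \<Rightarrow> real \<Rightarrow> 'a \<Rightarrow> real" where
  "tempered_hermite M B k H lam t = wiener_ito M B k (tempered_hermite_kernel k H lam t)"

end

theory Submission
  imports Defs
begin

text \<open>
  Off-diagonal step functions \<open>\<phi>\<close> are carried along together with the path functional \<open>F\<close> that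
  integrates them, so that one pair \<open>(\<phi>, F)\<close> can be evaluated on several Brownian motions. Step
  functions are dense in \<open>L\<^sup>2\<close> and \<open>\<phi> \<mapsto> F(B)\<close> is bounded from \<open>L\<^sup>2(\<real>\<^sup>k)\<close> to \<open>L\<^sup>2(M)\<close>, hence the
  multiple integral exists, is almost surely unique and is linear. The joint law of finitely many
  \<open>F\<^sub>j(B)\<close> depends only on the law of the increments, and this passes to \<open>L\<^sup>2\<close>-limits: the
  integrals of a family \<open>f\<^sub>t\<close> have the same finite-dimensional laws for any two Brownian motions.

  Put \<open>B'(s) = B(c s + h) / sqrt c\<close>, again a Brownian motion up to its value at \<open>0\<close>. Integrating
  \<open>g\<close> against \<open>B\<close> is integrating \<open>c powr (k / 2) * g(c x + h)\<close> against \<open>B'\<close>. For the kernels,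
  \<open>c = 1\<close> turns the increment over \<open>[h, t + h]\<close> into the one over \<open>[0, t]\<close>, and \<open>h = 0\<close> turns
  \<open>(lam, c t)\<close> into \<open>(c lam, t)\<close> with the factor \<open>c powr (1 + k (d - 1))\<close>, where
  \<open>1 + k (d - 1) + k / 2 = H\<close>.
\<close>

section \<open>Simple pairs: off-diagonal step functions and their path integrals\<close>

text \<open>\<open>wiener_ito\<close> picks a version, and the approximating sequence inside
  \<open>is_wiener_ito\<close> is existential, so it may change with the integrand and with the
  motion. All arguments therefore concern the relation \<open>is_wiener_ito\<close>, and the pivot
  is \<open>L2_tendsto_wiener_ito\<close>: any simple pairs converging to \<open>f\<close> have
  integrals converging to any version of the integral of \<open>f\<close>. One sequence can then
  serve two motions at once, as a comparison of laws requires. Each box of a simple pair has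
  endpoints of its own, so that sums, multiples and affine images of pairs are immediate. A common
  grid enters only where cells must be disjoint: for joint laws, for second moments and for the way
  back to \<open>offdiag_step\<close>. Density survives since the diagonals are null sets, and the
  cells that must be left out shrink to them. The kernel is a Bochner integral in \<open>s\<close>
  with default value 0, so its additivity over adjacent intervals is obtained only for almost every
  \<open>y\<close>; this is why integrands are exchanged up to null sets.\<close>

inductive simple_pair ::
  "nat \<Rightarrow> ((nat \<Rightarrow> real) \<Rightarrow> real) \<Rightarrow> ((real \<Rightarrow> real) \<Rightarrow> real) \<Rightarrow> bool" for k where
  zero: "simple_pair k (\<lambda>_. 0) (\<lambda>_. 0)"
| add_box: "simple_pair k (\<lambda>x. \<phi> x + c * (\<Prod>i<k. indicator {l i<..r i} (x i)))
                         (\<lambda>b. F b + c * (\<Prod>i<k. b (r i) - b (l i)))"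
  if "simple_pair k \<phi> F" "\<And>i. i < k \<Longrightarrow> l i \<le> r i"
     "\<And>i j. i < k \<Longrightarrow> j < k \<Longrightarrow> i \<noteq> j \<Longrightarrow> {l i<..r i} \<inter> {l j<..r j} = {}"

lemma simple_pair_add:
  assumes "simple_pair k \<phi> F" "simple_pair k \<psi> G"
  shows "simple_pair k (\<lambda>x. \<phi> x + \<psi> x) (\<lambda>b. F b + G b)"
  using assms(2)
proof induction
  case zero
  then show ?case using assms(1) by simp
next
  case (add_box \<psi> G l r c)
  show ?case
    using simple_pair.add_box[OF add_box.IH add_box.hyps(2,3), where c=c] by (simp add: add.assoc)
qed

lemma simple_pair_scale:
  assumes "simple_pair k \<phi> F"
  shows "simple_pair k (\<lambda>x. d * \<phi> x) (\<lambda>b. d * F b)"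
  using assms
proof induction
  case zero
  then show ?case using simple_pair.zero by simp
next
  case (add_box \<psi> G l r c)
  show ?case
    using simple_pair.add_box[OF add_box.IH add_box.hyps(2,3), where c="d * c"]
    by (simp add: distrib_left mult.assoc)
qed

lemma simple_pair_diff:
  assumes "simple_pair k \<phi> F" "simple_pair k \<psi> G"
  shows "simple_pair k (\<lambda>x. \<phi> x - \<psi> x) (\<lambda>b. F b - G b)"
  using simple_pair_add[OF assms(1) simple_pair_scale[OF assms(2), of "-1"]] by simp

lemma simple_pair_box:
  assumes "\<And>i. i < k \<Longrightarrow> l i \<le> r i"
    and "\<And>i j. i < k \<Longrightarrow> j < k \<Longrightarrow> i \<noteq> j \<Longrightarrow> {l i<..r i} \<inter> {l j<..r j} = {}"
  shows "simple_pair k (\<lambda>x. c * (\<Prod>i<k. indicator {l i<..r i} (x i)))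
                       (\<lambda>b. c * (\<Prod>i<k. b (r i) - b (l i)))"
  using simple_pair.add_box[OF simple_pair.zero assms, where c=c] by simp

lemma simple_pair_sum:
  assumes "finite I" "\<And>i. i \<in> I \<Longrightarrow> simple_pair k (\<phi> i) (F i)"
  shows "simple_pair k (\<lambda>x. \<Sum>i\<in>I. \<phi> i x) (\<lambda>b. \<Sum>i\<in>I. F i b)"
  using assms
  by (induction I rule: finite_induct) (auto intro: simple_pair.zero simple_pair_add)

section \<open>Grids on the line and the cutting of boxes into grid cells\<close>

lemma finite_offdiag_indices [simp]: "finite (offdiag_indices k n)"
  by (auto simp: offdiag_indices_def intro!: finite_PiE)

lemma offdiag_indices_D:
  assumes "p \<in> offdiag_indices k n"
  shows "i < k \<Longrightarrow> p i < n" "inj_on p {..<k}" "p \<in> {..<k} \<rightarrow>\<^sub>E {..<n}"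
  using assms by (auto simp: offdiag_indices_def)

lemma grid_mono:
  fixes t :: "nat \<Rightarrow> real"
  assumes "strict_mono_on {..n} t" "i \<le> n" "j \<le> n"
  shows "t i \<le> t j \<longleftrightarrow> i \<le> j" "t i < t j \<longleftrightarrow> i < j"
  using strict_mono_on_less_eq[OF assms(1)] strict_mono_on_less[OF assms(1)] assms(2,3) by simp_all

lemma grid_cells_disjoint:
  fixes t :: "nat \<Rightarrow> real"
  assumes "strict_mono_on {..n} t" "i < n" "j < n" "i \<noteq> j"
  shows "{t i<..t (Suc i)} \<inter> {t j<..t (Suc j)} = {}"
proof -
  have "t (Suc i) \<le> t j \<or> t (Suc j) \<le> t i"
    using assms by (cases "i < j") (auto simp: grid_mono[OF assms(1)])
  then show ?thesis by auto
qed

text \<open>Injective multi-indices pick distinct cells, so the sides of each box are pairwise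
  disjoint. In \<open>offdiag_step_integral (\<lambda>s b. b s)\<close> the sample point is the path
  itself, which turns the integral into a functional of paths.\<close>

lemma simple_pair_offdiag_step:
  assumes t: "strict_mono_on {..n} t"
  shows "simple_pair k (offdiag_step k n t a) (offdiag_step_integral (\<lambda>s b. b s) k n t a)"
proof -
  have "simple_pair k (\<lambda>x. a p * (\<Prod>i<k. indicator {t (p i)<..t (Suc (p i))} (x i)))
          (\<lambda>b. a p * (\<Prod>i<k. b (t (Suc (p i))) - b (t (p i))))"
    if p: "p \<in> offdiag_indices k n" for p
  proof (rule simple_pair_box)
    show "t (p i) \<le> t (Suc (p i))" if "i < k" for i
      using offdiag_indices_D(1)[OF p that] by (simp add: grid_mono[OF t])
    show "{t (p i)<..t (Suc (p i))} \<inter> {t (p j)<..t (Suc (p j))} = {}"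
      if "i < k" "j < k" "i \<noteq> j" for i j
      using that offdiag_indices_D[OF p] by (intro grid_cells_disjoint[OF t]) (auto dest: inj_onD)
  qed
  from simple_pair_sum[OF finite_offdiag_indices this, of k n]
  show ?thesis unfolding offdiag_step_def offdiag_step_integral_def .
qed

text \<open>Each increment telescopes over the cells of its side, and expanding the product of sums
  leaves one choice of cell per coordinate. The functions \<open>b i\<close> may differ from
  coordinate to coordinate, so that box indicators become an instance too.\<close>

lemma box_increments_eq_sum_cells:
  fixes b :: "nat \<Rightarrow> real \<Rightarrow> real" and t :: "nat \<Rightarrow> real"
  assumes t: "strict_mono_on {..n} t"
    and lr: "\<And>i. i < k \<Longrightarrow> l i \<in> t ` {..n}" "\<And>i. i < k \<Longrightarrow> r i \<in> t ` {..n}"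
      "\<And>i. i < k \<Longrightarrow> l i \<le> r i"
  shows "(\<Prod>i<k. b i (r i) - b i (l i)) =
    (\<Sum>p\<in>PiE {..<k} (\<lambda>i. {j. j < n \<and> l i \<le> t j \<and> t j < r i}).
        \<Prod>i<k. b i (t (Suc (p i))) - b i (t (p i)))"
proof -
  have "b i (r i) - b i (l i) =
     (\<Sum>j | j < n \<and> l i \<le> t j \<and> t j < r i. b i (t (Suc j)) - b i (t j))" if i: "i < k" for i
  proof -
    obtain u v where u: "u \<le> n" "l i = t u" and v: "v \<le> n" "r i = t v" using lr(1,2)[OF i] by auto
    then have "u \<le> v" using lr(3)[OF i] grid_mono[OF t, of u v] by simp
    have "{j. j < n \<and> l i \<le> t j \<and> t j < r i} = {u..<v}"
      using u v by (auto simp: grid_mono[OF t])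
    then show ?thesis using sum_Suc_diff'[OF \<open>u \<le> v\<close>, of "\<lambda>j. b i (t j)"] u v by simp
  qed
  then have "(\<Prod>i<k. b i (r i) - b i (l i)) =
     (\<Prod>i<k. \<Sum>j | j < n \<and> l i \<le> t j \<and> t j < r i. b i (t (Suc j)) - b i (t j))"
    by (intro prod.cong) auto
  also have "\<dots> = (\<Sum>p\<in>PiE {..<k} (\<lambda>i. {j. j < n \<and> l i \<le> t j \<and> t j < r i}).
        \<Prod>i<k. b i (t (Suc (p i))) - b i (t (p i)))"
    by (rule prod_sum_PiE) auto
  finally show ?thesis .
qed

text \<open>For fixed \<open>x\<close> the indicator is an increment in its endpoints, so the
  telescoping identity covers it.\<close>

lemma indicator_greaterThanAtMost_eq_diff:
  "l \<le> r \<Longrightarrow> (indicator {l<..r} x :: real) = indicator {x..} r - indicator {x..} (l :: real)"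
  by (auto simp: indicator_def)

lemma box_indicator_eq_sum_cells:
  fixes t x :: "nat \<Rightarrow> real"
  assumes t: "strict_mono_on {..n} t"
    and lr: "\<And>i. i < k \<Longrightarrow> l i \<in> t ` {..n}" "\<And>i. i < k \<Longrightarrow> r i \<in> t ` {..n}"
      "\<And>i. i < k \<Longrightarrow> l i \<le> r i"
  shows "(\<Prod>i<k. indicator {l i<..r i} (x i) :: real) =
    (\<Sum>p\<in>PiE {..<k} (\<lambda>i. {j. j < n \<and> l i \<le> t j \<and> t j < r i}).
        \<Prod>i<k. indicator {t (p i)<..t (Suc (p i))} (x i))"
proof -
  let ?P = "PiE {..<k} (\<lambda>i. {j. j < n \<and> l i \<le> t j \<and> t j < r i})"
  have "(\<Prod>i<k. indicator {l i<..r i} (x i)) =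
      (\<Prod>i<k. indicator {x i..} (r i) - (indicator {x i..} (l i) :: real))"
    using lr(3) by (intro prod.cong) (auto simp: indicator_greaterThanAtMost_eq_diff)
  also have "\<dots> = (\<Sum>p\<in>?P. \<Prod>i<k. indicator {x i..} (t (Suc (p i))) - indicator {x i..} (t (p i)))"
    by (rule box_increments_eq_sum_cells[OF t lr, where b="\<lambda>i. indicator {x i..}"]) auto
  also have "\<dots> = (\<Sum>p\<in>?P. \<Prod>i<k. indicator {t (p i)<..t (Suc (p i))} (x i))"
    by (intro sum.cong prod.cong refl indicator_greaterThanAtMost_eq_diff[symmetric] less_imp_le
        strict_mono_onD[OF t]) (auto simp: PiE_iff Suc_le_eq less_imp_le)
  finally show ?thesis .
qed

text \<open>\<open>T\<close> collects the endpoints of the boxes. Admitting every grid through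
  \<open>T\<close>, and not just one, keeps the induction going when a box is added and lets several
  pairs share a grid.\<close>

lemma simple_pair_grid:
  assumes "simple_pair k \<phi> F"
  shows "\<exists>T. finite T \<and> (\<forall>(n::nat) t. strict_mono_on {..n} t \<longrightarrow> T \<subseteq> t ` {..n} \<longrightarrow>
    (\<exists>a. \<phi> = offdiag_step k n t a \<and> F = offdiag_step_integral (\<lambda>s b. b s) k n t a))"
  using assms
proof induction
  case zero
  have "\<exists>a. (\<lambda>_. 0) = offdiag_step k n t a \<and> (\<lambda>_. 0) = offdiag_step_integral (\<lambda>s b. b s) k n t a" for n t
    by (rule exI[of _ "\<lambda>_. 0"]) (auto simp: offdiag_step_def offdiag_step_integral_def)
  then show ?case by blast
next
  case (add_box \<phi> F l r c)
  obtain T where T: "finite T" "\<And>(n :: nat) t. strict_mono_on {..n} t \<Longrightarrow> T \<subseteq> t ` {..n} \<Longrightarrow>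
    \<exists>a. \<phi> = offdiag_step k n t a \<and> F = offdiag_step_integral (\<lambda>s b. b s) k n t a"
    using add_box.IH by blast
  define T' where "T' = T \<union> l ` {..<k} \<union> r ` {..<k}"
  show ?case
  proof (intro exI[of _ T'] conjI allI impI)
    show "finite T'" using T by (simp add: T'_def)
    fix n :: nat and t :: "nat \<Rightarrow> real"
    assume t: "strict_mono_on {..n} t" "T' \<subseteq> t ` {..n}"
    then obtain a where a: "\<phi> = offdiag_step k n t a"
      "F = offdiag_step_integral (\<lambda>s b. b s) k n t a"
      using T(2)[OF t(1)] by (auto simp: T'_def)
    let ?P = "PiE {..<k} (\<lambda>i. {j. j < n \<and> l i \<le> t j \<and> t j < r i})"
    have P: "?P \<subseteq> offdiag_indices k n"
    proof
      fix p assume p: "p \<in> ?P"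
      have "inj_on p {..<k}"
      proof (rule inj_onI, rule ccontr)
        fix i j assume ij: "i \<in> {..<k}" "j \<in> {..<k}" "p i = p j" "i \<noteq> j"
        \<comment> \<open>A repeated index would put one cell into two disjoint sides. The right
          endpoint is the point to test, because cells are open on the left.\<close>
        have *: "t (Suc (p i)) \<in> {l i<..r i}" if i: "i < k" for i
        proof -
          have pi: "p i < n" "l i \<le> t (p i)" "t (p i) < r i" using p i by (auto simp: PiE_iff)
          obtain v where v: "v \<le> n" "r i = t v" using t(2) i unfolding T'_def by auto
          then have "p i < v" using pi grid_mono[OF t(1), of "p i" v] by simp
          then show ?thesis using v pi grid_mono[OF t(1), of "Suc (p i)" v]
              grid_mono(2)[OF t(1), of "p i" "Suc (p i)"] by simp
        qed
        show False using *[of i] *[of j] add_box.hyps(3)[of i j] ij by auto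
      qed
      then show "p \<in> offdiag_indices k n" using p by (auto simp: offdiag_indices_def PiE_iff)
    qed
    define a' where "a' p = a p + c * indicator ?P p" for p
    \<comment> \<open>With \<open>g\<close> left open, the same coefficients \<open>a'\<close> serve
      the cell indicators and the products of increments.\<close>
    have split: "(\<Sum>p\<in>offdiag_indices k n. a' p * g p) =
       (\<Sum>p\<in>offdiag_indices k n. a p * g p) + c * (\<Sum>p\<in>?P. g p)" for g :: "_ \<Rightarrow> real"
    proof -
      have "(\<Sum>p\<in>offdiag_indices k n. indicator ?P p * g p) = (\<Sum>p\<in>?P. g p)"
        using P by (subst sum.mono_neutral_cong_right[of _ ?P "\<lambda>p. indicator ?P p * g p" g]) auto
      then show ?thesis
        unfolding a'_def by (simp add: distrib_right sum.distrib mult.assoc flip: sum_distrib_left)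
    qed
    have lr: "\<And>i. i < k \<Longrightarrow> l i \<in> t ` {..n}" "\<And>i. i < k \<Longrightarrow> r i \<in> t ` {..n}"
      using t(2) by (auto simp: T'_def)
    note box = box_increments_eq_sum_cells[OF t(1) lr add_box.hyps(2)]
    show "\<exists>a. (\<lambda>x. \<phi> x + c * (\<Prod>i<k. indicator {l i<..r i} (x i))) = offdiag_step k n t a \<and>
      (\<lambda>b. F b + c * (\<Prod>i<k. b (r i) - b (l i))) = offdiag_step_integral (\<lambda>s b. b s) k n t a"
    proof (intro exI[of _ a'] conjI ext)
      fix x :: "nat \<Rightarrow> real"
      show "\<phi> x + c * (\<Prod>i<k. indicator {l i<..r i} (x i)) = offdiag_step k n t a' x"
        unfolding offdiag_step_def split a
        using box_indicator_eq_sum_cells[where x=x, OF t(1) lr add_box.hyps(2)] by simp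
    next
      fix b :: "real \<Rightarrow> real"
      show "F b + c * (\<Prod>i<k. b (r i) - b (l i)) = offdiag_step_integral (\<lambda>s b. b s) k n t a' b"
        unfolding offdiag_step_integral_def split a using box[where b="\<lambda>_. b"] by simp
    qed
  qed
qed

lemma finite_subset_grid:
  fixes T :: "real set"
  assumes "finite T"
  obtains n :: nat and t where "strict_mono_on {..n} t" "T \<subseteq> t ` {..n}"
proof -
  \<comment> \<open>A grid with parameter \<open>n\<close> has \<open>n + 1\<close> points, hence at
    least one; inserting 0 covers empty \<open>T\<close>.\<close>
  define xs where "xs = sorted_list_of_set (insert 0 T)"
  have xs: "sorted_wrt (<) xs" "set xs = insert 0 T"
    using assms by (simp_all add: xs_def del: sorted_list_of_set_insert_remove)
  then have "length xs \<noteq> 0" by force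
  show ?thesis
  proof (rule that[of "length xs - 1" "nth xs"])
    show "strict_mono_on {..length xs - 1} ((!) xs)"
      using \<open>length xs \<noteq> 0\<close> by (intro strict_mono_onI sorted_wrt_nth_less[OF xs(1)]) simp_all
    show "T \<subseteq> (!) xs ` {..length xs - 1}"
    proof
      fix x assume "x \<in> T"
      then have "x \<in> set xs" using xs by simp
      then obtain i where "i < length xs" "xs ! i = x" by (auto simp: in_set_conv_nth)
      then show "x \<in> (!) xs ` {..length xs - 1}" by (intro image_eqI[of _ _ i]) auto
    qed
  qed
qed

text \<open>A grid through the union of the endpoint sets of all the pairs is admissible for each of
  them.\<close>

lemma simple_pairs_common_grid:
  assumes "finite J" "\<And>j. j \<in> J \<Longrightarrow> simple_pair k (\<phi> j) (F j)"
  obtains n :: nat and t a where "strict_mono_on {..n} t"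
    "\<And>j. j \<in> J \<Longrightarrow> \<phi> j = offdiag_step k n t (a j)"
    "\<And>j. j \<in> J \<Longrightarrow> F j = offdiag_step_integral (\<lambda>s b. b s) k n t (a j)"
proof -
  define good where "good j T \<longleftrightarrow> finite T \<and> (\<forall>(n::nat) t. strict_mono_on {..n} t \<longrightarrow> T \<subseteq> t ` {..n} \<longrightarrow>
    (\<exists>a. \<phi> j = offdiag_step k n t a \<and> F j = offdiag_step_integral (\<lambda>s b. b s) k n t a))" for j T
  have "\<forall>j\<in>J. \<exists>T. good j T"
    using simple_pair_grid assms(2) unfolding good_def by blast
  then obtain T where "\<forall>j\<in>J. good j (T j)" by (rule bchoice[THEN exE])
  then have T: "\<And>j. j \<in> J \<Longrightarrow> finite (T j)"
    "\<And>j (n :: nat) t. j \<in> J \<Longrightarrow> strict_mono_on {..n} t \<Longrightarrow> T j \<subseteq> t ` {..n} \<Longrightarrow>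
      \<exists>a. \<phi> j = offdiag_step k n t a \<and> F j = offdiag_step_integral (\<lambda>s b. b s) k n t a"
    unfolding good_def by simp_all
  have "finite (\<Union>j\<in>J. T j)" using assms(1) T(1) by auto
  then obtain n :: nat and t where t: "strict_mono_on {..n} t" "(\<Union>j\<in>J. T j) \<subseteq> t ` {..n}"
    by (rule finite_subset_grid)
  then have "\<forall>j\<in>J. \<exists>a. \<phi> j = offdiag_step k n t a \<and> F j = offdiag_step_integral (\<lambda>s b. b s) k n t a"
    by (intro ballI T(2)) auto
  then obtain a where "\<forall>j\<in>J. \<phi> j = offdiag_step k n t (a j) \<and>
      F j = offdiag_step_integral (\<lambda>s b. b s) k n t (a j)"
    by (rule bchoice[THEN exE])
  then show ?thesis by (intro that[OF t(1), of a]) simp_all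
qed

text \<open>Trades the grids of the definition for simple pairs, which are closed under sums and
  affine substitution. For the converse a grid is chosen separately for each
  \<open>m\<close>.\<close>

lemma is_wiener_ito_iff_simple_pairs:
  "is_wiener_ito M B k f X \<longleftrightarrow>
     square_integrable (lborel_pow k) f \<and> square_integrable M X \<and>
     (\<exists>\<phi> F. (\<forall>m. simple_pair k (\<phi> m) (F m)) \<and> L2_tendsto (lborel_pow k) \<phi> f \<and>
        L2_tendsto M (\<lambda>m \<omega>. F m (\<lambda>s. B s \<omega>)) X)" (is "_ \<longleftrightarrow> ?R")
proof
  assume "is_wiener_ito M B k f X"
  then obtain n t a where *: "square_integrable (lborel_pow k) f" "square_integrable M X"
    "\<And>m. strict_mono_on {..n m} (t m)"
    "L2_tendsto (lborel_pow k) (\<lambda>m. offdiag_step k (n m) (t m) (a m)) f"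
    "L2_tendsto M (\<lambda>m. offdiag_step_integral B k (n m) (t m) (a m)) X"
    unfolding is_wiener_ito_def by auto
  have "(\<lambda>m. offdiag_step_integral B k (n m) (t m) (a m)) =
    (\<lambda>m \<omega>. offdiag_step_integral (\<lambda>s b. b s) k (n m) (t m) (a m) (\<lambda>s. B s \<omega>))"
    by (simp add: offdiag_step_integral_def fun_eq_iff)
  with * simple_pair_offdiag_step[OF *(3)] show ?R
    by (intro conjI exI[of _ "\<lambda>m. offdiag_step k (n m) (t m) (a m)"]
        exI[of _ "\<lambda>m. offdiag_step_integral (\<lambda>s b. b s) k (n m) (t m) (a m)"] allI) simp_all
next
  assume ?R
  then obtain \<phi> F where *: "square_integrable (lborel_pow k) f" "square_integrable M X"
    "\<And>m. simple_pair k (\<phi> m) (F m)" "L2_tendsto (lborel_pow k) \<phi> f"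
    "L2_tendsto M (\<lambda>m \<omega>. F m (\<lambda>s. B s \<omega>)) X" by auto
  have "\<exists>n t a. strict_mono_on {..n} t \<and> \<phi> m = offdiag_step k n t a \<and>
      F m = offdiag_step_integral (\<lambda>s b. b s) k n t a" for m
    by (rule simple_pairs_common_grid[of "{m}" k \<phi> F]) (use *(3) in auto)
  then have "\<forall>m. \<exists>g. strict_mono_on {..fst g} (fst (snd g)) \<and>
      \<phi> m = offdiag_step k (fst g) (fst (snd g)) (snd (snd g)) \<and>
      F m = offdiag_step_integral (\<lambda>s b. b s) k (fst g) (fst (snd g)) (snd (snd g))"
    by (simp add: split_paired_Ex)
  then obtain g where "\<forall>m. strict_mono_on {..fst (g m)} (fst (snd (g m))) \<and>
      \<phi> m = offdiag_step k (fst (g m)) (fst (snd (g m))) (snd (snd (g m))) \<and>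
      F m = offdiag_step_integral (\<lambda>s b. b s) k (fst (g m)) (fst (snd (g m))) (snd (snd (g m)))"
    by (rule choice[THEN exE])
  then obtain n t a where g: "\<And>m. strict_mono_on {..n m} (t m)"
      "\<And>m. \<phi> m = offdiag_step k (n m) (t m) (a m)"
      "\<And>m. F m = offdiag_step_integral (\<lambda>s b. b s) k (n m) (t m) (a m)"
    using that[of "\<lambda>m. fst (g m)" "\<lambda>m. fst (snd (g m))" "\<lambda>m. snd (snd (g m))"] by simp
  have "(\<lambda>m. offdiag_step_integral B k (n m) (t m) (a m)) = (\<lambda>m \<omega>. F m (\<lambda>s. B s \<omega>))"
    by (simp add: offdiag_step_integral_def fun_eq_iff g(3))
  moreover have "(\<lambda>m. offdiag_step k (n m) (t m) (a m)) = \<phi>" using g(2) by (simp add: fun_eq_iff)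
  ultimately show "is_wiener_ito M B k f X"
    unfolding is_wiener_ito_def using * g(1)
    by (intro conjI exI[of _ n] exI[of _ t] exI[of _ a] allI) simp_all
qed

section \<open>Increments of Brownian motion and the isometry bound\<close>

text \<open>The process \<open>B (c * s + h) / sqrt c\<close> need not vanish at 0, whereas the
  integrals see increments only. Stating everything through the law of increments gives a class that
  is closed under such changes of time.\<close>

locale brownian_increments = prob_space M
  for M :: "'a measure" and B :: "real \<Rightarrow> 'a \<Rightarrow> real" +
  assumes measurable_B [measurable]: "B t \<in> borel_measurable M"
    and indep_increments:
      "strict_mono_on {..n} \<tau> \<Longrightarrow>
         indep_vars (\<lambda>_. borel) (\<lambda>i \<omega>. B (\<tau> (Suc i)) \<omega> - B (\<tau> i) \<omega>) {..<n}"
    and normal_increments: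
      "s < t \<Longrightarrow> distributed M lborel (\<lambda>\<omega>. B t \<omega> - B s \<omega>) (normal_density 0 (sqrt (t - s)))"

lemma fdd_equal_marginal:
  assumes "fdd_equal M X N Y"
  shows "distr M borel (X t) = distr N borel (Y t)"
proof -
  have [measurable]: "X u \<in> borel_measurable M" "Y u \<in> borel_measurable N" for u
    using assms by (auto simp: fdd_equal_def)
  have "distr (distr M (Pi\<^sub>M {t} (\<lambda>_. borel)) (\<lambda>\<omega>. \<lambda>t\<in>{t}. X t \<omega>)) borel (\<lambda>x. x t) =
        distr (distr N (Pi\<^sub>M {t} (\<lambda>_. borel)) (\<lambda>\<omega>. \<lambda>t\<in>{t}. Y t \<omega>)) borel (\<lambda>x. x t)"
    using assms by (simp add: fdd_equal_def)
  then show ?thesis by (simp add: distr_distr comp_def)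
qed

text \<open>Stationarity carries \<open>B t - B s\<close> to \<open>B (t - s) - B 0\<close>, whose
  last term vanishes almost surely, and \<open>gaussian_BM\<close> gives the density.\<close>

lemma two_sided_brownian_motion_increments:
  assumes "two_sided_brownian_motion M B"
  shows "brownian_increments M B"
proof -
  interpret two_sided_brownian_motion M B by fact
  have [measurable]: "B t \<in> borel_measurable M" for t by (rule measurable_BM)
  show ?thesis
  proof
    fix s t :: real assume "s < t"
    have "fdd_equal M (\<lambda>t \<omega>. B (t + s) \<omega> - B s \<omega>) M (\<lambda>t \<omega>. B t \<omega> - B 0 \<omega>)"
      using stationary_BM by (auto simp: stationary_increments_def)
    from fdd_equal_marginal[OF this, of "t - s"]
    have "distr M borel (\<lambda>\<omega>. B t \<omega> - B s \<omega>) = distr M borel (\<lambda>\<omega>. B (t - s) \<omega> - B 0 \<omega>)" by simp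
    also have "\<dots> = distr M borel (B (t - s))"
      using zero_BM by (intro distr_cong_AE) auto
    finally have "distr M lborel (\<lambda>\<omega>. B t \<omega> - B s \<omega>) = distr M lborel (B (t - s))"
      by (simp cong: distr_cong)
    then show "distributed M lborel (\<lambda>\<omega>. B t \<omega> - B s \<omega>) (normal_density 0 (sqrt (t - s)))"
      using gaussian_BM[of "t - s"] \<open>s < t\<close> by (simp add: distributed_def)
  qed (use measurable_BM independent_BM in auto)
qed

text \<open>By independence the joint law is the product of the marginals, and the normal densities
  fix these.\<close>

lemma brownian_increments_distr_eq:
  assumes "brownian_increments M B" "brownian_increments M' B'"
    and t: "strict_mono_on {..n} t"
  shows "distr M (Pi\<^sub>M {..<n} (\<lambda>_. borel)) (\<lambda>\<omega>. \<lambda>i\<in>{..<n}. B (t (Suc i)) \<omega> - B (t i) \<omega>) =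
    distr M' (Pi\<^sub>M {..<n} (\<lambda>_. borel)) (\<lambda>\<omega>. \<lambda>i\<in>{..<n}. B' (t (Suc i)) \<omega> - B' (t i) \<omega>)"
proof -
  interpret brownian_increments M B by fact
  interpret B': brownian_increments M' B' by fact
  show ?thesis
  \<comment> \<open>Without increments both laws are the point mass at the only extensional function
    on the empty set. Independence is expressed by a product law for nonempty index sets.\<close>
  proof (cases "n = 0")
    case True
    then show ?thesis by (simp add: space_PiM prob_space.distr_const B'.prob_space_axioms restrict_def)
  next
    case False
    have "distr M borel (\<lambda>\<omega>. B (t (Suc i)) \<omega> - B (t i) \<omega>) =
        distr M' borel (\<lambda>\<omega>. B' (t (Suc i)) \<omega> - B' (t i) \<omega>)" if "i < n" for i
    proof -
      have "t i < t (Suc i)" using that by (intro strict_mono_onD[OF t]) auto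
      then have "distr M lborel (\<lambda>\<omega>. B (t (Suc i)) \<omega> - B (t i) \<omega>) =
        distr M' lborel (\<lambda>\<omega>. B' (t (Suc i)) \<omega> - B' (t i) \<omega>)"
        using normal_increments B'.normal_increments by (simp add: distributed_def)
      then show ?thesis by (simp cong: distr_cong)
    qed
    then have "(\<Pi>\<^sub>M i\<in>{..<n}. distr M borel (\<lambda>\<omega>. B (t (Suc i)) \<omega> - B (t i) \<omega>)) =
        (\<Pi>\<^sub>M i\<in>{..<n}. distr M' borel (\<lambda>\<omega>. B' (t (Suc i)) \<omega> - B' (t i) \<omega>))"
      by (intro PiM_cong) auto
    then show ?thesis
      using indep_increments[OF t] B'.indep_increments[OF t] False
      by (simp add: indep_vars_iff_distr_eq_PiM B'.indep_vars_iff_distr_eq_PiM lessThan_empty_iff)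
  qed
qed

text \<open>On a common grid all the functionals together are one measurable map \<open>g\<close> of
  the vector of increments, so their joint law is an image of the law of that vector.\<close>

lemma simple_pairs_distr_eq:
  assumes "brownian_increments M B" "brownian_increments M' B'"
    and J: "finite J" "\<And>j. j \<in> J \<Longrightarrow> simple_pair k (\<phi> j) (F j)"
  shows "distr M (Pi\<^sub>M J (\<lambda>_. borel)) (\<lambda>\<omega>. \<lambda>j\<in>J. F j (\<lambda>s. B s \<omega>)) =
    distr M' (Pi\<^sub>M J (\<lambda>_. borel)) (\<lambda>\<omega>. \<lambda>j\<in>J. F j (\<lambda>s. B' s \<omega>))"
proof -
  interpret brownian_increments M B by fact
  interpret B': brownian_increments M' B' by fact
  obtain n :: nat and t a where t: "strict_mono_on {..n} t" and
    F: "\<And>j. j \<in> J \<Longrightarrow> F j = offdiag_step_integral (\<lambda>s b. b s) k n t (a j)"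
    by (rule simple_pairs_common_grid[OF J]) auto
  define g where "g d = (\<lambda>j\<in>J. \<Sum>p\<in>offdiag_indices k n. a j p * (\<Prod>i<k. d (p i)))"
    for d :: "nat \<Rightarrow> real"
  have g: "g \<in> measurable (Pi\<^sub>M {..<n} (\<lambda>_. borel)) (Pi\<^sub>M J (\<lambda>_. borel))"
    unfolding g_def
    by (intro measurable_restrict borel_measurable_sum borel_measurable_times borel_measurable_prod
        borel_measurable_const measurable_component_singleton) (auto dest: offdiag_indices_D)
  have *: "(\<lambda>j\<in>J. F j b) = g (\<lambda>i\<in>{..<n}. b (t (Suc i)) - b (t i))" for b
    unfolding g_def by (intro restrict_ext)
      (auto simp: F offdiag_step_integral_def offdiag_indices_def PiE_iff intro!: sum.cong prod.cong)
  have "distr (distr M (Pi\<^sub>M {..<n} (\<lambda>_. borel)) (\<lambda>\<omega>. \<lambda>i\<in>{..<n}. B (t (Suc i)) \<omega> - B (t i) \<omega>)) (Pi\<^sub>M J (\<lambda>_. borel)) g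
    = distr (distr M' (Pi\<^sub>M {..<n} (\<lambda>_. borel)) (\<lambda>\<omega>. \<lambda>i\<in>{..<n}. B' (t (Suc i)) \<omega> - B' (t i) \<omega>)) (Pi\<^sub>M J (\<lambda>_. borel)) g"
    using brownian_increments_distr_eq[OF assms(1,2) t] by simp
  then show ?thesis
    unfolding * by (subst (asm) (1 2) distr_distr) (use g in \<open>auto simp: comp_def\<close>)
qed

lemma simple_pair_measurable:
  assumes "simple_pair k \<phi> F"
  shows "\<phi> \<in> borel_measurable (lborel_pow k)"
  using assms
proof induction
  case (add_box \<phi> F l r c)
  have [measurable]: "(\<lambda>x. x i) \<in> borel_measurable (lborel_pow k)" if "i < k" for i
    using measurable_component_singleton[of i "{..<k}" "\<lambda>_. lborel"] that by simp
  show ?case using add_box.IH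
    by (intro borel_measurable_add borel_measurable_times borel_measurable_prod
        borel_measurable_const) (auto intro!: measurable_compose[OF _ borel_measurable_indicator])
qed simp

section \<open>Moments of products of increments and a second-moment bound\<close>

context brownian_increments
begin

lemma simple_pair_integral_measurable:
  assumes "simple_pair k \<phi> F"
  shows "(\<lambda>\<omega>. F (\<lambda>s. B s \<omega>)) \<in> borel_measurable M"
  using assms by induction auto

lemma increment_moments:
  assumes "s < t"
  shows "integrable M (\<lambda>\<omega>. (B t \<omega> - B s \<omega>) ^ e)"
    "expectation (\<lambda>\<omega>. B t \<omega> - B s \<omega>) = 0"
    "expectation (\<lambda>\<omega>. (B t \<omega> - B s \<omega>)\<^sup>2) = t - s"
proof -
  note D = normal_increments[OF assms]
  have \<sigma>: "0 < sqrt (t - s)" using assms by simp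
  show "integrable M (\<lambda>\<omega>. (B t \<omega> - B s \<omega>) ^ e)"
    using distributed_integrable[OF D, of "\<lambda>x. x ^ e"] integrable_normal_moment[OF \<sigma>, of 0 e]
    by simp
  show "expectation (\<lambda>\<omega>. B t \<omega> - B s \<omega>) = 0"
    using distributed_integral[OF D, of "\<lambda>x. x"] integral_normal_moment_odd[OF \<sigma>, of 0 0] by simp
  show "expectation (\<lambda>\<omega>. (B t \<omega> - B s \<omega>)\<^sup>2) = t - s"
    using distributed_integral[OF D, of "\<lambda>x. x\<^sup>2"] integral_normal_moment_even[OF \<sigma>, of 0 1] assms
    by simp
qed

text \<open>Collected by cells, the product has exponents \<open>e j\<close> in {0, 1, 2} and
  factors by independence. Exponent 2 contributes the variance, exponent 0 the value 1, and a single
  exponent 1 kills the product because the increment is centred.\<close>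

lemma expectation_increment_products:
  assumes t: "strict_mono_on {..n} t" and PQ: "P \<subseteq> {..<n}" "Q \<subseteq> {..<n}"
  defines "D \<equiv> \<lambda>j \<omega>. B (t (Suc j)) \<omega> - B (t j) \<omega>"
  shows "integrable M (\<lambda>\<omega>. (\<Prod>j\<in>P. D j \<omega>) * (\<Prod>j\<in>Q. D j \<omega>))"
    "expectation (\<lambda>\<omega>. (\<Prod>j\<in>P. D j \<omega>) * (\<Prod>j\<in>Q. D j \<omega>)) =
       (if P = Q then \<Prod>j\<in>P. t (Suc j) - t j else 0)"
proof -
  define e :: "nat \<Rightarrow> nat" where "e j = of_bool (j \<in> P) + of_bool (j \<in> Q)" for j
  have lt: "t j < t (Suc j)" if "j < n" for j
    using that by (intro strict_mono_onD[OF t]) auto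
  have eq: "(\<Prod>j\<in>P. D j \<omega>) * (\<Prod>j\<in>Q. D j \<omega>) = (\<Prod>j<n. D j \<omega> ^ e j)" for \<omega>
  proof -
    have "(\<Prod>j\<in>A. D j \<omega>) = (\<Prod>j<n. D j \<omega> ^ of_bool (j \<in> A))" if "A \<subseteq> {..<n}" for A
      using that by (intro prod.mono_neutral_cong_left) auto
    from this[OF PQ(1)] this[OF PQ(2)] show ?thesis
      by (simp add: e_def power_add prod.distrib)
  qed
  have ind: "indep_vars (\<lambda>_. borel) (\<lambda>j \<omega>. D j \<omega> ^ e j) {..<n}"
    using indep_vars_compose2[OF indep_increments[OF t], of "\<lambda>j x. x ^ e j" "\<lambda>_. borel"]
    unfolding D_def by simp
  have int: "integrable M (\<lambda>\<omega>. D j \<omega> ^ e j)" if "j \<in> {..<n}" for j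
    unfolding D_def using increment_moments(1)[OF lt] that by auto
  show "integrable M (\<lambda>\<omega>. (\<Prod>j\<in>P. D j \<omega>) * (\<Prod>j\<in>Q. D j \<omega>))"
    unfolding eq by (rule indep_vars_integrable[OF _ ind int]) auto
  have "expectation (\<lambda>\<omega>. (\<Prod>j\<in>P. D j \<omega>) * (\<Prod>j\<in>Q. D j \<omega>)) =
      (\<Prod>j<n. expectation (\<lambda>\<omega>. D j \<omega> ^ e j))"
    unfolding eq by (rule indep_vars_lebesgue_integral[OF _ ind int]) auto
  also have "\<dots> = (if P = Q then \<Prod>j\<in>P. t (Suc j) - t j else 0)"
  proof (cases "P = Q")
    case True
    have "expectation (\<lambda>\<omega>. D j \<omega> ^ e j) = (if j \<in> P then t (Suc j) - t j else 1)" if "j < n" for j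
      using increment_moments(3)[OF lt[OF that]] True by (simp add: e_def D_def prob_space power2_eq_square)
    then have "(\<Prod>j<n. expectation (\<lambda>\<omega>. D j \<omega> ^ e j)) = (\<Prod>j<n. if j \<in> P then t (Suc j) - t j else 1)"
      by (intro prod.cong) auto
    also have "\<dots> = (\<Prod>j\<in>P. t (Suc j) - t j)"
      using PQ by (intro prod.mono_neutral_cong_right) auto
    finally show ?thesis using True by simp
  next
    case False
    then obtain j where j: "j \<in> P \<and> j \<notin> Q \<or> j \<in> Q \<and> j \<notin> P" by blast
    then have "j < n" "e j = 1" using PQ by (auto simp: e_def)
    then have "expectation (\<lambda>\<omega>. D j \<omega> ^ e j) = 0"
      using increment_moments(2)[OF lt] by (simp add: D_def)
    then have "(\<Prod>j<n. expectation (\<lambda>\<omega>. D j \<omega> ^ e j)) = 0"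
      using \<open>j < n\<close> by (intro prod_zero) auto
    then show ?thesis using False by simp
  qed
  finally show "expectation (\<lambda>\<omega>. (\<Prod>j\<in>P. D j \<omega>) * (\<Prod>j\<in>Q. D j \<omega>)) =
       (if P = Q then \<Prod>j\<in>P. t (Suc j) - t j else 0)" .
qed

end

text \<open>Multi-indices with one and the same range share their product of increments, so these
  are the terms that fail to be orthogonal in the isometry bound. They are maps into a set of at
  most \<open>k\<close> points.\<close>

lemma card_offdiag_same_range:
  "card {q \<in> offdiag_indices k n. q ` {..<k} = p ` {..<k}} \<le> k ^ k"
proof -
  have "card {q \<in> offdiag_indices k n. q ` {..<k} = p ` {..<k}} \<le> card ({..<k} \<rightarrow>\<^sub>E p ` {..<k})"
    by (intro card_mono finite_PiE) (auto simp: offdiag_indices_def PiE_iff extensional_def)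
  also have "\<dots> = card (p ` {..<k}) ^ k" by (simp add: card_PiE)
  also have "\<dots> \<le> k ^ k" using card_image_le[of "{..<k}" p] by (intro power_mono) auto
  finally show ?thesis .
qed

text \<open>Two distinct multi-indices differ in a coordinate where their cells are disjoint, hence
  the box indicators \<xi> are idempotent and mutually orthogonal. The square reduces to the
  diagonal terms, weighted by box volumes.\<close>

lemma nn_integral_offdiag_step_square:
  assumes t: "strict_mono_on {..n} t"
  shows "(\<integral>\<^sup>+x. ennreal ((offdiag_step k n t a x)\<^sup>2) \<partial>lborel_pow k) =
    ennreal (\<Sum>p\<in>offdiag_indices k n. (a p)\<^sup>2 * (\<Prod>i<k. t (Suc (p i)) - t (p i)))"
proof -
  interpret product_sigma_finite "\<lambda>_. lborel :: real measure" by standard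
  let ?O = "offdiag_indices k n"
  define \<xi> :: "(nat \<Rightarrow> nat) \<Rightarrow> (nat \<Rightarrow> real) \<Rightarrow> real"
    where "\<xi> p x = (\<Prod>i<k. indicator {t (p i)<..t (Suc (p i))} (x i))" for p x
  have lt: "t (p i) < t (Suc (p i))" if "p \<in> ?O" "i < k" for p i
    using offdiag_indices_D(1)[OF that] by (intro strict_mono_onD[OF t]) auto
  have \<xi>2: "\<xi> p x * \<xi> q x = (if p = q then \<xi> p x else 0)" if pq: "p \<in> ?O" "q \<in> ?O" for p q x
  proof (cases "p = q")
    case True
    then show ?thesis by (auto simp: \<xi>_def indicator_def simp flip: prod.distrib intro!: prod.cong)
  next
    case False
    then obtain i where i: "i < k" "p i \<noteq> q i"
      using pq by (metis PiE_ext lessThan_iff offdiag_indices_D(3))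
    then have "{t (p i)<..t (Suc (p i))} \<inter> {t (q i)<..t (Suc (q i))} = {}"
      using offdiag_indices_D(1) pq by (intro grid_cells_disjoint[OF t]) auto
    then have "indicator {t (p i)<..t (Suc (p i))} (x i) * indicator {t (q i)<..t (Suc (q i))} (x i) = (0 :: real)"
      by (auto simp: indicator_def)
    then have "\<xi> p x * \<xi> q x = 0"
      unfolding \<xi>_def prod.distrib[symmetric] using i by (intro prod_zero) auto
    then show ?thesis using False by simp
  qed
  have "(offdiag_step k n t a x)\<^sup>2 = (\<Sum>p\<in>?O. (a p)\<^sup>2 * \<xi> p x)" for x
  proof -
    have "(offdiag_step k n t a x)\<^sup>2 = (\<Sum>p\<in>?O. \<Sum>q\<in>?O. a p * a q * (\<xi> p x * \<xi> q x))"
      unfolding offdiag_step_def \<xi>_def[symmetric] power2_eq_square sum_product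
      by (simp add: mult_ac)
    also have "\<dots> = (\<Sum>p\<in>?O. \<Sum>q\<in>?O. if p = q then (a p)\<^sup>2 * \<xi> p x else 0)"
      by (intro sum.cong refl) (auto simp: \<xi>2 power2_eq_square)
    finally show ?thesis by simp
  qed
  then have "(\<integral>\<^sup>+x. ennreal ((offdiag_step k n t a x)\<^sup>2) \<partial>lborel_pow k) =
      (\<integral>\<^sup>+x. (\<Sum>p\<in>?O. ennreal ((a p)\<^sup>2) * (\<Prod>i<k. indicator {t (p i)<..t (Suc (p i))} (x i))) \<partial>lborel_pow k)"
    by (simp add: \<xi>_def prod_nonneg ennreal_mult' flip: sum_ennreal prod_ennreal ennreal_indicator)
  also have "\<dots> = (\<Sum>p\<in>?O. ennreal ((a p)\<^sup>2) *
      (\<integral>\<^sup>+x. (\<Prod>i<k. indicator {t (p i)<..t (Suc (p i))} (x i)) \<partial>lborel_pow k))"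
  proof -
    have [measurable]: "(\<lambda>x. x i) \<in> borel_measurable (lborel_pow k)" if "i < k" for i
      using measurable_component_singleton[of i "{..<k}" "\<lambda>_. lborel"] that by simp
    have "(\<lambda>x. \<Prod>i<k. indicator {t (p i)<..t (Suc (p i))} (x i) :: ennreal) \<in> borel_measurable (lborel_pow k)" for p
      by (intro borel_measurable_prod_ennreal) (auto intro!: measurable_compose[OF _ borel_measurable_indicator])
    then show ?thesis by (simp add: nn_integral_sum nn_integral_cmult)
  qed
  also have "\<dots> = (\<Sum>p\<in>?O. ennreal ((a p)\<^sup>2) * (\<Prod>i<k. ennreal (t (Suc (p i)) - t (p i))))"
  proof (intro sum.cong refl arg_cong2[where f="(*)"])
    fix p assume p: "p \<in> ?O"
    have "(\<integral>\<^sup>+x. (\<Prod>i<k. indicator {t (p i)<..t (Suc (p i))} (x i)) \<partial>lborel_pow k) =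
       (\<Prod>i<k. \<integral>\<^sup>+x. indicator {t (p i)<..t (Suc (p i))} x \<partial>lborel)"
      by (intro product_nn_integral_prod) auto
    also have "\<dots> = (\<Prod>i<k. ennreal (t (Suc (p i)) - t (p i)))"
      using lt[OF p] by (intro prod.cong) (auto simp: less_imp_le)
    finally show "(\<integral>\<^sup>+x. (\<Prod>i<k. indicator {t (p i)<..t (Suc (p i))} (x i)) \<partial>lborel_pow k) =
      (\<Prod>i<k. ennreal (t (Suc (p i)) - t (p i)))" .
  qed
  also have "\<dots> = (\<Sum>p\<in>?O. ennreal ((a p)\<^sup>2 * (\<Prod>i<k. t (Suc (p i)) - t (p i))))"
  proof (intro sum.cong refl)
    fix p assume p: "p \<in> ?O"
    have *: "\<And>i. i \<in> {..<k} \<Longrightarrow> 0 \<le> t (Suc (p i)) - t (p i)" using lt[OF p] by (simp add: less_imp_le)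
    then have "ennreal ((a p)\<^sup>2 * (\<Prod>i<k. t (Suc (p i)) - t (p i))) =
        ennreal ((a p)\<^sup>2) * ennreal (\<Prod>i<k. t (Suc (p i)) - t (p i))"
      by (intro ennreal_mult prod_nonneg) auto
    then show "ennreal ((a p)\<^sup>2) * (\<Prod>i<k. ennreal (t (Suc (p i)) - t (p i))) =
        ennreal ((a p)\<^sup>2 * (\<Prod>i<k. t (Suc (p i)) - t (p i)))"
      using * by (simp only: prod_ennreal)
  qed
  also have "\<dots> = ennreal (\<Sum>p\<in>?O. (a p)\<^sup>2 * (\<Prod>i<k. t (Suc (p i)) - t (p i)))"
    using lt by (intro sum_ennreal) (auto intro!: mult_nonneg_nonneg prod_nonneg simp: less_imp_le)
  finally show ?thesis .
qed

context brownian_increments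
begin

text \<open>The sharp constant is \<open>k!\<close>; only boundedness of the map matters.\<close>

lemma simple_pair_isometry_bound:
  assumes "simple_pair k \<phi> F"
  shows "(\<integral>\<^sup>+\<omega>. ennreal ((F (\<lambda>s. B s \<omega>))\<^sup>2) \<partial>M) \<le>
    ennreal (real (k ^ k)) * (\<integral>\<^sup>+x. ennreal ((\<phi> x)\<^sup>2) \<partial>lborel_pow k)"
proof -
  obtain n :: nat and t a where t: "strict_mono_on {..n} t" and
    \<phi>: "\<phi> = offdiag_step k n t a" and F: "F = offdiag_step_integral (\<lambda>s b. b s) k n t a"
    by (rule simple_pairs_common_grid[of "{0 :: nat}" k "\<lambda>_. \<phi>" "\<lambda>_. F"]) (use assms in auto)
  let ?O = "offdiag_indices k n"
  define D where "D j \<omega> = B (t (Suc j)) \<omega> - B (t j) \<omega>" for j \<omega>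
  \<comment> \<open>Since \<open>p\<close> is injective, its product of increments depends on the
    range of \<open>p\<close> alone; writing it over the range matches
    \<open>expectation_increment_products\<close>.\<close>
  define X where "X p \<omega> = (\<Prod>j\<in>p ` {..<k}. D j \<omega>)" for p \<omega>
  define \<delta> where "\<delta> p = (\<Prod>i<k. t (Suc (p i)) - t (p i))" for p
  have lt: "t (p i) < t (Suc (p i))" if "p \<in> ?O" "i < k" for p i
    using offdiag_indices_D(1)[OF that] by (intro strict_mono_onD[OF t]) auto
  have \<delta>: "0 \<le> \<delta> p" if "p \<in> ?O" for p
    unfolding \<delta>_def using lt[OF that] by (intro prod_nonneg) (auto simp: less_imp_le)
  have \<delta>': "\<delta> p = (\<Prod>j\<in>p ` {..<k}. t (Suc j) - t j)" if "p \<in> ?O" for p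
    unfolding \<delta>_def using offdiag_indices_D(2)[OF that] by (simp add: prod.reindex)
  have sub: "p ` {..<k} \<subseteq> {..<n}" if "p \<in> ?O" for p
    using offdiag_indices_D(1)[OF that] by auto
  have FX: "F (\<lambda>s. B s \<omega>) = (\<Sum>p\<in>?O. a p * X p \<omega>)" for \<omega>
    unfolding F offdiag_step_integral_def X_def D_def
    by (intro sum.cong refl arg_cong2[where f="(*)"], subst prod.reindex)
      (auto dest: offdiag_indices_D)
  have F2: "(F (\<lambda>s. B s \<omega>))\<^sup>2 = (\<Sum>p\<in>?O. \<Sum>q\<in>?O. (a p * a q) * (X p \<omega> * X q \<omega>))" for \<omega>
    unfolding FX power2_eq_square sum_product by (simp add: mult_ac)
  have XX: "integrable M (\<lambda>\<omega>. X p \<omega> * X q \<omega>)"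
    "expectation (\<lambda>\<omega>. X p \<omega> * X q \<omega>) = (if p ` {..<k} = q ` {..<k} then \<delta> p else 0)"
    if "p \<in> ?O" "q \<in> ?O" for p q
    using expectation_increment_products[OF t sub[OF that(1)] sub[OF that(2)]] \<delta>'[OF that(1)]
    unfolding X_def D_def by simp_all
  have "expectation (\<lambda>\<omega>. (F (\<lambda>s. B s \<omega>))\<^sup>2) =
      (\<Sum>p\<in>?O. \<Sum>q\<in>?O. (a p * a q) * (if p ` {..<k} = q ` {..<k} then \<delta> p else 0))"
    unfolding F2 using XX by (simp add: Bochner_Integration.integral_sum)
  \<comment> \<open>The two halves are equal by exchanging \<open>p\<close> and \<open>q\<close>, as
    \<open>\<delta>\<close> depends on the range only. What remains counts, for each
    \<open>p\<close>, the multi-indices with its range.\<close>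
  also have "\<dots> \<le> (\<Sum>p\<in>?O. \<Sum>q\<in>?O. ((a p)\<^sup>2 / 2 + (a q)\<^sup>2 / 2) * (if p ` {..<k} = q ` {..<k} then \<delta> p else 0))"
  proof (intro sum_mono mult_right_mono)
    show "a p * a q \<le> (a p)\<^sup>2 / 2 + (a q)\<^sup>2 / 2" for p q
      using sum_squares_bound[of "a p" "a q"] by simp
  qed (use \<delta> in auto)
  also have "\<dots> = (\<Sum>p\<in>?O. \<Sum>q\<in>?O. (a p)\<^sup>2 / 2 * (if p ` {..<k} = q ` {..<k} then \<delta> p else 0)) +
     (\<Sum>p\<in>?O. \<Sum>q\<in>?O. (a q)\<^sup>2 / 2 * (if p ` {..<k} = q ` {..<k} then \<delta> p else 0))"
    by (simp add: distrib_right sum.distrib)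
  also have "(\<Sum>p\<in>?O. \<Sum>q\<in>?O. (a q)\<^sup>2 / 2 * (if p ` {..<k} = q ` {..<k} then \<delta> p else 0)) =
     (\<Sum>p\<in>?O. \<Sum>q\<in>?O. (a p)\<^sup>2 / 2 * (if p ` {..<k} = q ` {..<k} then \<delta> p else 0))"
    by (subst sum.swap, intro sum.cong refl) (auto simp: \<delta>')
  also have "(\<Sum>p\<in>?O. \<Sum>q\<in>?O. (a p)\<^sup>2 / 2 * (if p ` {..<k} = q ` {..<k} then \<delta> p else 0)) + \<dots> =
     (\<Sum>p\<in>?O. (a p)\<^sup>2 * \<delta> p * real (card {q \<in> ?O. q ` {..<k} = p ` {..<k}}))"
    unfolding sum.distrib[symmetric]
  proof (intro sum.cong refl)
    fix p assume p: "p \<in> ?O"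
    have "(\<Sum>q\<in>?O. (a p)\<^sup>2 / 2 * (if p ` {..<k} = q ` {..<k} then \<delta> p else 0) +
             (a p)\<^sup>2 / 2 * (if p ` {..<k} = q ` {..<k} then \<delta> p else 0)) =
          (\<Sum>q\<in>{q \<in> ?O. q ` {..<k} = p ` {..<k}}. (a p)\<^sup>2 * \<delta> p)"
      by (intro sum.mono_neutral_cong_right) auto
    then show "(\<Sum>q\<in>?O. (a p)\<^sup>2 / 2 * (if p ` {..<k} = q ` {..<k} then \<delta> p else 0) +
             (a p)\<^sup>2 / 2 * (if p ` {..<k} = q ` {..<k} then \<delta> p else 0)) =
          (a p)\<^sup>2 * \<delta> p * real (card {q \<in> ?O. q ` {..<k} = p ` {..<k}})" by simp
  qed
  also have "\<dots> \<le> (\<Sum>p\<in>?O. (a p)\<^sup>2 * \<delta> p * real (k ^ k))"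
    using card_offdiag_same_range \<delta>
    by (intro sum_mono mult_left_mono) (auto intro!: mult_nonneg_nonneg simp del: of_nat_power)
  also have "\<dots> = real (k ^ k) * (\<Sum>p\<in>?O. (a p)\<^sup>2 * \<delta> p)"
    by (simp add: sum_distrib_left mult_ac)
  finally have *: "expectation (\<lambda>\<omega>. (F (\<lambda>s. B s \<omega>))\<^sup>2) \<le> real (k ^ k) * (\<Sum>p\<in>?O. (a p)\<^sup>2 * \<delta> p)" .
  have "integrable M (\<lambda>\<omega>. (F (\<lambda>s. B s \<omega>))\<^sup>2)"
    unfolding F2 using XX by auto
  then have "(\<integral>\<^sup>+\<omega>. ennreal ((F (\<lambda>s. B s \<omega>))\<^sup>2) \<partial>M) = ennreal (expectation (\<lambda>\<omega>. (F (\<lambda>s. B s \<omega>))\<^sup>2))"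
    by (intro nn_integral_eq_integral) auto
  also have "\<dots> \<le> ennreal (real (k ^ k) * (\<Sum>p\<in>?O. (a p)\<^sup>2 * \<delta> p))"
    using * by (rule ennreal_leI)
  also have "\<dots> = ennreal (real (k ^ k)) * (\<integral>\<^sup>+x. ennreal ((\<phi> x)\<^sup>2) \<partial>lborel_pow k)"
    unfolding \<phi> nn_integral_offdiag_step_square[OF t] \<delta>_def[symmetric]
    by (intro ennreal_mult) (auto intro!: sum_nonneg mult_nonneg_nonneg \<delta>)
  finally show ?thesis .
qed

text \<open>An increasing affine map keeps the order of the time points, and stretching time by
  \<open>c\<close> multiplies variances by \<open>c\<close>, which the division by
  \<open>sqrt c\<close> undoes.\<close>

lemma brownian_increments_affine:
  assumes c: "c > 0"
  shows "brownian_increments M (\<lambda>s \<omega>. B (c * s + h) \<omega> / sqrt c)"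
proof
  show "(\<lambda>\<omega>. B (c * t + h) \<omega> / sqrt c) \<in> borel_measurable M" for t by measurable
  show "indep_vars (\<lambda>_. borel) (\<lambda>i \<omega>. B (c * \<tau> (Suc i) + h) \<omega> / sqrt c - B (c * \<tau> i + h) \<omega> / sqrt c) {..<n}"
    if "strict_mono_on {..n} \<tau>" for n :: nat and \<tau>
  proof -
    have "strict_mono_on {..n} (\<lambda>i. c * \<tau> i + h)"
      using that c by (auto simp: monotone_on_def)
    from indep_vars_compose2[OF indep_increments[OF this], of "\<lambda>_ x. x / sqrt c" "\<lambda>_. borel"]
    show ?thesis by (simp add: diff_divide_distrib)
  qed
  show "distributed M lborel (\<lambda>\<omega>. B (c * t + h) \<omega> / sqrt c - B (c * s + h) \<omega> / sqrt c)
     (normal_density 0 (sqrt (t - s)))" if "s < t" for s t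
  proof -
    have lt: "c * s + h < c * t + h" using that c by simp
    have "\<bar>1 / sqrt c\<bar> * sqrt (c * t + h - (c * s + h)) = sqrt (t - s)"
      using c by (simp add: right_diff_distrib[symmetric] real_sqrt_mult)
    then show ?thesis
      using normal_density_affine[OF normal_increments[OF lt], of "1 / sqrt c" 0] lt c
      by (simp add: diff_divide_distrib)
  qed
qed

end

section \<open>Density of the off-diagonal step functions\<close>

lemma nn_integral_square_add_le:
  fixes f g :: "'a \<Rightarrow> real"
  assumes [measurable]: "f \<in> borel_measurable M" "g \<in> borel_measurable M"
  shows "(\<integral>\<^sup>+x. ennreal ((f x + g x)\<^sup>2) \<partial>M) \<le>
    2 * (\<integral>\<^sup>+x. ennreal ((f x)\<^sup>2) \<partial>M) + 2 * (\<integral>\<^sup>+x. ennreal ((g x)\<^sup>2) \<partial>M)"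
proof -
  have "(\<integral>\<^sup>+x. ennreal ((f x + g x)\<^sup>2) \<partial>M) \<le>
      (\<integral>\<^sup>+x. 2 * ennreal ((f x)\<^sup>2) + 2 * ennreal ((g x)\<^sup>2) \<partial>M)"
  proof (intro nn_integral_mono)
    fix x
    have "(f x + g x)\<^sup>2 \<le> 2 * (f x)\<^sup>2 + 2 * (g x)\<^sup>2"
      using sum_squares_bound[of "f x" "g x"] by (simp add: power2_sum)
    then have "ennreal ((f x + g x)\<^sup>2) \<le> ennreal (2 * (f x)\<^sup>2 + 2 * (g x)\<^sup>2)" by (rule ennreal_leI)
    then show "ennreal ((f x + g x)\<^sup>2) \<le> 2 * ennreal ((f x)\<^sup>2) + 2 * ennreal ((g x)\<^sup>2)"
      by (simp add: ennreal_mult'')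
  qed
  then show ?thesis by (simp add: nn_integral_add nn_integral_cmult)
qed

lemma tendsto_0_ennreal_le:
  fixes f g :: "nat \<Rightarrow> ennreal"
  assumes "f \<longlonglongrightarrow> 0" "g \<longlonglongrightarrow> 0" "\<And>n. h n \<le> 2 * f n + 2 * g n"
  shows "h \<longlonglongrightarrow> 0"
proof (rule tendsto_sandwich[OF _ _ tendsto_const])
  have "(\<lambda>n. 2 * f n + 2 * g n) \<longlonglongrightarrow> 2 * 0 + 2 * 0"
    using assms(1,2) by (intro tendsto_add ennreal_tendsto_cmult) auto
  then show "(\<lambda>n. 2 * f n + 2 * g n) \<longlonglongrightarrow> 0" by simp
qed (use assms(3) in auto)

lemma L2_tendsto_add:
  assumes "L2_tendsto M F f" "L2_tendsto M G g"
    and [measurable]: "\<And>n. F n \<in> borel_measurable M" "\<And>n. G n \<in> borel_measurable M"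
      "f \<in> borel_measurable M" "g \<in> borel_measurable M"
  shows "L2_tendsto M (\<lambda>n x. F n x + G n x) (\<lambda>x. f x + g x)"
  unfolding L2_tendsto_def
proof (rule tendsto_0_ennreal_le[OF assms(1,2)[unfolded L2_tendsto_def]])
  fix n
  have "(\<integral>\<^sup>+x. ennreal ((F n x + G n x - (f x + g x))\<^sup>2) \<partial>M) =
      (\<integral>\<^sup>+x. ennreal (((F n x - f x) + (G n x - g x))\<^sup>2) \<partial>M)"
    by (simp add: algebra_simps)
  also have "\<dots> \<le> 2 * (\<integral>\<^sup>+x. ennreal ((F n x - f x)\<^sup>2) \<partial>M) + 2 * (\<integral>\<^sup>+x. ennreal ((G n x - g x)\<^sup>2) \<partial>M)"
    by (rule nn_integral_square_add_le) auto
  finally show "(\<integral>\<^sup>+x. ennreal ((F n x + G n x - (f x + g x))\<^sup>2) \<partial>M) \<le>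
    2 * (\<integral>\<^sup>+x. ennreal ((F n x - f x)\<^sup>2) \<partial>M) + 2 * (\<integral>\<^sup>+x. ennreal ((G n x - g x)\<^sup>2) \<partial>M)" .
qed

lemma L2_tendsto_cmult:
  assumes "L2_tendsto M F f"
    and [measurable]: "\<And>n. F n \<in> borel_measurable M" "f \<in> borel_measurable M"
  shows "L2_tendsto M (\<lambda>n x. c * F n x) (\<lambda>x. c * f x)"
proof -
  have "(\<integral>\<^sup>+x. ennreal ((c * F n x - c * f x)\<^sup>2) \<partial>M) =
      ennreal (c\<^sup>2) * (\<integral>\<^sup>+x. ennreal ((F n x - f x)\<^sup>2) \<partial>M)" for n
    by (simp add: power_mult_distrib ennreal_mult' nn_integral_cmult flip: right_diff_distrib)
  moreover have "(\<lambda>n. ennreal (c\<^sup>2) * (\<integral>\<^sup>+x. ennreal ((F n x - f x)\<^sup>2) \<partial>M)) \<longlonglongrightarrow> ennreal (c\<^sup>2) * 0"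
    using assms(1) unfolding L2_tendsto_def by (intro ennreal_tendsto_cmult) auto
  ultimately show ?thesis unfolding L2_tendsto_def by simp
qed

lemma L2_tendsto_diagonal:
  assumes "L2_tendsto M G f" "(\<lambda>n. \<integral>\<^sup>+x. ennreal ((F n x - G n x)\<^sup>2) \<partial>M) \<longlonglongrightarrow> 0"
    and [measurable]: "\<And>n. F n \<in> borel_measurable M" "\<And>n. G n \<in> borel_measurable M"
      "f \<in> borel_measurable M"
  shows "L2_tendsto M F f"
  unfolding L2_tendsto_def
proof (rule tendsto_0_ennreal_le[OF assms(2) assms(1)[unfolded L2_tendsto_def]])
  fix n
  show "(\<integral>\<^sup>+x. ennreal ((F n x - f x)\<^sup>2) \<partial>M) \<le>
    2 * (\<integral>\<^sup>+x. ennreal ((F n x - G n x)\<^sup>2) \<partial>M) + 2 * (\<integral>\<^sup>+x. ennreal ((G n x - f x)\<^sup>2) \<partial>M)"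
    using nn_integral_square_add_le[of "\<lambda>x. F n x - G n x" M "\<lambda>x. G n x - f x"] by simp
qed

lemma L2_tendsto_dominated:
  assumes [measurable]: "\<And>n. F n \<in> borel_measurable M" "f \<in> borel_measurable M"
      "w \<in> borel_measurable M"
    and bound: "\<And>n x. x \<in> space M \<Longrightarrow> \<bar>F n x - f x\<bar> \<le> w x"
    and w: "(\<integral>\<^sup>+x. ennreal ((w x)\<^sup>2) \<partial>M) < \<infinity>"
    and lim: "AE x in M. (\<lambda>n. F n x) \<longlonglongrightarrow> f x"
  shows "L2_tendsto M F f"
proof -
  have "(\<lambda>n. \<integral>\<^sup>+x. ennreal ((F n x - f x)\<^sup>2) \<partial>M) \<longlonglongrightarrow> (\<integral>\<^sup>+x. 0 \<partial>M)"
  proof (rule nn_integral_dominated_convergence[OF _ _ _ _ w])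
    show "AE x in M. (\<lambda>n. ennreal ((F n x - f x)\<^sup>2)) \<longlonglongrightarrow> 0"
      using lim
    proof eventually_elim
      case (elim x)
      then have "(\<lambda>n. ennreal ((F n x - f x)\<^sup>2)) \<longlonglongrightarrow> ennreal ((f x - f x)\<^sup>2)"
        by (intro tendsto_intros tendsto_ennrealI)
      then show ?case by simp
    qed
    show "AE x in M. ennreal ((F n x - f x)\<^sup>2) \<le> ennreal ((w x)\<^sup>2)" for n
    proof (rule AE_I2, rule ennreal_leI)
      fix x assume "x \<in> space M"
      then show "(F n x - f x)\<^sup>2 \<le> (w x)\<^sup>2"
        using power_mono[OF bound abs_ge_zero, of x n 2] by simp
    qed
  qed auto
  then show ?thesis by (simp add: L2_tendsto_def)
qed

text \<open>The closure of the off-diagonal step functions under L2 limits. The rules that follow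
  are those consumed by an induction over measurable sets.\<close>

definition simple_approximable :: "nat \<Rightarrow> ((nat \<Rightarrow> real) \<Rightarrow> real) \<Rightarrow> bool" where
  "simple_approximable k f \<longleftrightarrow> f \<in> borel_measurable (lborel_pow k) \<and>
     (\<exists>\<phi> F. (\<forall>m. simple_pair k (\<phi> m) (F m)) \<and> L2_tendsto (lborel_pow k) \<phi> f)"

lemma simple_approximableI:
  assumes "\<And>m. simple_pair k (\<phi> m) (F m)" "L2_tendsto (lborel_pow k) \<phi> f"
    "f \<in> borel_measurable (lborel_pow k)"
  shows "simple_approximable k f"
  using assms unfolding simple_approximable_def by (intro conjI exI[of _ \<phi>] exI[of _ F]) simp_all

lemma simple_approximableE:
  assumes "simple_approximable k f"
  obtains \<phi> F where "\<And>m. simple_pair k (\<phi> m) (F m)" "L2_tendsto (lborel_pow k) \<phi> f"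
    "f \<in> borel_measurable (lborel_pow k)"
  using assms unfolding simple_approximable_def by auto

lemma simple_approximable_zero: "simple_approximable k (\<lambda>_. 0)"
  by (rule simple_approximableI[OF simple_pair.zero]) (simp_all add: L2_tendsto_def)

lemma simple_approximable_add:
  assumes "simple_approximable k f" "simple_approximable k g"
  shows "simple_approximable k (\<lambda>x. f x + g x)"
proof -
  obtain \<phi> F where 1: "\<And>m. simple_pair k (\<phi> m) (F m)" "L2_tendsto (lborel_pow k) \<phi> f"
    "f \<in> borel_measurable (lborel_pow k)" by (rule simple_approximableE[OF assms(1)]) auto
  obtain \<psi> G where 2: "\<And>m. simple_pair k (\<psi> m) (G m)" "L2_tendsto (lborel_pow k) \<psi> g"
    "g \<in> borel_measurable (lborel_pow k)" by (rule simple_approximableE[OF assms(2)]) auto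
  show ?thesis
    using 1 2 simple_pair_measurable
    by (intro simple_approximableI[OF simple_pair_add[OF 1(1) 2(1)]] L2_tendsto_add) auto
qed

lemma simple_approximable_cmult:
  assumes "simple_approximable k f"
  shows "simple_approximable k (\<lambda>x. c * f x)"
proof -
  obtain \<phi> F where 1: "\<And>m. simple_pair k (\<phi> m) (F m)" "L2_tendsto (lborel_pow k) \<phi> f"
    "f \<in> borel_measurable (lborel_pow k)" by (rule simple_approximableE[OF assms]) auto
  show ?thesis
    using 1 simple_pair_measurable
    by (intro simple_approximableI[OF simple_pair_scale[OF 1(1), where d=c]] L2_tendsto_cmult) auto
qed

lemma simple_approximable_sum:
  assumes "finite I" "\<And>i. i \<in> I \<Longrightarrow> simple_approximable k (f i)"
  shows "simple_approximable k (\<lambda>x. \<Sum>i\<in>I. f i x)"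
  using assms
  by (induction I rule: finite_induct) (auto intro: simple_approximable_zero simple_approximable_add)

text \<open>Points of the product space are extensional, and identities such as that for the
  indicator of a complement hold for these points only.\<close>

lemma simple_approximable_cong:
  assumes "simple_approximable k f" "\<And>x. x \<in> space (lborel_pow k) \<Longrightarrow> f x = g x"
  shows "simple_approximable k g"
proof -
  obtain \<phi> F where 1: "\<And>m. simple_pair k (\<phi> m) (F m)" "L2_tendsto (lborel_pow k) \<phi> f"
    "f \<in> borel_measurable (lborel_pow k)" by (rule simple_approximableE[OF assms(1)]) auto
  have "(\<integral>\<^sup>+x. ennreal ((\<phi> m x - f x)\<^sup>2) \<partial>lborel_pow k) =
      (\<integral>\<^sup>+x. ennreal ((\<phi> m x - g x)\<^sup>2) \<partial>lborel_pow k)" for m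
    using assms(2) by (intro nn_integral_cong) simp
  then have 2: "L2_tendsto (lborel_pow k) \<phi> g"
    using 1(2) unfolding L2_tendsto_def by simp
  have "g \<in> borel_measurable (lborel_pow k)"
    using 1(3) measurable_cong[of "lborel_pow k" f g borel, OF assms(2)] by simp
  with 1(1) 2 show ?thesis by (rule simple_approximableI)
qed

text \<open>A diagonal choice: for each \<open>n\<close> a step function is taken within
  \<open>1 / Suc n\<close> of \<open>g n\<close> in squared L2 distance.\<close>

lemma simple_approximable_limit:
  assumes g: "\<And>n. simple_approximable k (g n)" and lim: "L2_tendsto (lborel_pow k) g f"
    and f: "f \<in> borel_measurable (lborel_pow k)"
  shows "simple_approximable k f"
proof -
  have meas: "g n \<in> borel_measurable (lborel_pow k)" for n
    using g by (simp add: simple_approximable_def)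
  have "\<exists>pr. simple_pair k (fst pr) (snd pr) \<and>
     (\<integral>\<^sup>+x. ennreal ((fst pr x - g n x)\<^sup>2) \<partial>lborel_pow k) < ennreal (1 / real (Suc n))" for n
  proof -
    obtain \<phi> F where 1: "\<And>m. simple_pair k (\<phi> m) (F m)" "L2_tendsto (lborel_pow k) \<phi> (g n)"
      "g n \<in> borel_measurable (lborel_pow k)" by (rule simple_approximableE[OF g[of n]]) (rule that)
    have "eventually (\<lambda>m. (\<integral>\<^sup>+x. ennreal ((\<phi> m x - g n x)\<^sup>2) \<partial>lborel_pow k) < ennreal (1 / real (Suc n))) sequentially"
      using 1(2) unfolding L2_tendsto_def by (rule order_tendstoD) simp
    then have "\<exists>m. (\<integral>\<^sup>+x. ennreal ((\<phi> m x - g n x)\<^sup>2) \<partial>lborel_pow k) < ennreal (1 / real (Suc n))"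
      by (rule eventually_happens'[OF sequentially_bot])
    then obtain m where "(\<integral>\<^sup>+x. ennreal ((\<phi> m x - g n x)\<^sup>2) \<partial>lborel_pow k) < ennreal (1 / real (Suc n))" ..
    with 1(1) show ?thesis by (intro exI[of _ "(\<phi> m, F m)"]) simp
  qed
  then have "\<exists>pr. \<forall>n. simple_pair k (fst (pr n)) (snd (pr n)) \<and>
     (\<integral>\<^sup>+x. ennreal ((fst (pr n) x - g n x)\<^sup>2) \<partial>lborel_pow k) < ennreal (1 / real (Suc n))"
    by (rule choice[OF allI])
  then obtain pr where pr': "\<forall>n. simple_pair k (fst (pr n)) (snd (pr n)) \<and>
     (\<integral>\<^sup>+x. ennreal ((fst (pr n) x - g n x)\<^sup>2) \<partial>lborel_pow k) < ennreal (1 / real (Suc n))" ..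
  have pr: "simple_pair k (fst (pr n)) (snd (pr n))"
    "(\<integral>\<^sup>+x. ennreal ((fst (pr n) x - g n x)\<^sup>2) \<partial>lborel_pow k) < ennreal (1 / real (Suc n))" for n
    using spec[OF pr', of n] by auto
  have "(\<lambda>n. ennreal (1 / real (Suc n))) \<longlonglongrightarrow> ennreal 0"
    by (intro tendsto_ennrealI) (use LIMSEQ_inverse_real_of_nat in \<open>simp add: inverse_eq_divide\<close>)
  then have lim0: "(\<lambda>n. ennreal (1 / real (Suc n))) \<longlonglongrightarrow> 0" by simp
  have "(\<lambda>n. \<integral>\<^sup>+x. ennreal ((fst (pr n) x - g n x)\<^sup>2) \<partial>lborel_pow k) \<longlonglongrightarrow> 0"
  proof (rule tendsto_sandwich[OF _ _ tendsto_const lim0])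
    show "\<forall>\<^sub>F n in sequentially. (\<integral>\<^sup>+x. ennreal ((fst (pr n) x - g n x)\<^sup>2) \<partial>lborel_pow k) \<le> ennreal (1 / real (Suc n))"
      by (intro always_eventually allI less_imp_le pr(2))
  qed simp
  then have "L2_tendsto (lborel_pow k) (\<lambda>n. fst (pr n)) f"
    by (rule L2_tendsto_diagonal[OF lim _ simple_pair_measurable[OF pr(1)] meas f])
  with pr(1) show ?thesis using f by (rule simple_approximableI)
qed

text \<open>Lower orthants form an intersection-stable generator. It drives two arguments: the
  density of step functions and the identification of laws on finite products.\<close>

lemma sets_PiM_borel_atMost:
  assumes "finite I"
  shows "sets (Pi\<^sub>M I (\<lambda>_. borel :: real measure)) =
    sigma_sets (PiE I (\<lambda>_. UNIV)) (range (\<lambda>\<rho>. PiE I (\<lambda>i. {..\<rho> i})))"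
proof -
  have "sets (Pi\<^sub>M I (\<lambda>_. borel :: real measure)) = sets (\<Pi>\<^sub>M i\<in>I. sigma UNIV (range atMost :: real set set))"
    by (simp add: borel_eq_atMost[symmetric])
  also have "\<dots> = sets (sigma (PiE I (\<lambda>_. UNIV))
     {{f\<in>(\<Pi>\<^sub>E i\<in>I. UNIV). \<forall>i\<in>j. f i \<in> A i} | A j. j \<in> {I} \<and> A \<in> Pi j (\<lambda>_. range atMost)})"
  proof (rule sets_PiM_sigma)
    show "\<exists>S\<subseteq>range (atMost :: real \<Rightarrow> _). countable S \<and> UNIV = \<Union>S"
    proof (intro exI[of _ "range (\<lambda>n::nat. {..real n})"] conjI)
      have "x \<in> \<Union> (range (\<lambda>n::nat. {..real n}))" for x
        using real_arch_simple[of x] by simp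
      then show "UNIV = \<Union> (range (\<lambda>n::nat. {..real n}))" by blast
    qed auto
  qed (use assms in auto)
  also have "{{f\<in>(\<Pi>\<^sub>E i\<in>I. UNIV). \<forall>i\<in>j. f i \<in> A i} | A j. j \<in> {I} \<and> A \<in> Pi j (\<lambda>_. range (atMost :: real \<Rightarrow> _))} =
      range (\<lambda>\<rho>. PiE I (\<lambda>i. {..\<rho> i}))" (is "?L = ?R")
  proof (intro set_eqI iffI)
    fix X assume "X \<in> ?L"
    then obtain A where A: "A \<in> Pi I (\<lambda>_. range (atMost :: real \<Rightarrow> _))"
      "X = {f\<in>(\<Pi>\<^sub>E i\<in>I. UNIV). \<forall>i\<in>I. f i \<in> A i}" by auto
    then have "\<forall>i\<in>I. \<exists>r. A i = {..r}" by auto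
    then obtain \<rho> where "\<forall>i\<in>I. A i = {..\<rho> i}" by (rule bchoice[THEN exE])
    then have "X = PiE I (\<lambda>i. {..\<rho> i})" using A(2) by (auto simp: PiE_iff extensional_def)
    then show "X \<in> ?R" by auto
  next
    fix X assume "X \<in> ?R"
    then obtain \<rho> where "X = PiE I (\<lambda>i. {..\<rho> i :: real})" by auto
    then have "X = {f\<in>(\<Pi>\<^sub>E i\<in>I. UNIV). \<forall>i\<in>I. f i \<in> {..\<rho> i}}"
      by (auto simp: PiE_iff extensional_def)
    then show "X \<in> ?L"
      by (intro CollectI exI[of _ "\<lambda>i. {..\<rho> i}"] exI[of _ I] conjI) auto
  qed
  finally show ?thesis by (subst (asm) sets_measure_of) (auto simp: PiE_iff)
qed

lemma Int_stable_PiE_atMost: "Int_stable (range (\<lambda>\<rho>. PiE I (\<lambda>i. {..\<rho> i :: real})))"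
proof (rule Int_stableI, elim imageE, simp)
  fix \<rho> \<sigma> :: "'a \<Rightarrow> real"
  have "PiE I (\<lambda>i. {..\<rho> i}) \<inter> PiE I (\<lambda>i. {..\<sigma> i}) = PiE I (\<lambda>i. {..min (\<rho> i) (\<sigma> i)})"
    by (auto simp: PiE_iff)
  then show "PiE I (\<lambda>i. {..\<rho> i}) \<inter> PiE I (\<lambda>i. {..\<sigma> i}) \<in> range (\<lambda>\<rho>. PiE I (\<lambda>i. {..\<rho> i}))"
    by (intro image_eqI[of _ _ "\<lambda>i. min (\<rho> i) (\<sigma> i)"]) auto
qed

text \<open>If coordinate \<open>i\<close> is integrated first, the slice of the diagonal
  \<open>x i = x j\<close> is a single point.\<close>

lemma AE_lborel_pow_inj: "AE x in lborel_pow k. inj_on x {..<k}"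
proof -
  interpret product_sigma_finite "\<lambda>_. lborel :: real measure" by standard
  have "AE x in lborel_pow k. x i \<noteq> x j" if ij: "i < k" "j < k" "i \<noteq> j" for i j
  proof -
    let ?I = "{..<k} - {i}"
    have ins: "insert i ?I = {..<k}" using ij by auto
    have [measurable]: "(\<lambda>x. x i) \<in> borel_measurable (lborel_pow k)"
      "(\<lambda>x. x j) \<in> borel_measurable (lborel_pow k)"
      using ij measurable_component_singleton[of _ "{..<k}" "\<lambda>_. lborel"] by auto
    have eq: "{x \<in> space (lborel_pow k). \<not> x i \<noteq> x j} = {x \<in> space (lborel_pow k). x i = x j}" by auto
    have m [measurable]: "{x \<in> space (lborel_pow k). x i = x j} \<in> sets (lborel_pow k)" by measurable
    have "emeasure (lborel_pow k) {x \<in> space (lborel_pow k). x i = x j} =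
       (\<integral>\<^sup>+x. indicator {x \<in> space (lborel_pow k). x i = x j} x \<partial>Pi\<^sub>M (insert i ?I) (\<lambda>_. lborel))"
      unfolding ins using m by simp
    also have "\<dots> = (\<integral>\<^sup>+x. \<integral>\<^sup>+y. indicator {x \<in> space (lborel_pow k). x i = x j} (x(i := y)) \<partial>lborel \<partial>Pi\<^sub>M ?I (\<lambda>_. lborel))"
      by (rule product_nn_integral_insert) (use m ins in auto)
    also have "\<dots> \<le> (\<integral>\<^sup>+x. \<integral>\<^sup>+y. indicator {x j} (y :: real) \<partial>lborel \<partial>Pi\<^sub>M ?I (\<lambda>_. lborel))"
      using ij by (intro nn_integral_mono) (auto simp: indicator_def)
    also have "\<dots> = 0" by simp
    finally show ?thesis by (subst AE_iff_measurable[OF m eq]) simp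
  qed
  then have "AE x in lborel_pow k. \<forall>i\<in>{..<k}. \<forall>j\<in>{..<k}. i \<noteq> j \<longrightarrow> x i \<noteq> x j"
    by (intro AE_finite_allI) auto
  then show ?thesis by eventually_elim (auto simp: inj_on_def)
qed

text \<open>The sides are half-open like grid cells, so that a grid on \<open>[-R, R]\<close>
  partitions the cube exactly. Cubes serve to cut down to sets of finite measure.\<close>

definition cube :: "nat \<Rightarrow> real \<Rightarrow> (nat \<Rightarrow> real) \<Rightarrow> real" where
  "cube k R x = (\<Prod>i<k. indicator {- R<..R} (x i))"

lemma measurable_coordinate: "i < k \<Longrightarrow> (\<lambda>x. x i) \<in> borel_measurable (lborel_pow k)"
  using measurable_component_singleton[of i "{..<k}" "\<lambda>_. lborel"] by simp

lemma measurable_prod_indicator: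
  assumes "\<And>i. i < k \<Longrightarrow> A i \<in> sets borel"
  shows "(\<lambda>x. \<Prod>i<k. indicator (A i) (x i) :: real) \<in> borel_measurable (lborel_pow k)"
  using assms measurable_coordinate
  by (intro borel_measurable_prod) (auto intro!: measurable_compose[OF _ borel_measurable_indicator])

lemma cube_measurable [measurable]: "cube k R \<in> borel_measurable (lborel_pow k)"
  unfolding cube_def[abs_def] by (rule measurable_prod_indicator) simp

lemma cube_bounds: "0 \<le> cube k R x" "cube k R x \<le> 1" "\<bar>cube k R x\<bar> \<le> 1" "(cube k R x)\<^sup>2 = cube k R x"
proof -
  show 1: "0 \<le> cube k R x" unfolding cube_def by (intro prod_nonneg) auto
  show 2: "cube k R x \<le> 1" unfolding cube_def by (intro prod_le_1) (auto simp: indicator_def)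
  show "\<bar>cube k R x\<bar> \<le> 1" using 1 2 by simp
  show "(cube k R x)\<^sup>2 = cube k R x"
    unfolding cube_def power2_eq_square prod.distrib[symmetric] by (intro prod.cong) (auto simp: indicator_def)
qed

lemma nn_integral_cube_finite: "(\<integral>\<^sup>+x. ennreal ((cube k R x)\<^sup>2) \<partial>lborel_pow k) < \<infinity>"
proof -
  interpret product_sigma_finite "\<lambda>_. lborel :: real measure" by standard
  have "(\<integral>\<^sup>+x. ennreal ((cube k R x)\<^sup>2) \<partial>lborel_pow k) =
      (\<integral>\<^sup>+x. (\<Prod>i<k. indicator {- R<..R} (x i)) \<partial>lborel_pow k)"
    unfolding cube_bounds(4) by (simp add: cube_def flip: prod_ennreal ennreal_indicator)
  also have "\<dots> = (\<Prod>i<k. \<integral>\<^sup>+x. indicator {- R<..R} x \<partial>lborel)"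
    by (intro product_nn_integral_prod) auto
  also have "\<dots> < \<infinity>"
    by (cases "R \<ge> 0") (auto simp: less_top[symmetric] power_eq_top_ennreal)
  finally show ?thesis .
qed

text \<open>Uniform grids: the injective cells exhaust the cube up to cells meeting a diagonal, and
  these shrink to the null set of diagonals.\<close>

lemma simple_approximable_cube:
  assumes R: "R > 0"
  shows "simple_approximable k (cube k R)"
proof -
  \<comment> \<open>There are \<open>m + 1\<close> cells of length \<open>2 * R / (m + 1)\<close>,
    so \<open>m = 0\<close> causes no division by zero.\<close>
  define t where "t m j = - R + 2 * R * real j / real (Suc m)" for m j
  have t: "strict_mono_on {..Suc m} (t m)" for m
    using R by (intro strict_mono_onI) (auto simp: t_def divide_strict_right_mono)
  define ind :: "nat \<Rightarrow> (nat \<Rightarrow> nat) \<Rightarrow> (nat \<Rightarrow> real) \<Rightarrow> real"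
    where "ind m p x = (\<Prod>i<k. indicator {t m (p i)<..t m (Suc (p i))} (x i))" for m p x
  let ?P = "\<lambda>m. {..<k} \<rightarrow>\<^sub>E {..<Suc m}"
  have ind: "0 \<le> ind m p x" for m p x unfolding ind_def by (intro prod_nonneg) auto
  have ends: "t m 0 = - R" "t m (Suc m) = R" for m by (simp_all add: t_def)
  have cube: "cube k R x = (\<Sum>p\<in>?P m. ind m p x)" for m x
  proof -
    have "- R \<in> t m ` {..Suc m}" "R \<in> t m ` {..Suc m}"
      using ends[of m] by (metis atMost_iff image_eqI le0 order_refl)+
    then have "cube k R x = (\<Sum>p\<in>PiE {..<k} (\<lambda>i. {j. j < Suc m \<and> - R \<le> t m j \<and> t m j < R}). ind m p x)"
      unfolding cube_def ind_def using R by (intro box_indicator_eq_sum_cells[OF t]) auto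
    also have "{j. j < Suc m \<and> - R \<le> t m j \<and> t m j < R} = {..<Suc m}"
      using grid_mono[OF t, of 0 m] grid_mono[OF t, of _ m "Suc m"] by (auto simp: ends less_imp_le)
    finally show ?thesis .
  qed
  define \<phi> where "\<phi> m = offdiag_step k (Suc m) (t m) (\<lambda>_. 1)" for m
  have sub: "offdiag_indices k (Suc m) \<subseteq> ?P m" for m by (auto simp: offdiag_indices_def)
  have fin: "finite (?P m)" for m by (intro finite_PiE) auto
  have \<phi>: "\<phi> m x = (\<Sum>p\<in>offdiag_indices k (Suc m). ind m p x)" for m x
    by (simp add: \<phi>_def offdiag_step_def ind_def)
  have bnd: "0 \<le> \<phi> m x" "\<phi> m x \<le> cube k R x" for m x
    unfolding \<phi> cube[of _ m] by (auto intro!: sum_nonneg ind) (intro sum_mono2 fin sub ind)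
  \<comment> \<open>Once the mesh is below the smallest gap between coordinates of \<open>x\<close>,
    no two coordinates share a cell, and the omitted multi-indices do not see
    \<open>x\<close>.\<close>
  have ev: "eventually (\<lambda>m. \<phi> m x = cube k R x) sequentially" if inj: "inj_on x {..<k}" for x
  proof -
    have "eventually (\<lambda>m. 2 * R / real (Suc m) < \<bar>x i - x j\<bar>) sequentially"
      if "i < k" "j < k" "i \<noteq> j" for i j
    proof (rule order_tendstoD(2))
      show "(\<lambda>m. 2 * R / real (Suc m)) \<longlonglongrightarrow> 0" by real_asymp
      show "0 < \<bar>x i - x j\<bar>" using inj that by (auto dest: inj_onD)
    qed
    then have "eventually (\<lambda>m. \<forall>i\<in>{..<k}. \<forall>j\<in>{..<k}. i \<noteq> j \<longrightarrow> 2 * R / real (Suc m) < \<bar>x i - x j\<bar>) sequentially"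
      by (intro eventually_ball_finite ballI) auto
    then show ?thesis
    proof eventually_elim
      case (elim m)
      have "ind m p x = 0" if p: "p \<in> ?P m - offdiag_indices k (Suc m)" for p
      proof (rule ccontr)
        assume "ind m p x \<noteq> 0"
        then have x: "x i \<in> {t m (p i)<..t m (Suc (p i))}" if "i < k" for i
          unfolding ind_def using that by (auto simp: indicator_def split: if_splits)
        from p have "\<not> inj_on p {..<k}" by (auto simp: offdiag_indices_def)
        then obtain i j where ij: "i < k" "j < k" "i \<noteq> j" "p i = p j" by (auto simp: inj_on_def)
        have "\<bar>x i - x j\<bar> < t m (Suc (p i)) - t m (p i)"
          using x[OF ij(1)] x[OF ij(2)] ij(4) by auto
        also have "\<dots> = 2 * R / real (Suc m)"
          by (simp add: t_def add_divide_distrib[symmetric] diff_divide_distrib[symmetric] algebra_simps)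
        finally have "\<bar>x i - x j\<bar> < 2 * R / real (Suc m)" .
        moreover have "2 * R / real (Suc m) < \<bar>x i - x j\<bar>" using elim ij(1-3) by blast
        ultimately show False by simp
      qed
      then show "\<phi> m x = cube k R x"
        unfolding \<phi> cube[of _ m] using sub fin by (intro sum.mono_neutral_left) auto
    qed
  qed
  have "L2_tendsto (lborel_pow k) \<phi> (cube k R)"
  proof (rule L2_tendsto_dominated[where w = "cube k R"])
    show "\<phi> m \<in> borel_measurable (lborel_pow k)" for m
      unfolding \<phi>_def by (rule simple_pair_measurable[OF simple_pair_offdiag_step[OF t]])
    show "\<bar>\<phi> m x - cube k R x\<bar> \<le> cube k R x" for m x using bnd[of m x] by simp
    show "AE x in lborel_pow k. (\<lambda>m. \<phi> m x) \<longlonglongrightarrow> cube k R x"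
      using AE_lborel_pow_inj by eventually_elim (auto intro!: tendsto_eventually ev)
  qed (use nn_integral_cube_finite in auto)
  moreover have "simple_pair k (\<phi> m) (offdiag_step_integral (\<lambda>s b. b s) k (Suc m) (t m) (\<lambda>_. 1))" for m
    unfolding \<phi>_def by (rule simple_pair_offdiag_step[OF t])
  ultimately show ?thesis by (intro simple_approximableI) auto
qed

lemma simple_pair_mult_orthant:
  assumes "simple_pair k \<phi> F"
  shows "\<exists>G. simple_pair k (\<lambda>x. (\<Prod>i<k. indicator {..\<rho> i} (x i)) * \<phi> x) G"
  using assms
proof induction
  case zero
  then show ?case using simple_pair.zero by auto
next
  case (add_box \<phi> F l r c)
  then obtain G where G: "simple_pair k (\<lambda>x. (\<Prod>i<k. indicator {..\<rho> i} (x i)) * \<phi> x) G" by blast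
  \<comment> \<open>The outer \<open>max\<close> turns a side that lies beyond
    \<open>\<rho> i\<close> into an empty interval with \<open>l i \<le> r' i\<close> still
    true.\<close>
  define r' where "r' i = max (l i) (min (r i) (\<rho> i))" for i
  have sub: "{l i<..r' i} \<subseteq> {l i<..r i}" for i by (auto simp: r'_def)
  have "(\<Prod>i<k. indicator {..\<rho> i} (x i)) * (c * (\<Prod>i<k. indicator {l i<..r i} (x i))) =
      c * (\<Prod>i<k. indicator {l i<..r' i} (x i) :: real)" for x :: "nat \<Rightarrow> real"
  proof -
    have "(\<Prod>i<k. indicator {..\<rho> i} (x i)) * (c * (\<Prod>i<k. indicator {l i<..r i} (x i))) =
        c * (\<Prod>i<k. indicator {..\<rho> i} (x i) * indicator {l i<..r i} (x i) :: real)"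
      by (simp add: prod.distrib)
    also have "(\<Prod>i<k. indicator {..\<rho> i} (x i) * indicator {l i<..r i} (x i) :: real) =
        (\<Prod>i<k. indicator {l i<..r' i} (x i))"
      by (intro prod.cong) (auto simp: indicator_def r'_def)
    finally show ?thesis .
  qed
  then have "(\<lambda>x. (\<Prod>i<k. indicator {..\<rho> i} (x i)) * (\<phi> x + c * (\<Prod>i<k. indicator {l i<..r i} (x i)))) =
     (\<lambda>x. (\<Prod>i<k. indicator {..\<rho> i} (x i)) * \<phi> x + c * (\<Prod>i<k. indicator {l i<..r' i} (x i)))"
    by (simp add: distrib_left fun_eq_iff)
  moreover have "simple_pair k (\<lambda>x. (\<Prod>i<k. indicator {..\<rho> i} (x i)) * \<phi> x + c * (\<Prod>i<k. indicator {l i<..r' i} (x i)))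
      (\<lambda>b. G b + c * (\<Prod>i<k. b (r' i) - b (l i)))"
  proof (rule simple_pair.add_box[OF G])
    show "l i \<le> r' i" for i by (simp add: r'_def)
    show "{l i<..r' i} \<inter> {l j<..r' j} = {}" if "i < k" "j < k" "i \<noteq> j" for i j
      using add_box.hyps(3)[OF that] sub[of i] sub[of j] by blast
  qed
  ultimately show ?case by auto
qed

lemma simple_approximable_mult_orthant:
  assumes "simple_approximable k f"
  shows "simple_approximable k (\<lambda>x. (\<Prod>i<k. indicator {..\<rho> i} (x i)) * f x)"
proof -
  define o' :: "(nat \<Rightarrow> real) \<Rightarrow> real" where "o' x = (\<Prod>i<k. indicator {..\<rho> i} (x i))" for x
  have [measurable]: "o' \<in> borel_measurable (lborel_pow k)"
    unfolding o'_def[abs_def] by (rule measurable_prod_indicator) simp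
  have o': "(o' x)\<^sup>2 \<le> 1" for x
    unfolding o'_def power2_eq_square prod.distrib[symmetric]
    by (intro prod_le_1) (auto simp: indicator_def)
  obtain \<phi> F where 1: "\<And>m. simple_pair k (\<phi> m) (F m)" "L2_tendsto (lborel_pow k) \<phi> f"
    and [measurable]: "f \<in> borel_measurable (lborel_pow k)"
    by (rule simple_approximableE[OF assms]) auto
  have "\<forall>m. \<exists>G. simple_pair k (\<lambda>x. o' x * \<phi> m x) G"
    unfolding o'_def using simple_pair_mult_orthant[OF 1(1)] by blast
  then obtain G where G: "\<And>m. simple_pair k (\<lambda>x. o' x * \<phi> m x) (G m)"
    by (rule choice[THEN exE]) auto
  have "L2_tendsto (lborel_pow k) (\<lambda>m x. o' x * \<phi> m x) (\<lambda>x. o' x * f x)"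
    unfolding L2_tendsto_def
  proof (rule tendsto_sandwich[OF _ _ tendsto_const 1(2)[unfolded L2_tendsto_def]])
    show "\<forall>\<^sub>F m in sequentially. (\<integral>\<^sup>+x. ennreal ((o' x * \<phi> m x - o' x * f x)\<^sup>2) \<partial>lborel_pow k) \<le>
        (\<integral>\<^sup>+x. ennreal ((\<phi> m x - f x)\<^sup>2) \<partial>lborel_pow k)"
    proof (intro always_eventually allI nn_integral_mono ennreal_leI)
      show "(o' x * \<phi> m x - o' x * f x)\<^sup>2 \<le> (\<phi> m x - f x)\<^sup>2" for m x
        using mult_right_mono[OF o'[of x], of "(\<phi> m x - f x)\<^sup>2"]
        by (simp add: power_mult_distrib flip: right_diff_distrib)
    qed
  qed auto
  from simple_approximableI[OF G this] show ?thesis unfolding o'_def[symmetric] by simp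
qed

text \<open>Induction from orthants to all measurable sets. The factor \<open>cube k R\<close> keeps
  every function in L2: a complement becomes a difference from the cube, and a disjoint union is a
  limit dominated by it.\<close>

lemma simple_approximable_indicator_cube:
  assumes A: "A \<in> sets (lborel_pow k)" and R: "R > 0"
  shows "simple_approximable k (\<lambda>x. indicator A x * cube k R x)"
proof -
  have sets: "sets (lborel_pow k) = sigma_sets (PiE {..<k} (\<lambda>_. UNIV)) (range (\<lambda>\<rho>. PiE {..<k} (\<lambda>i. {..\<rho> i})))"
    using sets_PiM_borel_atMost[of "{..<k}"] by (simp cong: sets_PiM_cong)
  have space: "space (lborel_pow k) = PiE {..<k} (\<lambda>_. UNIV)" by (simp add: space_PiM)
  note cubeA = simple_approximable_cube[OF R, of k]
  have "range (\<lambda>\<rho>. PiE {..<k} (\<lambda>i. {..\<rho> i :: real})) \<subseteq> Pow (PiE {..<k} (\<lambda>_. UNIV))"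
    by (auto simp: PiE_iff)
  from Int_stable_PiE_atMost[of "{..<k}"] this A[unfolded sets] show ?thesis
  proof (induction rule: sigma_sets_induct_disjoint)
    case (basic A)
    then obtain \<rho> where \<rho>: "A = PiE {..<k} (\<lambda>i. {..\<rho> i})" by auto
    show ?case
    proof (rule simple_approximable_cong[OF simple_approximable_mult_orthant[OF cubeA, of \<rho>]])
      fix x assume x: "x \<in> space (lborel_pow k)"
      have "(\<Prod>i<k. indicator {..\<rho> i} (x i)) = (indicator A x :: real)"
      proof (cases "x \<in> A")
        case True
        then show ?thesis using \<rho> by (auto simp: PiE_iff intro!: prod.neutral)
      next
        case False
        then obtain i where "i < k" "\<not> x i \<le> \<rho> i" using \<rho> x by (auto simp: PiE_iff space)
        then show ?thesis using False by (auto intro!: prod_zero bexI[of _ i])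
      qed
      then show "(\<Prod>i<k. indicator {..\<rho> i} (x i)) * cube k R x = indicator A x * cube k R x" by simp
    qed
  next
    case empty
    show ?case using simple_approximable_zero by simp
  next
    case (compl A)
    have "simple_approximable k (\<lambda>x. cube k R x + (- 1) * (indicator A x * cube k R x))"
      by (intro simple_approximable_add simple_approximable_cmult cubeA compl.IH)
    then show ?case
      by (rule simple_approximable_cong) (auto simp: space indicator_def)
  next
    case (union A)
    have A: "A i \<in> sets (lborel_pow k)" for i using union.hyps(2) unfolding sets by auto
    have [measurable]: "(\<Union>i. A i) \<in> sets (lborel_pow k)" using A by auto
    define g where "g n x = (\<Sum>i<n. indicator (A i) x * cube k R x)" for n x
    have g: "simple_approximable k (g n)" for n
      unfolding g_def[abs_def] by (intro simple_approximable_sum union.IH) auto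
    have g_eq: "g n x = indicator (\<Union>i<n. A i) x * cube k R x" for n x
      unfolding g_def sum_distrib_right[symmetric]
      by (subst indicator_UN_disjoint) (use union.hyps(1) in \<open>auto simp: disjoint_family_on_def\<close>)
    show ?case
    proof (rule simple_approximable_limit[OF g])
      show "L2_tendsto (lborel_pow k) g (\<lambda>x. indicator (\<Union>i. A i) x * cube k R x)"
      proof (rule L2_tendsto_dominated[where w="cube k R"])
        show "g n \<in> borel_measurable (lborel_pow k)" for n
          using g by (simp add: simple_approximable_def)
        show "\<bar>g n x - indicator (\<Union>i. A i) x * cube k R x\<bar> \<le> cube k R x" for n x
          unfolding g_eq using cube_bounds(1)[of k R x] by (auto simp: indicator_def)
        have "(\<lambda>n. g n x) \<longlonglongrightarrow> indicator (\<Union>i. A i) x * cube k R x" for x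
          unfolding g_eq by (intro tendsto_mult tendsto_const LIMSEQ_indicator_UN)
        then show "AE x in lborel_pow k. (\<lambda>n. g n x) \<longlonglongrightarrow> indicator (\<Union>i. A i) x * cube k R x" by simp
      qed (use nn_integral_cube_finite in auto)
    qed auto
  qed
qed

text \<open>Simple functions with \<open>\<bar>s n x\<bar> \<le> 2 * \<bar>f x\<bar>\<close> are cut
  off by growing cubes. Each of them is a finite combination of the indicators already
  treated.\<close>

lemma simple_approximable_square_integrable:
  assumes f: "square_integrable (lborel_pow k) f"
  shows "simple_approximable k f"
proof -
  have [measurable]: "f \<in> borel_measurable (lborel_pow k)" and fi: "integrable (lborel_pow k) (\<lambda>x. (f x)\<^sup>2)"
    using f by (auto simp: square_integrable_def)
  obtain s where s': "(\<forall>n. simple_function (lborel_pow k) (s n)) \<and>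
    (\<forall>x\<in>space (lborel_pow k). (\<lambda>n. s n x) \<longlonglongrightarrow> f x) \<and>
    (\<forall>n. \<forall>x\<in>space (lborel_pow k). dist (s n x) 0 \<le> 2 * dist (f x) 0)"
    using borel_measurable_implies_sequence_metric[of f "lborel_pow k" 0] by auto
  then have s: "\<And>n. simple_function (lborel_pow k) (s n)"
    "\<And>x. x \<in> space (lborel_pow k) \<Longrightarrow> (\<lambda>n. s n x) \<longlonglongrightarrow> f x"
    "\<And>n x. x \<in> space (lborel_pow k) \<Longrightarrow> \<bar>s n x\<bar> \<le> 2 * \<bar>f x\<bar>"
    by auto
  have [measurable]: "s n \<in> borel_measurable (lborel_pow k)" for n
    using s(1) by (rule borel_measurable_simple_function)
  define g where "g n x = s n x * cube k (real (Suc n)) x" for n x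
  have "simple_approximable k (g n)" for n
  proof -
    have "simple_approximable k (\<lambda>x. \<Sum>v\<in>s n ` space (lborel_pow k).
        v * (indicator (s n -` {v} \<inter> space (lborel_pow k)) x * cube k (real (Suc n)) x))"
      using s(1)[of n]
      by (intro simple_approximable_sum simple_approximable_cmult simple_approximable_indicator_cube)
        (auto simp: simple_function_def)
    then show ?thesis
    proof (rule simple_approximable_cong)
      fix x assume x: "x \<in> space (lborel_pow k)"
      have "(\<Sum>v\<in>s n ` space (lborel_pow k).
          v * (indicator (s n -` {v} \<inter> space (lborel_pow k)) x * cube k (real (Suc n)) x)) =
        (\<Sum>v\<in>s n ` space (lborel_pow k). if v = s n x then v * cube k (real (Suc n)) x else 0)"
        using x by (intro sum.cong) (auto simp: indicator_def)
      also have "\<dots> = g n x" using x s(1)[of n] by (simp add: g_def simple_function_def)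
      finally show "(\<Sum>v\<in>s n ` space (lborel_pow k).
          v * (indicator (s n -` {v} \<inter> space (lborel_pow k)) x * cube k (real (Suc n)) x)) = g n x" .
    qed
  qed
  moreover have "L2_tendsto (lborel_pow k) g f"
  \<comment> \<open>The bound is three times the absolute value of \<open>f x\<close>: two parts
    from \<open>g n x\<close> and one from \<open>f x\<close>.\<close>
  proof (rule L2_tendsto_dominated[where w="\<lambda>x. 3 * f x * sgn (f x)"])
    show "g n \<in> borel_measurable (lborel_pow k)" for n unfolding g_def[abs_def] by measurable
    show "\<bar>g n x - f x\<bar> \<le> 3 * f x * sgn (f x)" if "x \<in> space (lborel_pow k)" for n x
    proof -
      have "\<bar>g n x\<bar> \<le> 2 * \<bar>f x\<bar> * 1"
        unfolding g_def abs_mult using s(3)[OF that, of n] cube_bounds(3)[of k "real (Suc n)" x]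
        by (intro mult_mono) auto
      moreover have "f x * sgn (f x) = \<bar>f x\<bar>" by (simp add: abs_sgn)
      ultimately show ?thesis by (simp only: mult.assoc)
    qed
    have "(\<integral>\<^sup>+x. ennreal ((3 * f x * sgn (f x))\<^sup>2) \<partial>lborel_pow k) = (\<integral>\<^sup>+x. ennreal (9 * (f x)\<^sup>2) \<partial>lborel_pow k)"
      by (intro nn_integral_cong) (auto simp: power_mult_distrib sgn_if)
    also have "\<dots> < \<infinity>" using fi by (simp add: nn_integral_eq_integral)
    finally show "(\<integral>\<^sup>+x. ennreal ((3 * f x * sgn (f x))\<^sup>2) \<partial>lborel_pow k) < \<infinity>" .
    show "AE x in lborel_pow k. (\<lambda>n. g n x) \<longlonglongrightarrow> f x"
    proof (rule AE_I2)
      fix x assume x: "x \<in> space (lborel_pow k)"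
      have "eventually (\<lambda>n. \<forall>i\<in>{..<k}. \<bar>x i\<bar> < real (Suc n)) sequentially"
        by (intro eventually_ball_finite ballI finite_lessThan)
          (metis eventually_sequentiallyI le_imp_less_Suc of_nat_less_iff order_le_less_trans real_nat_ceiling_ge)
      then have "eventually (\<lambda>n. cube k (real (Suc n)) x = 1) sequentially"
      proof eventually_elim
        case (elim n)
        have "x i \<in> {- real (Suc n)<..real (Suc n)}" if "i < k" for i
          using bspec[OF elim, of i] that by (auto simp: abs_less_iff)
        then show ?case unfolding cube_def by (intro prod.neutral) auto
      qed
      then have "(\<lambda>n. cube k (real (Suc n)) x) \<longlonglongrightarrow> 1" by (rule tendsto_eventually)
      from tendsto_mult[OF s(2)[OF x] this] show "(\<lambda>n. g n x) \<longlonglongrightarrow> f x" by (simp add: g_def)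
    qed
  qed auto
  ultimately show ?thesis using \<open>f \<in> borel_measurable _\<close>
    by (rule simple_approximable_limit)
qed

section \<open>Existence and linearity of the multiple integral\<close>

lemma square_integrable_iff_nn_integral:
  "square_integrable M f \<longleftrightarrow> f \<in> borel_measurable M \<and> (\<integral>\<^sup>+x. ennreal ((f x)\<^sup>2) \<partial>M) < \<infinity>"
proof -
  have "integrable M (\<lambda>x. (f x)\<^sup>2) \<longleftrightarrow> (\<integral>\<^sup>+x. ennreal ((f x)\<^sup>2) \<partial>M) < \<infinity>" if [measurable]: "f \<in> borel_measurable M"
    by (simp add: integrable_iff_bounded)
  then show ?thesis by (auto simp: square_integrable_def)
qed

lemma square_integrable_add:
  assumes "square_integrable M f" "square_integrable M g"
  shows "square_integrable M (\<lambda>x. f x + g x)"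
  using assms nn_integral_square_add_le[of f M g] unfolding square_integrable_iff_nn_integral
  by (auto simp: ennreal_mult_less_top intro: le_less_trans)

lemma square_integrable_cmult:
  "square_integrable M f \<Longrightarrow> square_integrable M (\<lambda>x. c * f x)"
  by (auto simp: square_integrable_def power_mult_distrib)

lemma square_integrable_diff:
  assumes "square_integrable M f" "square_integrable M g"
  shows "square_integrable M (\<lambda>x. f x - g x)"
  using square_integrable_add[OF assms(1) square_integrable_cmult[OF assms(2), of "-1"]] by simp

lemma L2_tendsto_AE_subseq:
  assumes "L2_tendsto M F f" and sq: "\<And>n. square_integrable M (F n)" "square_integrable M f"
  obtains r :: "nat \<Rightarrow> nat" where "strict_mono r" "AE x in M. (\<lambda>n. F (r n) x) \<longlonglongrightarrow> f x"
proof -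
  have int: "integrable M (\<lambda>x. (F n x - f x)\<^sup>2)" for n
    using square_integrable_diff[OF sq(1)[of n] sq(2)] by (simp add: square_integrable_def)
  have "ennreal (\<integral>x. norm ((F n x - f x)\<^sup>2) \<partial>M) = (\<integral>\<^sup>+x. ennreal ((F n x - f x)\<^sup>2) \<partial>M)" for n
    using int[of n] by (simp add: nn_integral_eq_integral)
  then have "(\<lambda>n. ennreal (\<integral>x. norm ((F n x - f x)\<^sup>2) \<partial>M)) \<longlonglongrightarrow> ennreal 0"
    using assms(1) by (simp add: L2_tendsto_def)
  then have "(\<lambda>n. \<integral>x. norm ((F n x - f x)\<^sup>2) \<partial>M) \<longlonglongrightarrow> 0"
    by (subst (asm) tendsto_ennreal_iff) auto
  from tendsto_L1_AE_subseq[OF int this] obtain r :: "nat \<Rightarrow> nat" where r: "strict_mono r"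
    "AE x in M. (\<lambda>n. (F (r n) x - f x)\<^sup>2) \<longlonglongrightarrow> 0" by auto
  have "AE x in M. (\<lambda>n. F (r n) x) \<longlonglongrightarrow> f x"
    using r(2)
  proof eventually_elim
    case (elim x)
    from tendsto_real_sqrt[OF elim] have "(\<lambda>n. \<bar>F (r n) x - f x\<bar>) \<longlonglongrightarrow> 0" by simp
    then show ?case by (simp add: tendsto_rabs_zero_iff LIM_zero_iff)
  qed
  with r(1) show ?thesis by (rule that)
qed

lemma L2_tendsto_subseq:
  "L2_tendsto M F f \<Longrightarrow> strict_mono r \<Longrightarrow> L2_tendsto M (\<lambda>n. F (r n)) f"
  unfolding L2_tendsto_def using LIMSEQ_subseq_LIMSEQ[of _ 0 r] by (fastforce simp: comp_def)

text \<open>On a probability space an L2 Cauchy sequence is Cauchy in L1, so a subsequence converges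
  almost everywhere. Fatou's lemma then bounds the L2 distance of the full sequence from that
  limit.\<close>

lemma (in prob_space) L2_complete:
  fixes X :: "nat \<Rightarrow> 'a \<Rightarrow> real"
  assumes sq: "\<And>n. square_integrable M (X n)"
    and cauchy: "\<And>e. e > 0 \<Longrightarrow> \<exists>N. \<forall>i\<ge>N. \<forall>j\<ge>N. (\<integral>\<^sup>+x. ennreal ((X i x - X j x)\<^sup>2) \<partial>M) < ennreal e"
  obtains Y where "square_integrable M Y" "L2_tendsto M X Y"
proof -
  have [measurable]: "X n \<in> borel_measurable M" for n using sq by (simp add: square_integrable_def)
  have sqd: "integrable M (\<lambda>x. (X i x - X j x)\<^sup>2)" for i j
    using square_integrable_diff[OF sq[of i] sq[of j]] by (simp add: square_integrable_def)
  have int: "integrable M (X n)" for n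
    using sq[of n] by (auto simp: square_integrable_def intro: square_integrable_imp_integrable)
  have "\<exists>N. \<forall>i\<ge>N. \<forall>j\<ge>N. (LINT x|M. norm (X i x - X j x)) < e" if e: "e > 0" for e :: real
  proof -
    obtain N where N: "\<And>i j. i \<ge> N \<Longrightarrow> j \<ge> N \<Longrightarrow> (\<integral>\<^sup>+x. ennreal ((X i x - X j x)\<^sup>2) \<partial>M) < ennreal (e\<^sup>2)"
      using cauchy[of "e\<^sup>2"] e by auto
    have "(LINT x|M. norm (X i x - X j x)) < e" if ij: "i \<ge> N" "j \<ge> N" for i j
    proof -
      have "ennreal (LINT x|M. (X i x - X j x)\<^sup>2) < ennreal (e\<^sup>2)"
        using N[OF ij] nn_integral_eq_integral[OF sqd[of i j]] by simp
      then have lt: "(LINT x|M. (X i x - X j x)\<^sup>2) < e\<^sup>2"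
        by (subst (asm) ennreal_less_iff) auto
      \<comment> \<open>The arithmetic-geometric inequality for \<open>e\<close> and
        \<open>\<bar>z\<bar>\<close>, divided by \<open>2 * e\<close>, replaces Cauchy-Schwarz; its
        weights make the right side less than \<open>e\<close>.\<close>
      have "(LINT x|M. norm (X i x - X j x)) \<le> (LINT x|M. e / 2 + (X i x - X j x)\<^sup>2 / (2 * e))"
      proof (rule integral_mono)
        show "norm (X i x - X j x) \<le> e / 2 + (X i x - X j x)\<^sup>2 / (2 * e)" for x
          using sum_squares_bound[of e "norm (X i x - X j x)"] e
          by (simp add: field_simps power2_eq_square)
      qed (use int sqd in auto)
      also have "\<dots> = e / 2 + (LINT x|M. (X i x - X j x)\<^sup>2) / (2 * e)"
        using sqd[of i j] by (simp add: prob_space)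
      also have "\<dots> < e / 2 + e\<^sup>2 / (2 * e)" using lt e by (intro add_strict_left_mono divide_strict_right_mono) auto
      finally show ?thesis using e by (simp add: power2_eq_square)
    qed
    then show ?thesis by blast
  qed
  from cauchy_L1_AE_cauchy_subseq[OF int this] obtain r :: "nat \<Rightarrow> nat" where r: "strict_mono r"
    "AE x in M. Cauchy (\<lambda>i. X (r i) x)" by auto
  define Y where "Y x = lim (\<lambda>i. X (r i) x)" for x
  have [measurable]: "Y \<in> borel_measurable M" unfolding Y_def[abs_def] by measurable
  have Y: "AE x in M. (\<lambda>i. X (r i) x) \<longlonglongrightarrow> Y x"
    using r(2) by eventually_elim (simp add: Y_def Cauchy_convergent_iff convergent_LIMSEQ_iff)
  have bound: "\<exists>N. \<forall>n\<ge>N. (\<integral>\<^sup>+x. ennreal ((X n x - Y x)\<^sup>2) \<partial>M) \<le> ennreal e" if e: "e > 0" for e :: real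
  proof -
    obtain N where N: "\<And>i j. i \<ge> N \<Longrightarrow> j \<ge> N \<Longrightarrow> (\<integral>\<^sup>+x. ennreal ((X i x - X j x)\<^sup>2) \<partial>M) < ennreal e"
      using cauchy[OF e] by auto
    have "(\<integral>\<^sup>+x. ennreal ((X n x - Y x)\<^sup>2) \<partial>M) \<le> ennreal e" if n: "n \<ge> N" for n
    proof -
      have "(\<integral>\<^sup>+x. ennreal ((X n x - Y x)\<^sup>2) \<partial>M) = (\<integral>\<^sup>+x. liminf (\<lambda>i. ennreal ((X n x - X (r i) x)\<^sup>2)) \<partial>M)"
      proof (rule nn_integral_cong_AE, use Y in eventually_elim)
        case (elim x)
        then have "(\<lambda>i. ennreal ((X n x - X (r i) x)\<^sup>2)) \<longlonglongrightarrow> ennreal ((X n x - Y x)\<^sup>2)"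
          by (intro tendsto_ennrealI tendsto_intros)
        from lim_imp_Liminf[OF sequentially_bot this] show ?case by simp
      qed
      also have "\<dots> \<le> liminf (\<lambda>i. \<integral>\<^sup>+x. ennreal ((X n x - X (r i) x)\<^sup>2) \<partial>M)"
        by (rule nn_integral_liminf) measurable
      also have "\<dots> \<le> limsup (\<lambda>i. \<integral>\<^sup>+x. ennreal ((X n x - X (r i) x)\<^sup>2) \<partial>M)"
        by (rule Liminf_le_Limsup) simp
      also have "\<dots> \<le> ennreal e"
      proof (rule Limsup_bounded)
        show "\<forall>\<^sub>F i in sequentially. (\<integral>\<^sup>+x. ennreal ((X n x - X (r i) x)\<^sup>2) \<partial>M) \<le> ennreal e"
          using eventually_ge_at_top[of N]
        proof eventually_elim
          case (elim i)
          then show ?case using N[OF n, of "r i"] seq_suble[OF r(1), of i] by simp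
        qed
      qed
      finally show ?thesis .
    qed
    then show ?thesis by blast
  qed
  have lim: "L2_tendsto M X Y"
    unfolding L2_tendsto_def
  proof (rule order_tendstoI)
    fix a :: ennreal assume "0 < a"
    \<comment> \<open>\<open>a\<close> may be infinite; a smaller positive \<open>b\<close> is
      finite and hence comes from a real number.\<close>
    then obtain b where b: "0 < b" "b < a" using dense by blast
    then have "b < top" using less_trans[OF b(2)] top.not_eq_extremum by fastforce
    with b have e: "0 < enn2real b" "ennreal (enn2real b) < a" by (simp_all add: enn2real_positive_iff)
    show "\<forall>\<^sub>F n in sequentially. (\<integral>\<^sup>+x. ennreal ((X n x - Y x)\<^sup>2) \<partial>M) < a"
      using bound[OF e(1)] e(2) by (auto simp: eventually_sequentially intro: le_less_trans)
  qed auto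
  obtain N where "(\<integral>\<^sup>+x. ennreal ((X N x - Y x)\<^sup>2) \<partial>M) \<le> ennreal 1" using bound[of 1] by auto
  then have "square_integrable M (\<lambda>x. X N x - Y x)"
    unfolding square_integrable_iff_nn_integral by (auto intro: le_less_trans)
  from square_integrable_diff[OF sq[of N] this] have "square_integrable M Y" by simp
  then show ?thesis using lim by (rule that)
qed

lemma simple_pair_square_integrable:
  assumes "simple_pair k \<phi> F"
  shows "square_integrable (lborel_pow k) \<phi>"
proof -
  obtain n :: nat and t a where t: "strict_mono_on {..n} t" and \<phi>: "\<phi> = offdiag_step k n t a"
    by (rule simple_pairs_common_grid[of "{0 :: nat}" k "\<lambda>_. \<phi>" "\<lambda>_. F"]) (use assms in auto)
  show ?thesis
    using nn_integral_offdiag_step_square[OF t, of k a] simple_pair_measurable[OF assms]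
    by (simp add: square_integrable_iff_nn_integral \<phi>)
qed

section \<open>Extension of the integral from simple pairs to all square integrable
  functions\<close>

context brownian_increments
begin

lemma simple_pair_integral_square_integrable:
  assumes "simple_pair k \<phi> F"
  shows "square_integrable M (\<lambda>\<omega>. F (\<lambda>s. B s \<omega>))"
  unfolding square_integrable_iff_nn_integral
proof
  have "(\<integral>\<^sup>+x. ennreal ((\<phi> x)\<^sup>2) \<partial>lborel_pow k) < \<infinity>"
    using simple_pair_square_integrable[OF assms] by (simp add: square_integrable_iff_nn_integral)
  then have "ennreal (real (k ^ k)) * (\<integral>\<^sup>+x. ennreal ((\<phi> x)\<^sup>2) \<partial>lborel_pow k) < \<infinity>"
    by (simp add: ennreal_mult_less_top)
  then show "(\<integral>\<^sup>+\<omega>. ennreal ((F (\<lambda>s. B s \<omega>))\<^sup>2) \<partial>M) < \<infinity>"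
    using simple_pair_isometry_bound[OF assms] by (rule le_less_trans[rotated])
qed (rule simple_pair_integral_measurable[OF assms])

text \<open>The isometry bound for the difference of two pairs, routed through a common target
  \<open>f\<close>. It yields both the Cauchy property and the independence of the approximating
  sequence.\<close>

lemma simple_pair_integral_dist_le:
  assumes "simple_pair k \<phi> F" "simple_pair k \<psi> G"
    and [measurable]: "f \<in> borel_measurable (lborel_pow k)"
  shows "(\<integral>\<^sup>+\<omega>. ennreal ((F (\<lambda>s. B s \<omega>) - G (\<lambda>s. B s \<omega>))\<^sup>2) \<partial>M) \<le>
     ennreal (real (k ^ k)) * (2 * (\<integral>\<^sup>+x. ennreal ((\<phi> x - f x)\<^sup>2) \<partial>lborel_pow k) +
       2 * (\<integral>\<^sup>+x. ennreal ((\<psi> x - f x)\<^sup>2) \<partial>lborel_pow k))"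
proof -
  have [measurable]: "\<phi> \<in> borel_measurable (lborel_pow k)" "\<psi> \<in> borel_measurable (lborel_pow k)"
    using assms by (auto intro: simple_pair_measurable)
  have "(\<integral>\<^sup>+x. ennreal ((\<phi> x - \<psi> x)\<^sup>2) \<partial>lborel_pow k) \<le>
     2 * (\<integral>\<^sup>+x. ennreal ((\<phi> x - f x)\<^sup>2) \<partial>lborel_pow k) + 2 * (\<integral>\<^sup>+x. ennreal ((\<psi> x - f x)\<^sup>2) \<partial>lborel_pow k)"
    using nn_integral_square_add_le[of "\<lambda>x. \<phi> x - f x" "lborel_pow k" "\<lambda>x. f x - \<psi> x"]
    by (simp add: power2_commute)
  then show ?thesis
    using simple_pair_isometry_bound[OF simple_pair_diff[OF assms(1,2)]]
    by (meson mult_left_mono order_trans zero_le)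
qed

text \<open>The given pairs and the pairs that witness \<open>X\<close> approximate the same
  \<open>f\<close>, so their integrals merge in L2.\<close>

lemma L2_tendsto_wiener_ito:
  assumes "is_wiener_ito M B k f X"
    and sp: "\<And>m. simple_pair k (\<phi> m) (F m)" and lim: "L2_tendsto (lborel_pow k) \<phi> f"
  shows "L2_tendsto M (\<lambda>m \<omega>. F m (\<lambda>s. B s \<omega>)) X"
proof -
  obtain \<psi> G where f: "square_integrable (lborel_pow k) f" and X: "square_integrable M X"
    and G: "\<And>m. simple_pair k (\<psi> m) (G m)" "L2_tendsto (lborel_pow k) \<psi> f"
    "L2_tendsto M (\<lambda>m \<omega>. G m (\<lambda>s. B s \<omega>)) X"
    using assms(1) unfolding is_wiener_ito_iff_simple_pairs by auto
  have fm: "f \<in> borel_measurable (lborel_pow k)" using f by (simp add: square_integrable_def)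
  have "(\<lambda>m. ennreal (real (k ^ k)) * (2 * (\<integral>\<^sup>+x. ennreal ((\<phi> m x - f x)\<^sup>2) \<partial>lborel_pow k) +
       2 * (\<integral>\<^sup>+x. ennreal ((\<psi> m x - f x)\<^sup>2) \<partial>lborel_pow k))) \<longlonglongrightarrow> ennreal (real (k ^ k)) * (2 * 0 + 2 * 0)"
    using lim G(2) unfolding L2_tendsto_def by (intro ennreal_tendsto_cmult tendsto_add) auto
  then have lim0: "(\<lambda>m. ennreal (real (k ^ k)) * (2 * (\<integral>\<^sup>+x. ennreal ((\<phi> m x - f x)\<^sup>2) \<partial>lborel_pow k) +
       2 * (\<integral>\<^sup>+x. ennreal ((\<psi> m x - f x)\<^sup>2) \<partial>lborel_pow k))) \<longlonglongrightarrow> 0" by simp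
  have "(\<lambda>m. \<integral>\<^sup>+\<omega>. ennreal ((F m (\<lambda>s. B s \<omega>) - G m (\<lambda>s. B s \<omega>))\<^sup>2) \<partial>M) \<longlonglongrightarrow> 0"
    by (rule tendsto_sandwich[OF _ _ tendsto_const lim0])
      (intro always_eventually allI zero_le simple_pair_integral_dist_le sp G fm)+
  then show ?thesis
    using X by (intro L2_tendsto_diagonal[OF G(3)] simple_pair_integral_measurable[OF sp]
        simple_pair_integral_measurable[OF G(1)]) (auto simp: square_integrable_def)
qed

lemma wiener_ito_exists:
  assumes f: "square_integrable (lborel_pow k) f"
  obtains X where "is_wiener_ito M B k f X"
proof -
  obtain \<phi> F where sp: "\<And>m. simple_pair k (\<phi> m) (F m)" and lim: "L2_tendsto (lborel_pow k) \<phi> f"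
    and fm: "f \<in> borel_measurable (lborel_pow k)"
    by (rule simple_approximableE[OF simple_approximable_square_integrable[OF f]]) auto
  have "\<exists>N. \<forall>i\<ge>N. \<forall>j\<ge>N. (\<integral>\<^sup>+\<omega>. ennreal ((F i (\<lambda>s. B s \<omega>) - F j (\<lambda>s. B s \<omega>))\<^sup>2) \<partial>M) < ennreal e"
    if e: "e > 0" for e
  proof -
    define d where "d m = ennreal (real (k ^ k)) * (2 * (\<integral>\<^sup>+x. ennreal ((\<phi> m x - f x)\<^sup>2) \<partial>lborel_pow k))" for m
    have "d \<longlonglongrightarrow> ennreal (real (k ^ k)) * (2 * 0)"
      using lim unfolding L2_tendsto_def d_def[abs_def] by (intro ennreal_tendsto_cmult) auto
    then have "\<forall>\<^sub>F m in sequentially. d m < ennreal (e / 2)"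
      using e by (intro order_tendstoD(2)) (auto simp: ennreal_zero_less_mult_iff)
    then obtain N where N: "\<And>m. m \<ge> N \<Longrightarrow> d m < ennreal (e / 2)"
      unfolding eventually_sequentially by auto
    have "(\<integral>\<^sup>+\<omega>. ennreal ((F i (\<lambda>s. B s \<omega>) - F j (\<lambda>s. B s \<omega>))\<^sup>2) \<partial>M) < ennreal e" if "i \<ge> N" "j \<ge> N" for i j
    proof -
      have "(\<integral>\<^sup>+\<omega>. ennreal ((F i (\<lambda>s. B s \<omega>) - F j (\<lambda>s. B s \<omega>))\<^sup>2) \<partial>M) \<le> d i + d j"
        using simple_pair_integral_dist_le[OF sp sp fm, of i j] by (simp add: d_def distrib_left)
      also have "\<dots> < ennreal (e / 2) + ennreal (e / 2)"
        by (intro add_strict_mono N that)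
      also have "\<dots> = ennreal e" using e by (simp flip: ennreal_plus)
      finally show ?thesis .
    qed
    then show ?thesis by blast
  qed
  from L2_complete[OF simple_pair_integral_square_integrable[OF sp] this]
  obtain X where "square_integrable M X" "L2_tendsto M (\<lambda>m \<omega>. F m (\<lambda>s. B s \<omega>)) X" .
  with f sp lim have "is_wiener_ito M B k f X"
    unfolding is_wiener_ito_iff_simple_pairs by (intro conjI exI[of _ \<phi>] exI[of _ F]) auto
  then show ?thesis by (rule that)
qed

lemma is_wiener_ito_wiener_ito:
  "square_integrable (lborel_pow k) f \<Longrightarrow> is_wiener_ito M B k f (wiener_ito M B k f)"
  unfolding wiener_ito_def by (metis someI wiener_ito_exists)

lemma is_wiener_ito_diff:
  assumes "is_wiener_ito M B k f X" "is_wiener_ito M B k g Y"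
  shows "is_wiener_ito M B k (\<lambda>x. f x - g x) (\<lambda>\<omega>. X \<omega> - Y \<omega>)"
proof -
  have sq: "square_integrable (lborel_pow k) f" "square_integrable (lborel_pow k) g"
    "square_integrable M X" "square_integrable M Y"
    using assms by (auto simp: is_wiener_ito_def)
  obtain \<phi> F where 1: "\<And>m. simple_pair k (\<phi> m) (F m)" "L2_tendsto (lborel_pow k) \<phi> f"
    by (rule simple_approximableE[OF simple_approximable_square_integrable[OF sq(1)]]) auto
  obtain \<psi> G where 2: "\<And>m. simple_pair k (\<psi> m) (G m)" "L2_tendsto (lborel_pow k) \<psi> g"
    by (rule simple_approximableE[OF simple_approximable_square_integrable[OF sq(2)]]) auto
  have meas: "f \<in> borel_measurable (lborel_pow k)" "g \<in> borel_measurable (lborel_pow k)"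
     "X \<in> borel_measurable M" "Y \<in> borel_measurable M"
    using sq by (auto simp: square_integrable_def)
  note meas1 = simple_pair_measurable[OF 1(1)] simple_pair_measurable[OF 2(1)]
    simple_pair_integral_measurable[OF 1(1)] simple_pair_integral_measurable[OF 2(1)]
  have "L2_tendsto (lborel_pow k) (\<lambda>m x. \<phi> m x + (- 1) * \<psi> m x) (\<lambda>x. f x + (- 1) * g x)"
    using meas meas1 by (intro L2_tendsto_add L2_tendsto_cmult 1 2) auto
  moreover have "L2_tendsto M (\<lambda>m \<omega>. F m (\<lambda>s. B s \<omega>) + (- 1) * G m (\<lambda>s. B s \<omega>)) (\<lambda>\<omega>. X \<omega> + (- 1) * Y \<omega>)"
    using meas meas1
    by (intro L2_tendsto_add L2_tendsto_cmult L2_tendsto_wiener_ito[OF assms(1) 1]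
        L2_tendsto_wiener_ito[OF assms(2) 2]) auto
  moreover have "simple_pair k (\<lambda>x. \<phi> m x - \<psi> m x) (\<lambda>b. F m b - G m b)" for m
    by (intro simple_pair_diff 1 2)
  ultimately show ?thesis
    unfolding is_wiener_ito_iff_simple_pairs using sq
    by (intro conjI exI[of _ "\<lambda>m x. \<phi> m x - \<psi> m x"] exI[of _ "\<lambda>m b. F m b - G m b"])
      (auto intro: square_integrable_diff)
qed

end

lemma is_wiener_ito_cong_AE:
  assumes "is_wiener_ito M B k f X" and ae: "AE x in lborel_pow k. f x = g x"
    and g: "g \<in> borel_measurable (lborel_pow k)"
  shows "is_wiener_ito M B k g X"
proof -
  have "(\<integral>\<^sup>+x. ennreal ((\<phi> x - f x)\<^sup>2) \<partial>lborel_pow k) = (\<integral>\<^sup>+x. ennreal ((\<phi> x - g x)\<^sup>2) \<partial>lborel_pow k)" for \<phi>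
    using ae by (intro nn_integral_cong_AE) auto
  moreover have "(\<integral>\<^sup>+x. ennreal ((f x)\<^sup>2) \<partial>lborel_pow k) = (\<integral>\<^sup>+x. ennreal ((g x)\<^sup>2) \<partial>lborel_pow k)"
    using ae by (intro nn_integral_cong_AE) auto
  ultimately show ?thesis
    using assms(1) g unfolding is_wiener_ito_def L2_tendsto_def square_integrable_iff_nn_integral
    by simp
qed

lemma is_wiener_ito_cmult:
  assumes "brownian_increments M B" "is_wiener_ito M B k f X"
  shows "is_wiener_ito M B k (\<lambda>x. c * f x) (\<lambda>\<omega>. c * X \<omega>)"
proof -
  interpret brownian_increments M B by fact
  obtain \<phi> F where sq: "square_integrable (lborel_pow k) f" "square_integrable M X"
    and 1: "\<And>m. simple_pair k (\<phi> m) (F m)" "L2_tendsto (lborel_pow k) \<phi> f"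
      "L2_tendsto M (\<lambda>m \<omega>. F m (\<lambda>s. B s \<omega>)) X"
    using assms(2) unfolding is_wiener_ito_iff_simple_pairs by auto
  have "L2_tendsto (lborel_pow k) (\<lambda>m x. c * \<phi> m x) (\<lambda>x. c * f x)"
    using sq by (intro L2_tendsto_cmult 1 simple_pair_measurable[OF 1(1)]) (auto simp: square_integrable_def)
  moreover have "L2_tendsto M (\<lambda>m \<omega>. c * F m (\<lambda>s. B s \<omega>)) (\<lambda>\<omega>. c * X \<omega>)"
    using sq by (intro L2_tendsto_cmult 1 simple_pair_integral_measurable[OF 1(1)])
      (auto simp: square_integrable_def)
  ultimately show ?thesis
    unfolding is_wiener_ito_iff_simple_pairs
    by (intro conjI square_integrable_cmult sq exI[of _ "\<lambda>m x. c * \<phi> m x"]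
        exI[of _ "\<lambda>m b. c * F m b"] allI simple_pair_scale 1) auto
qed

section \<open>Finite-dimensional laws and affine changes of time\<close>

text \<open>Orthants determine a law on a finite product; their indicators are limits of products of
  continuous ramps, whose expectations pass to almost sure limits.\<close>

lemma distr_PiM_eq_AE_limit:
  fixes X :: "nat \<Rightarrow> 'i \<Rightarrow> 'a \<Rightarrow> real" and X' :: "nat \<Rightarrow> 'i \<Rightarrow> 'b \<Rightarrow> real"
  assumes "prob_space M" "prob_space M'" and J: "finite J"
    and [measurable]: "\<And>n j. j \<in> J \<Longrightarrow> X n j \<in> borel_measurable M" "\<And>j. j \<in> J \<Longrightarrow> Y j \<in> borel_measurable M"
      "\<And>n j. j \<in> J \<Longrightarrow> X' n j \<in> borel_measurable M'" "\<And>j. j \<in> J \<Longrightarrow> Y' j \<in> borel_measurable M'"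
    and lim: "\<And>j. j \<in> J \<Longrightarrow> AE \<omega> in M. (\<lambda>n. X n j \<omega>) \<longlonglongrightarrow> Y j \<omega>"
    and lim': "\<And>j. j \<in> J \<Longrightarrow> AE \<omega> in M'. (\<lambda>n. X' n j \<omega>) \<longlonglongrightarrow> Y' j \<omega>"
    and eq: "\<And>n. distr M (Pi\<^sub>M J (\<lambda>_. borel)) (\<lambda>\<omega>. \<lambda>j\<in>J. X n j \<omega>) =
      distr M' (Pi\<^sub>M J (\<lambda>_. borel)) (\<lambda>\<omega>. \<lambda>j\<in>J. X' n j \<omega>)"
  shows "distr M (Pi\<^sub>M J (\<lambda>_. borel)) (\<lambda>\<omega>. \<lambda>j\<in>J. Y j \<omega>) =
    distr M' (Pi\<^sub>M J (\<lambda>_. borel)) (\<lambda>\<omega>. \<lambda>j\<in>J. Y' j \<omega>)" (is "?D = ?D'")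
proof -
  interpret M: prob_space M by fact
  interpret M': prob_space M' by fact
  \<comment> \<open>For \<open>s > 0\<close> this is 1 up to 0, falls linearly and is 0 from
    \<open>1 / s\<close> on; as \<open>s\<close> grows it decreases to the indicator of
    \<open>{..0}\<close>.\<close>
  define ramp :: "nat \<Rightarrow> real \<Rightarrow> real" where "ramp s z = max 0 (min 1 (1 - real s * z))" for s z
  have ramp_cont [continuous_intros]: "isCont (ramp s) z" for s z
    unfolding ramp_def by (intro continuous_intros)
  have [measurable]: "ramp s \<in> borel_measurable borel" for s
    unfolding ramp_def by measurable
  have ramp01: "0 \<le> ramp s z" "ramp s z \<le> 1" for s z by (auto simp: ramp_def)
  have ramp_lim: "(\<lambda>s. ramp s z) \<longlonglongrightarrow> indicator {..0} z" for z
  proof (cases "z \<le> 0")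
    case True
    then show ?thesis by (simp add: ramp_def mult_nonneg_nonpos)
  next
    case False
    obtain N where "1 / z < real N" using reals_Archimedean2 by blast
    then have "ramp s z = 0" if "s \<ge> N" for s
    proof -
      have "1 / z < real s" using that \<open>1 / z < real N\<close> by linarith
      then have "1 < real s * z" using False by (simp add: field_simps)
      then show ?thesis by (simp add: ramp_def)
    qed
    then have "\<forall>\<^sub>F s in sequentially. ramp s z = 0" by (auto simp: eventually_sequentially)
    then show ?thesis using False by (simp add: tendsto_eventually)
  qed
  \<comment> \<open>The limit in \<open>n\<close> is taken for a fixed ramp, where continuity lets
    almost sure convergence pass through. The discontinuous indicator is reached only afterwards, by
    the limit in \<open>s\<close>.\<close>
  have ramps: "(\<integral>\<^sup>+\<omega>. ennreal (\<Prod>j\<in>J. ramp s (Y j \<omega> - \<rho> j)) \<partial>M) =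
     (\<integral>\<^sup>+\<omega>. ennreal (\<Prod>j\<in>J. ramp s (Y' j \<omega> - \<rho> j)) \<partial>M')" for s \<rho>
  proof (rule LIMSEQ_unique)
    let ?g = "\<lambda>x. ennreal (\<Prod>j\<in>J. ramp s (x j - \<rho> j))"
    have g [measurable]: "?g \<in> borel_measurable (Pi\<^sub>M J (\<lambda>_. borel))" by measurable
    have "(\<integral>\<^sup>+\<omega>. ennreal (\<Prod>j\<in>J. ramp s (X n j \<omega> - \<rho> j)) \<partial>M) =
        (\<integral>\<^sup>+\<omega>. ennreal (\<Prod>j\<in>J. ramp s (X' n j \<omega> - \<rho> j)) \<partial>M')" for n
    proof -
      have "(\<integral>\<^sup>+x. ?g x \<partial>distr M (Pi\<^sub>M J (\<lambda>_. borel)) (\<lambda>\<omega>. \<lambda>j\<in>J. X n j \<omega>)) =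
        (\<integral>\<^sup>+x. ?g x \<partial>distr M' (Pi\<^sub>M J (\<lambda>_. borel)) (\<lambda>\<omega>. \<lambda>j\<in>J. X' n j \<omega>))"
        using eq[of n] by simp
      then show ?thesis by (simp add: nn_integral_distr)
    qed
    moreover have "(\<lambda>n. \<integral>\<^sup>+\<omega>. ennreal (\<Prod>j\<in>J. ramp s (X n j \<omega> - \<rho> j)) \<partial>M) \<longlonglongrightarrow>
        (\<integral>\<^sup>+\<omega>. ennreal (\<Prod>j\<in>J. ramp s (Y j \<omega> - \<rho> j)) \<partial>M)"
    proof (rule nn_integral_dominated_convergence[where w="\<lambda>_. 1"])
      have "AE \<omega> in M. \<forall>j\<in>J. (\<lambda>n. X n j \<omega>) \<longlonglongrightarrow> Y j \<omega>"
        using lim by (intro AE_finite_allI J) auto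
      then show "AE \<omega> in M. (\<lambda>n. ennreal (\<Prod>j\<in>J. ramp s (X n j \<omega> - \<rho> j))) \<longlonglongrightarrow>
          ennreal (\<Prod>j\<in>J. ramp s (Y j \<omega> - \<rho> j))"
        by eventually_elim (auto intro!: tendsto_ennrealI tendsto_prod isCont_tendsto_compose[OF ramp_cont] tendsto_diff)
    qed (use ramp01 in \<open>auto simp: M.emeasure_space_1 intro!: prod_le_1\<close>)
    moreover have "(\<lambda>n. \<integral>\<^sup>+\<omega>. ennreal (\<Prod>j\<in>J. ramp s (X' n j \<omega> - \<rho> j)) \<partial>M') \<longlonglongrightarrow>
        (\<integral>\<^sup>+\<omega>. ennreal (\<Prod>j\<in>J. ramp s (Y' j \<omega> - \<rho> j)) \<partial>M')"
    proof (rule nn_integral_dominated_convergence[where w="\<lambda>_. 1"])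
      have "AE \<omega> in M'. \<forall>j\<in>J. (\<lambda>n. X' n j \<omega>) \<longlonglongrightarrow> Y' j \<omega>"
        using lim' by (intro AE_finite_allI J) auto
      then show "AE \<omega> in M'. (\<lambda>n. ennreal (\<Prod>j\<in>J. ramp s (X' n j \<omega> - \<rho> j))) \<longlonglongrightarrow>
          ennreal (\<Prod>j\<in>J. ramp s (Y' j \<omega> - \<rho> j))"
        by eventually_elim (auto intro!: tendsto_ennrealI tendsto_prod isCont_tendsto_compose[OF ramp_cont] tendsto_diff)
    qed (use ramp01 in \<open>auto simp: M'.emeasure_space_1 intro!: prod_le_1\<close>)
    ultimately show "(\<lambda>n. \<integral>\<^sup>+\<omega>. ennreal (\<Prod>j\<in>J. ramp s (X n j \<omega> - \<rho> j)) \<partial>M) \<longlonglongrightarrow>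
        (\<integral>\<^sup>+\<omega>. ennreal (\<Prod>j\<in>J. ramp s (Y j \<omega> - \<rho> j)) \<partial>M)"
      "(\<lambda>n. \<integral>\<^sup>+\<omega>. ennreal (\<Prod>j\<in>J. ramp s (X n j \<omega> - \<rho> j)) \<partial>M) \<longlonglongrightarrow>
        (\<integral>\<^sup>+\<omega>. ennreal (\<Prod>j\<in>J. ramp s (Y' j \<omega> - \<rho> j)) \<partial>M')"
      by simp_all
  qed
  have orthant: "emeasure (distr N (Pi\<^sub>M J (\<lambda>_. borel)) (\<lambda>\<omega>. \<lambda>j\<in>J. Z j \<omega>)) (PiE J (\<lambda>j. {..\<rho> j})) =
      (\<integral>\<^sup>+\<omega>. ennreal (\<Prod>j\<in>J. indicator {..0} (Z j \<omega> - \<rho> j)) \<partial>N)"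
    and ramp_limit: "(\<lambda>s. \<integral>\<^sup>+\<omega>. ennreal (\<Prod>j\<in>J. ramp s (Z j \<omega> - \<rho> j)) \<partial>N) \<longlonglongrightarrow>
      (\<integral>\<^sup>+\<omega>. ennreal (\<Prod>j\<in>J. indicator {..0} (Z j \<omega> - \<rho> j)) \<partial>N)"
    if N: "prob_space N" and [measurable]: "\<And>j. j \<in> J \<Longrightarrow> Z j \<in> borel_measurable N"
    for N :: "'c measure" and Z :: "'i \<Rightarrow> 'c \<Rightarrow> real" and \<rho>
  proof -
    interpret N: prob_space N by fact
    have [measurable]: "PiE J (\<lambda>j. {..\<rho> j}) \<in> sets (Pi\<^sub>M J (\<lambda>_. borel))"
      using J by (intro sets_PiM_I_finite) auto
    have ind: "(\<Prod>j\<in>J. indicator {..0} (Z j \<omega> - \<rho> j)) =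
        (indicator (PiE J (\<lambda>j. {..\<rho> j})) (\<lambda>j\<in>J. Z j \<omega>) :: real)" for \<omega>
    proof (cases "\<forall>j\<in>J. Z j \<omega> \<le> \<rho> j")
      case True
      then show ?thesis by (auto simp: PiE_iff intro!: prod.neutral)
    next
      case False
      then obtain j where "j \<in> J" "\<not> Z j \<omega> \<le> \<rho> j" by auto
      then have "(\<Prod>j\<in>J. indicator {..0} (Z j \<omega> - \<rho> j) :: real) = 0"
        by (intro prod_zero J bexI[of _ j]) auto
      moreover have "(\<lambda>j\<in>J. Z j \<omega>) \<notin> PiE J (\<lambda>j. {..\<rho> j})"
        using \<open>j \<in> J\<close> \<open>\<not> Z j \<omega> \<le> \<rho> j\<close> by auto
      ultimately show ?thesis by simp
    qed
    show "emeasure (distr N (Pi\<^sub>M J (\<lambda>_. borel)) (\<lambda>\<omega>. \<lambda>j\<in>J. Z j \<omega>)) (PiE J (\<lambda>j. {..\<rho> j})) =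
      (\<integral>\<^sup>+\<omega>. ennreal (\<Prod>j\<in>J. indicator {..0} (Z j \<omega> - \<rho> j)) \<partial>N)"
      unfolding ind
      by (subst nn_integral_indicator[symmetric], simp, subst nn_integral_distr) (auto simp: ennreal_indicator)
    show "(\<lambda>s. \<integral>\<^sup>+\<omega>. ennreal (\<Prod>j\<in>J. ramp s (Z j \<omega> - \<rho> j)) \<partial>N) \<longlonglongrightarrow>
      (\<integral>\<^sup>+\<omega>. ennreal (\<Prod>j\<in>J. indicator {..0} (Z j \<omega> - \<rho> j)) \<partial>N)"
    proof (rule nn_integral_dominated_convergence[where w="\<lambda>_. 1"])
      show "AE \<omega> in N. (\<lambda>s. ennreal (\<Prod>j\<in>J. ramp s (Z j \<omega> - \<rho> j))) \<longlonglongrightarrow>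
          ennreal (\<Prod>j\<in>J. indicator {..0} (Z j \<omega> - \<rho> j))"
        by (intro AE_I2 tendsto_ennrealI tendsto_prod ramp_lim)
    qed (use ramp01 in \<open>auto simp: N.emeasure_space_1 intro!: prod_le_1\<close>)
  qed
  have eqo: "emeasure ?D (PiE J (\<lambda>j. {..\<rho> j})) = emeasure ?D' (PiE J (\<lambda>j. {..\<rho> j}))" for \<rho>
  proof -
    show ?thesis
      using LIMSEQ_unique[OF ramp_limit[of M Y \<rho>, unfolded ramps] ramp_limit[of M' Y' \<rho>]]
        assms(1,2) by (simp add: orthant)
  qed
  note sets = sets_PiM_borel_atMost[OF J]
  show ?thesis
  proof (rule measure_eqI_generator_eq[OF Int_stable_PiE_atMost[of J]])
    show "range (\<lambda>\<rho>. PiE J (\<lambda>i. {..\<rho> i})) \<subseteq> Pow (PiE J (\<lambda>_. UNIV :: real set))" by (auto simp: PiE_iff)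
    show "emeasure ?D A = emeasure ?D' A" if "A \<in> range (\<lambda>\<rho>. PiE J (\<lambda>i. {..\<rho> i}))" for A
      using that eqo by auto
    show "range (\<lambda>n::nat. PiE J (\<lambda>_. {..real n})) \<subseteq> range (\<lambda>\<rho>. PiE J (\<lambda>i. {..\<rho> i}))" by auto
    show "(\<Union>n::nat. PiE J (\<lambda>_. {..real n})) = PiE J (\<lambda>_. UNIV)"
    proof (intro equalityI subsetI)
      fix x :: "'i \<Rightarrow> real" assume x: "x \<in> PiE J (\<lambda>_. UNIV)"
      \<comment> \<open>The sum bounds all coordinates at once and makes sense for empty
        \<open>J\<close>.\<close>
      obtain n where n: "(\<Sum>j\<in>J. \<bar>x j\<bar>) \<le> real n" using real_arch_simple by blast
      have "x j \<le> real n" if "j \<in> J" for j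
        using n member_le_sum[OF that, of "\<lambda>j. \<bar>x j\<bar>"] J by force
      then show "x \<in> (\<Union>n::nat. PiE J (\<lambda>_. {..real n}))" using x by (auto simp: PiE_iff)
    qed (auto simp: PiE_iff)
    have "prob_space ?D" by (intro M.prob_space_distr measurable_restrict) auto
    then show "emeasure ?D (PiE J (\<lambda>_. {..real n})) \<noteq> \<infinity>" for n :: nat
      by (simp add: prob_space_def finite_measure.emeasure_finite)
  qed (simp_all add: sets)
qed

text \<open>For each \<open>t\<close> one sequence of simple pairs is evaluated on both motions. At
  every stage \<open>m\<close> the joint laws over a finite \<open>J\<close> agree, and the almost
  sure limits inherit this.\<close>

lemma wiener_ito_fdd_equal:
  fixes X :: "'t \<Rightarrow> 'a \<Rightarrow> real" and X' :: "'t \<Rightarrow> 'b \<Rightarrow> real"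
  assumes "brownian_increments M B" "brownian_increments M' B'"
    and X: "\<And>t. is_wiener_ito M B k (f t) (X t)" and X': "\<And>t. is_wiener_ito M' B' k (f t) (X' t)"
  shows "fdd_equal M X M' X'"
proof -
  interpret brownian_increments M B by fact
  interpret B': brownian_increments M' B' by fact
  have sq: "square_integrable M (X t)" "square_integrable M' (X' t)" for t
    using X X' by (auto simp: is_wiener_ito_def)
  then have meas: "X t \<in> borel_measurable M" "X' t \<in> borel_measurable M'" for t
    by (auto simp: square_integrable_def)
  have "\<exists>pr. (\<forall>m. simple_pair k (fst (pr m)) (snd (pr m))) \<and>
     (AE \<omega> in M. (\<lambda>m. snd (pr m) (\<lambda>s. B s \<omega>)) \<longlonglongrightarrow> X t \<omega>) \<and>
     (AE \<omega> in M'. (\<lambda>m. snd (pr m) (\<lambda>s. B' s \<omega>)) \<longlonglongrightarrow> X' t \<omega>)" for t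
  proof -
    obtain \<phi> F where sp: "\<And>m. simple_pair k (\<phi> m) (F m)" and lim: "L2_tendsto (lborel_pow k) \<phi> (f t)"
      using X[of t] unfolding is_wiener_ito_iff_simple_pairs by auto
    note L = L2_tendsto_wiener_ito[OF X sp lim] and L' = B'.L2_tendsto_wiener_ito[OF X' sp lim]
    obtain r :: "nat \<Rightarrow> nat" where r: "strict_mono r" "AE \<omega> in M. (\<lambda>m. F (r m) (\<lambda>s. B s \<omega>)) \<longlonglongrightarrow> X t \<omega>"
      by (rule L2_tendsto_AE_subseq[OF L simple_pair_integral_square_integrable[OF sp] sq(1)])
    \<comment> \<open>\<open>q\<close> refines the subsequence \<open>r\<close> found for
      \<open>M\<close>, so convergence holds almost surely on both spaces along the same
      indices.\<close>
    obtain q :: "nat \<Rightarrow> nat" where q: "strict_mono q" "AE \<omega> in M'. (\<lambda>m. F (r (q m)) (\<lambda>s. B' s \<omega>)) \<longlonglongrightarrow> X' t \<omega>"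
      by (rule L2_tendsto_AE_subseq[OF L2_tendsto_subseq[OF L' r(1)]
            B'.simple_pair_integral_square_integrable[OF sp] sq(2)])
    have "AE \<omega> in M. (\<lambda>m. F (r (q m)) (\<lambda>s. B s \<omega>)) \<longlonglongrightarrow> X t \<omega>"
      using r(2)
    proof eventually_elim
      case (elim \<omega>)
      from LIMSEQ_subseq_LIMSEQ[OF this q(1)] show ?case by (simp add: comp_def)
    qed
    with q(2) sp show ?thesis by (intro exI[of _ "\<lambda>m. (\<phi> (r (q m)), F (r (q m)))"]) simp
  qed
  then obtain pr where pr: "\<forall>t. (\<forall>m. simple_pair k (fst (pr t m)) (snd (pr t m))) \<and>
     (AE \<omega> in M. (\<lambda>m. snd (pr t m) (\<lambda>s. B s \<omega>)) \<longlonglongrightarrow> X t \<omega>) \<and>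
     (AE \<omega> in M'. (\<lambda>m. snd (pr t m) (\<lambda>s. B' s \<omega>)) \<longlonglongrightarrow> X' t \<omega>)"
    by (rule choice[OF allI, THEN exE])
  then have sp: "simple_pair k (fst (pr t m)) (snd (pr t m))" for t m by auto
  show ?thesis
    unfolding fdd_equal_def
  proof (intro conjI allI impI)
    fix J :: "'t set" assume J: "finite J"
    show "distr M (Pi\<^sub>M J (\<lambda>_. borel)) (\<lambda>\<omega>. \<lambda>t\<in>J. X t \<omega>) =
      distr M' (Pi\<^sub>M J (\<lambda>_. borel)) (\<lambda>\<omega>. \<lambda>t\<in>J. X' t \<omega>)"
      using pr by (intro distr_PiM_eq_AE_limit[OF prob_space_axioms B'.prob_space_axioms J
            simple_pair_integral_measurable[OF sp] meas(1) B'.simple_pair_integral_measurable[OF sp] meas(2)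
            _ _ simple_pairs_distr_eq[OF assms(1,2) J sp]]) auto
  qed (rule meas)+
qed

text \<open>The one-dimensional substitution in each coordinate contributes a factor
  \<open>c\<close>. Restricting to \<open>{..<k}\<close> keeps the image point extensional, hence
  inside the product space.\<close>

lemma lborel_pow_affine:
  assumes c: "c > 0"
  shows "density (distr (lborel_pow k) (lborel_pow k) (\<lambda>x. \<lambda>i\<in>{..<k}. c * x i + h)) (\<lambda>_. ennreal (c ^ k)) =
    lborel_pow k"
proof -
  interpret product_sigma_finite "\<lambda>_. lborel :: real measure" by standard
  let ?T = "\<lambda>x :: nat \<Rightarrow> real. \<lambda>i\<in>{..<k}. c * x i + h"
  have T [measurable]: "?T \<in> measurable (lborel_pow k) (lborel_pow k)" by measurable
  show ?thesis
  proof (rule PiM_eqI)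
    fix A :: "nat \<Rightarrow> real set" assume "\<And>i. i \<in> {..<k} \<Longrightarrow> A i \<in> sets lborel"
    then have [measurable]: "i < k \<Longrightarrow> A i \<in> sets borel" for i by simp
    define V where "V i = (\<lambda>x. h + c * x) -` A i" for i
    have V: "i < k \<Longrightarrow> V i \<in> sets borel" for i
      unfolding V_def using measurable_sets[of "\<lambda>x. h + c * x" borel borel "A i"] by simp
    have A: "PiE {..<k} A \<in> sets (lborel_pow k)" by (intro sets_PiM_I_finite) auto
    have one: "emeasure lborel (A i) = ennreal c * emeasure lborel (V i)" if "i < k" for i
    proof -
      have "emeasure lborel (A i) = emeasure (density (distr lborel borel (\<lambda>x. h + c * x)) (\<lambda>_. ennreal \<bar>c\<bar>)) (A i)"
        using lborel_real_affine[of c h] c by simp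
      also have "\<dots> = ennreal c * emeasure lborel (V i)"
        using that c by (subst emeasure_density_const) (auto simp: emeasure_distr V_def)
      finally show ?thesis .
    qed
    have "?T -` PiE {..<k} A \<inter> space (lborel_pow k) = PiE {..<k} V"
    proof (intro set_eqI)
      fix x :: "nat \<Rightarrow> real"
      show "x \<in> ?T -` PiE {..<k} A \<inter> space (lborel_pow k) \<longleftrightarrow> x \<in> PiE {..<k} V"
        by (simp add: space_PiM PiE_iff V_def add.commute[of _ h])
    qed
    then have "emeasure (density (distr (lborel_pow k) (lborel_pow k) ?T) (\<lambda>_. ennreal (c ^ k))) (PiE {..<k} A) =
        ennreal (c ^ k) * emeasure (lborel_pow k) (PiE {..<k} V)"
      using A by (subst emeasure_density_const) (auto simp: emeasure_distr)
    also have "emeasure (lborel_pow k) (PiE {..<k} V) = (\<Prod>i<k. emeasure lborel (V i))"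
      using V by (intro emeasure_PiM) auto
    also have "ennreal (c ^ k) * \<dots> = (\<Prod>i<k. ennreal c * emeasure lborel (V i))"
      using c by (simp add: prod.distrib ennreal_power)
    also have "\<dots> = (\<Prod>i<k. emeasure lborel (A i))" by (intro prod.cong) (auto simp: one)
    finally show "emeasure (density (distr (lborel_pow k) (lborel_pow k) ?T) (\<lambda>_. ennreal (c ^ k))) (PiE {..<k} A) =
      (\<Prod>i<k. emeasure lborel (A i))" .
  qed auto
qed

lemma nn_integral_lborel_pow_affine:
  assumes c: "c > 0" and [measurable]: "f \<in> borel_measurable (lborel_pow k)"
  shows "(\<integral>\<^sup>+x. f x \<partial>lborel_pow k) =
    ennreal (c ^ k) * (\<integral>\<^sup>+x. f (\<lambda>i\<in>{..<k}. c * x i + h) \<partial>lborel_pow k)"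
proof -
  have [measurable]: "(\<lambda>x. \<lambda>i\<in>{..<k}. c * x i + h) \<in> measurable (lborel_pow k) (lborel_pow k)" by measurable
  show ?thesis
    by (subst lborel_pow_affine[OF c, of k h, symmetric])
      (simp add: nn_integral_density nn_integral_distr nn_integral_cmult)
qed

text \<open>The pullback of a box has endpoints \<open>(l i - h) / c\<close> and
  \<open>(r i - h) / c\<close>. Each of the \<open>k\<close> increments of \<open>b\<close> equals
  \<open>sqrt c\<close> times an increment of the rescaled path, which accounts for
  \<open>sqrt c ^ k\<close>.\<close>

lemma simple_pair_affine:
  assumes "simple_pair k \<phi> F" and c: "c > 0"
  shows "\<exists>G. simple_pair k (\<lambda>x. \<phi> (\<lambda>i\<in>{..<k}. c * x i + h)) G \<and>
    (\<forall>b. F b = sqrt c ^ k * G (\<lambda>s. b (c * s + h) / sqrt c))"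
  using assms(1)
proof induction
  case zero
  then show ?case using simple_pair.zero by (intro exI[of _ "\<lambda>_. 0"]) auto
next
  case (add_box \<phi> F l r d)
  then obtain G where G: "simple_pair k (\<lambda>x. \<phi> (\<lambda>i\<in>{..<k}. c * x i + h)) G"
    "\<And>b. F b = sqrt c ^ k * G (\<lambda>s. b (c * s + h) / sqrt c)" by blast
  define l' where "l' i = (l i - h) / c" for i
  define r' where "r' i = (r i - h) / c" for i
  have ends: "c * l' i + h = l i" "c * r' i + h = r i" for i using c by (auto simp: l'_def r'_def)
  have mem: "x \<in> {l' i<..r' i} \<longleftrightarrow> c * x + h \<in> {l i<..r i}" for x i
    using c by (auto simp: l'_def r'_def field_simps)
  have "(\<Prod>i<k. indicator {l i<..r i} ((\<lambda>i\<in>{..<k}. c * x i + h) i)) =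
      (\<Prod>i<k. indicator {l' i<..r' i} (x i) :: real)" for x
    by (intro prod.cong refl) (simp add: indicator_def mem del: greaterThanAtMost_iff)
  moreover have "simple_pair k (\<lambda>x. \<phi> (\<lambda>i\<in>{..<k}. c * x i + h) + d * (\<Prod>i<k. indicator {l' i<..r' i} (x i)))
     (\<lambda>b. G b + d * (\<Prod>i<k. b (r' i) - b (l' i)))"
  proof (rule simple_pair.add_box[OF G(1)])
    show "l' i \<le> r' i" if "i < k" for i
      using add_box.hyps(2)[OF that] c by (simp add: l'_def r'_def divide_right_mono)
    show "{l' i<..r' i} \<inter> {l' j<..r' j} = {}" if "i < k" "j < k" "i \<noteq> j" for i j
      using add_box.hyps(3)[OF that] mem by blast
  qed
  moreover have "F b + d * (\<Prod>i<k. b (r i) - b (l i)) = sqrt c ^ k * (G (\<lambda>s. b (c * s + h) / sqrt c) +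
      d * (\<Prod>i<k. b (c * r' i + h) / sqrt c - b (c * l' i + h) / sqrt c))" for b
  proof -
    have "(\<Prod>i<k. b (r i) - b (l i)) = (\<Prod>i<k. sqrt c * (b (c * r' i + h) / sqrt c - b (c * l' i + h) / sqrt c))"
      using c by (intro prod.cong refl) (simp add: ends right_diff_distrib)
    also have "\<dots> = sqrt c ^ k * (\<Prod>i<k. b (c * r' i + h) / sqrt c - b (c * l' i + h) / sqrt c)"
      by (simp add: prod.distrib)
    finally show ?thesis by (simp add: G(2) distrib_left)
  qed
  ultimately show ?case
    by (intro exI[of _ "\<lambda>b. G b + d * (\<Prod>i<k. b (r' i) - b (l' i))"]) (simp only: simp_thms)
qed

text \<open>Substitution for the multiple integral. For simple pairs the identity holds path by
  path, and the pullback multiplies squared L2 distances by \<open>1 / c ^ k\<close>, so it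
  preserves approximation.\<close>

lemma is_wiener_ito_affine:
  assumes "brownian_increments M B" and g: "is_wiener_ito M B k g Y" and c: "c > 0"
  shows "is_wiener_ito M (\<lambda>s \<omega>. B (c * s + h) \<omega> / sqrt c) k
    (\<lambda>x. g (\<lambda>i\<in>{..<k}. c * x i + h)) (\<lambda>\<omega>. (1 / sqrt c ^ k) * Y \<omega>)"
proof -
  interpret brownian_increments M B by fact
  let ?T = "\<lambda>x :: nat \<Rightarrow> real. \<lambda>i\<in>{..<k}. c * x i + h"
  have T [measurable]: "?T \<in> measurable (lborel_pow k) (lborel_pow k)" by measurable
  obtain \<phi> F where sq: "square_integrable (lborel_pow k) g" "square_integrable M Y"
    and sp: "\<And>m. simple_pair k (\<phi> m) (F m)" and lim: "L2_tendsto (lborel_pow k) \<phi> g"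
      "L2_tendsto M (\<lambda>m \<omega>. F m (\<lambda>s. B s \<omega>)) Y"
    using g unfolding is_wiener_ito_iff_simple_pairs by auto
  have [measurable]: "g \<in> borel_measurable (lborel_pow k)" "\<phi> m \<in> borel_measurable (lborel_pow k)" for m
    using sq simple_pair_measurable[OF sp] by (auto simp: square_integrable_def)
  have "\<forall>m. \<exists>G. simple_pair k (\<lambda>x. \<phi> m (?T x)) G \<and>
      (\<forall>b. F m b = sqrt c ^ k * G (\<lambda>s. b (c * s + h) / sqrt c))"
    using simple_pair_affine[OF sp c] by blast
  then obtain G where "\<forall>m. simple_pair k (\<lambda>x. \<phi> m (?T x)) (G m) \<and>
      (\<forall>b. F m b = sqrt c ^ k * G m (\<lambda>s. b (c * s + h) / sqrt c))"
    by (rule choice[THEN exE])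
  then have G: "\<And>m. simple_pair k (\<lambda>x. \<phi> m (?T x)) (G m)"
    "\<And>m b. G m (\<lambda>s. b (c * s + h) / sqrt c) = (1 / sqrt c ^ k) * F m b" using c by auto
  have cv: "(\<integral>\<^sup>+x. f (?T x) \<partial>lborel_pow k) = ennreal (1 / c ^ k) * (\<integral>\<^sup>+x. f x \<partial>lborel_pow k)"
    if f: "f \<in> borel_measurable (lborel_pow k)" for f :: "_ \<Rightarrow> ennreal"
    unfolding nn_integral_lborel_pow_affine[OF c f, of h] using c
    by (simp add: mult.assoc[symmetric] ennreal_mult[symmetric])
  have "L2_tendsto (lborel_pow k) (\<lambda>m x. \<phi> m (?T x)) (\<lambda>x. g (?T x))"
  proof -
    have "(\<lambda>m. ennreal (1 / c ^ k) * (\<integral>\<^sup>+x. ennreal ((\<phi> m x - g x)\<^sup>2) \<partial>lborel_pow k)) \<longlonglongrightarrow> ennreal (1 / c ^ k) * 0"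
      using lim(1) unfolding L2_tendsto_def by (intro ennreal_tendsto_cmult) auto
    moreover have "(\<integral>\<^sup>+x. ennreal ((\<phi> m (?T x) - g (?T x))\<^sup>2) \<partial>lborel_pow k) =
        ennreal (1 / c ^ k) * (\<integral>\<^sup>+x. ennreal ((\<phi> m x - g x)\<^sup>2) \<partial>lborel_pow k)" for m
      by (rule cv[of "\<lambda>x. ennreal ((\<phi> m x - g x)\<^sup>2)"]) measurable
    ultimately show ?thesis unfolding L2_tendsto_def by simp
  qed
  moreover have "square_integrable (lborel_pow k) (\<lambda>x. g (?T x))"
    using sq(1) cv[of "\<lambda>x. ennreal ((g x)\<^sup>2)"]
    by (simp add: square_integrable_iff_nn_integral ennreal_mult_less_top)
  moreover have "L2_tendsto M (\<lambda>m \<omega>. G m (\<lambda>s. B (c * s + h) \<omega> / sqrt c)) (\<lambda>\<omega>. (1 / sqrt c ^ k) * Y \<omega>)"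
    unfolding G(2)[of _ "\<lambda>s. B s _"] using sq(2)
    by (intro L2_tendsto_cmult lim simple_pair_integral_measurable[OF sp]) (auto simp: square_integrable_def)
  ultimately show ?thesis
    unfolding is_wiener_ito_iff_simple_pairs using G(1)
    by (intro conjI square_integrable_cmult sq exI[of _ "\<lambda>m x. \<phi> m (?T x)"] exI[of _ G]) auto
qed

section \<open>The tempered Hermite kernel\<close>

text \<open>For \<open>p > 0\<close> the inequality \<open>y \<le> exp y\<close> at
  \<open>y = lam * x / p\<close>, raised to the power \<open>p\<close>, gives the constant
  \<open>(p / lam) powr p\<close>.\<close>

lemma powr_mult_exp_bounded:
  fixes p lam :: real
  assumes "p \<ge> 0" "lam > 0"
  obtains C where "C > 0" "\<And>x. x > 0 \<Longrightarrow> x powr p * exp (- lam * x) \<le> C"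
proof (cases "p = 0")
  case True
  then show ?thesis using assms by (intro that[of 1]) auto
next
  case False
  then have p: "p > 0" using assms by simp
  show ?thesis
  proof (rule that[of "(p / lam) powr p"])
    show "(p / lam) powr p > 0" using p assms by simp
    fix x :: real assume x: "x > 0"
    have "(lam * x / p) powr p \<le> exp (lam * x / p) powr p"
      using x p assms exp_ge_add_one_self[of "lam * x / p"] by (intro powr_mono2) (auto simp: field_simps)
    also have "\<dots> = exp (lam * x)" using p by (simp add: powr_def)
    finally have "(lam * x / p) powr p \<le> exp (lam * x)" .
    moreover have "x powr p = (p / lam) powr p * (lam * x / p) powr p"
      using x p assms by (subst powr_mult[symmetric]) (auto simp: field_simps)
    ultimately have "x powr p \<le> (p / lam) powr p * exp (lam * x)"
      by (simp add: mult_left_mono)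
    then show "x powr p * exp (- lam * x) \<le> (p / lam) powr p"
      by (simp add: exp_minus field_simps)
  qed
qed

lemma pos_powr_measurable [measurable]: "(\<lambda>x. pos_powr x a) \<in> borel_measurable borel"
  unfolding pos_powr_def by measurable

lemma pos_part_measurable [measurable]: "pos_part \<in> borel_measurable borel"
  unfolding pos_part_def[abs_def] by measurable

lemma pos_powr_nonneg [simp]: "0 \<le> pos_powr x a"
  by (simp add: pos_powr_def)

text \<open>The integral is split at \<open>u\<close>. As \<open>a \<le> 0\<close>, the factor
  \<open>(x + u) powr a\<close> is at most \<open>u powr a\<close> below \<open>u\<close> and at
  most \<open>x powr a\<close> above it. The two conditions on \<open>a\<close> are integrability at
  0 and at infinity.\<close>

lemma nn_integral_pos_powr_shift:
  fixes a u :: real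
  assumes a: "- 1 < a" "2 * a + 1 < 0" and u: "u > 0"
  shows "(\<integral>\<^sup>+x. ennreal (pos_powr x a * pos_powr (x + u) a) \<partial>lborel) \<le>
    ennreal ((1 / (a + 1) - 1 / (2 * a + 1)) * u powr (2 * a + 1))"
proof -
  have a0: "a \<le> 0" using a by simp
  have 1: "(\<integral>\<^sup>+x. ennreal (indicator {0..u} x * (u powr a * x powr a)) \<partial>lborel) =
      ennreal (u powr a * (u powr (a + 1) / (a + 1)))"
    by (rule nn_integral_has_integral_lebesgue)
      (use has_integral_mult_right[OF has_integral_powr_from_0[OF a(1), of u], of "u powr a"] u in auto)
  have 2: "(\<integral>\<^sup>+x. ennreal (indicator {u..} x * x powr (2 * a)) \<partial>lborel) =
      ennreal (- (u powr (2 * a + 1)) / (2 * a + 1))"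
    by (rule nn_integral_has_integral_lebesgue)
      (use has_integral_powr_to_inf[of "2 * a" u] a u in auto)
  have "(\<integral>\<^sup>+x. ennreal (pos_powr x a * pos_powr (x + u) a) \<partial>lborel) \<le>
      (\<integral>\<^sup>+x. ennreal (indicator {0..u} x * (u powr a * x powr a)) + ennreal (indicator {u..} x * x powr (2 * a)) \<partial>lborel)"
  proof (rule nn_integral_mono)
    fix x :: real
    have "pos_powr x a * pos_powr (x + u) a \<le> indicator {0..u} x * (u powr a * x powr a) + indicator {u..} x * x powr (2 * a)"
    proof (cases "x > 0")
      case False
      then show ?thesis by (simp add: pos_powr_def)
    next
      case True
      show ?thesis
      proof (cases "x \<le> u")
        case xu: True
        have "pos_powr x a * pos_powr (x + u) a = (x + u) powr a * x powr a"
          using True u by (simp add: pos_powr_def)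
        also have "\<dots> \<le> u powr a * x powr a"
          using True u a0 by (intro mult_right_mono powr_mono2') auto
        also have "\<dots> \<le> indicator {0..u} x * (u powr a * x powr a) + indicator {u..} x * x powr (2 * a)"
          using True xu by simp
        finally show ?thesis .
      next
        case False
        have "x powr a * (x + u) powr a \<le> x powr a * x powr a"
          using True u a0 by (intro mult_left_mono powr_mono2') auto
        then show ?thesis using True False u by (simp add: pos_powr_def powr_add[symmetric])
      qed
    qed
    then show "ennreal (pos_powr x a * pos_powr (x + u) a) \<le>
       ennreal (indicator {0..u} x * (u powr a * x powr a)) + ennreal (indicator {u..} x * x powr (2 * a))"
      using a0 by (auto dest!: ennreal_leI)
  qed
  also have "\<dots> = ennreal (u powr a * (u powr (a + 1) / (a + 1))) + ennreal (- (u powr (2 * a + 1)) / (2 * a + 1))"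
    by (subst nn_integral_add) (auto simp: 1 2)
  also have "\<dots> = ennreal ((1 / (a + 1) - 1 / (2 * a + 1)) * u powr (2 * a + 1))"
  proof -
    have "u powr a * u powr (a + 1) = u powr (2 * a + 1)" by (simp add: powr_add[symmetric])
    then have "u powr a * (u powr (a + 1) / (a + 1)) + - (u powr (2 * a + 1)) / (2 * a + 1) =
        (1 / (a + 1) - 1 / (2 * a + 1)) * u powr (2 * a + 1)"
      by (simp add: left_diff_distrib)
    moreover have "0 \<le> - (u powr (2 * a + 1)) / (2 * a + 1)" using a by (simp add: divide_nonneg_neg)
    ultimately show ?thesis using a u by (subst ennreal_plus[symmetric]) auto
  qed
  finally show ?thesis .
qed

text \<open>By symmetry \<open>r < s\<close>; the reflection \<open>y = r - x\<close> then gives the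
  shifted product with \<open>u = s - r\<close>.\<close>

lemma nn_integral_pos_powr_product:
  fixes a :: real
  assumes a: "- 1 < a" "2 * a + 1 < 0" and sr: "s \<noteq> r"
  shows "(\<integral>\<^sup>+y. ennreal (pos_powr (s - y) a * pos_powr (r - y) a) \<partial>lborel) \<le>
    ennreal ((1 / (a + 1) - 1 / (2 * a + 1)) * \<bar>s - r\<bar> powr (2 * a + 1))"
proof -
  have *: "(\<integral>\<^sup>+y. ennreal (pos_powr (s - y) a * pos_powr (r - y) a) \<partial>lborel) \<le>
    ennreal ((1 / (a + 1) - 1 / (2 * a + 1)) * \<bar>s - r\<bar> powr (2 * a + 1))" if "r < s" for s r
  proof -
    have "(\<integral>\<^sup>+y. ennreal (pos_powr (s - y) a * pos_powr (r - y) a) \<partial>lborel) =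
        (\<integral>\<^sup>+x. ennreal (pos_powr x a * pos_powr (x + (s - r)) a) \<partial>lborel)"
      by (subst nn_integral_real_affine[where c="-1" and t=r]) (auto simp: algebra_simps)
    then show ?thesis using nn_integral_pos_powr_shift[OF a, of "s - r"] that by simp
  qed
  show ?thesis
  proof (cases "r < s")
    case False
    then show ?thesis using *[of s r] sr by (simp add: mult.commute abs_minus_commute)
  qed (rule *)
qed

text \<open>Uniformly in \<open>s\<close>, the part of the inner integral on either side of
  \<open>s\<close> is at most the integral of \<open>x powr \<beta>\<close> over
  \<open>[0, b - a]\<close>.\<close>

lemma nn_integral_abs_powr_Icc_finite:
  fixes \<beta> a b :: real
  assumes \<beta>: "- 1 < \<beta>"
  shows "(\<integral>\<^sup>+s. (\<integral>\<^sup>+r. ennreal (\<bar>s - r\<bar> powr \<beta>) * indicator {a..b} r \<partial>lborel) * indicator {a..b} s \<partial>lborel) < \<infinity>"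
proof (cases "a \<le> b")
  case ab: True
  define L where "L = b - a"
  have L: "L \<ge> 0" using ab by (simp add: L_def)
  have half: "(\<integral>\<^sup>+x. ennreal (indicator {0..L} x * x powr \<beta>) \<partial>lborel) = ennreal (L powr (\<beta> + 1) / (\<beta> + 1))"
    by (rule nn_integral_has_integral_lebesgue) (use has_integral_powr_from_0[OF \<beta> L] in auto)
  have inner: "(\<integral>\<^sup>+r. ennreal (\<bar>s - r\<bar> powr \<beta>) * indicator {a..b} r \<partial>lborel) \<le> 2 * ennreal (L powr (\<beta> + 1) / (\<beta> + 1))"
    if s: "s \<in> {a..b}" for s
  proof -
    have "(\<integral>\<^sup>+r. ennreal (\<bar>s - r\<bar> powr \<beta>) * indicator {a..b} r \<partial>lborel) \<le>
        (\<integral>\<^sup>+r. ennreal (indicator {0..L} (s - r) * (s - r) powr \<beta>) + ennreal (indicator {0..L} (r - s) * (r - s) powr \<beta>) \<partial>lborel)"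
      using s by (intro nn_integral_mono) (auto simp: indicator_def L_def abs_if powr_def split: if_splits)
    also have "\<dots> = (\<integral>\<^sup>+r. ennreal (indicator {0..L} (s - r) * (s - r) powr \<beta>) \<partial>lborel) +
        (\<integral>\<^sup>+r. ennreal (indicator {0..L} (r - s) * (r - s) powr \<beta>) \<partial>lborel)"
      by (rule nn_integral_add) auto
    also have "(\<integral>\<^sup>+r. ennreal (indicator {0..L} (s - r) * (s - r) powr \<beta>) \<partial>lborel) = ennreal (L powr (\<beta> + 1) / (\<beta> + 1))"
      by (subst nn_integral_real_affine[where c="-1" and t=s]) (auto simp: half)
    also have "(\<integral>\<^sup>+r. ennreal (indicator {0..L} (r - s) * (r - s) powr \<beta>) \<partial>lborel) = ennreal (L powr (\<beta> + 1) / (\<beta> + 1))"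
      by (subst nn_integral_real_affine[where c="1" and t=s]) (auto simp: half)
    finally show ?thesis by (simp add: mult_2)
  qed
  have "(\<integral>\<^sup>+s. (\<integral>\<^sup>+r. ennreal (\<bar>s - r\<bar> powr \<beta>) * indicator {a..b} r \<partial>lborel) * indicator {a..b} s \<partial>lborel) \<le>
      (\<integral>\<^sup>+s. (2 * ennreal (L powr (\<beta> + 1) / (\<beta> + 1))) * indicator {a..b} s \<partial>lborel)"
    using inner by (intro nn_integral_mono) (auto simp: indicator_def)
  also have "\<dots> = 2 * ennreal (L powr (\<beta> + 1) / (\<beta> + 1)) * ennreal (b - a)"
    using ab by (simp add: nn_integral_cmult)
  also have "\<dots> < \<infinity>" by (simp add: ennreal_mult_less_top)
  finally show ?thesis .
qed simp

section \<open>The kernel over an arbitrary interval and its square integrability\<close>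

definition hermite_integrand :: "nat \<Rightarrow> real \<Rightarrow> real \<Rightarrow> (nat \<Rightarrow> real) \<Rightarrow> real \<Rightarrow> real" where
  "hermite_integrand k d lam y s = (\<Prod>i<k. pos_powr (s - y i) (d - 1) * exp (- lam * pos_part (s - y i)))"

text \<open>Both limits are free because the increments of the process lead to intervals that do not
  start at 0.\<close>

definition hermite_kernel :: "nat \<Rightarrow> real \<Rightarrow> real \<Rightarrow> real \<Rightarrow> real \<Rightarrow> (nat \<Rightarrow> real) \<Rightarrow> real" where
  "hermite_kernel k d lam u v y = (LBINT s=u..v. hermite_integrand k d lam y s)"

lemma tempered_hermite_kernel_eq:
  "tempered_hermite_kernel k H lam t = hermite_kernel k (hermite_exponent k H) lam 0 t"
  by (simp add: fun_eq_iff tempered_hermite_kernel_def hermite_kernel_def hermite_integrand_def zero_ereal_def)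

lemma hermite_integrand_nonneg: "0 \<le> hermite_integrand k d lam y s"
  unfolding hermite_integrand_def by (intro prod_nonneg) auto

lemma hermite_integrand_measurable:
  "(\<lambda>(y, s). hermite_integrand k d lam y s) \<in> borel_measurable (lborel_pow k \<Otimes>\<^sub>M lborel)"
proof -
  have [measurable]: "(\<lambda>p. fst p i) \<in> borel_measurable (lborel_pow k \<Otimes>\<^sub>M (lborel :: real measure))" if "i < k" for i
    using measurable_compose[OF measurable_fst measurable_coordinate[OF that]] .
  have "(\<lambda>p. \<Prod>i<k. pos_powr (snd p - fst p i) (d - 1) * exp (- lam * pos_part (snd p - fst p i)))
     \<in> borel_measurable (lborel_pow k \<Otimes>\<^sub>M (lborel :: real measure))"
    by (intro borel_measurable_prod) measurable
  then show ?thesis by (simp add: hermite_integrand_def case_prod_beta)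
qed

lemma measurable_hermite_integrand [measurable (raw)]:
  assumes "f \<in> measurable N (lborel_pow k)" "g \<in> borel_measurable N"
  shows "(\<lambda>x. hermite_integrand k d lam (f x) (g x)) \<in> borel_measurable N"
proof -
  have "g \<in> measurable N lborel" using assms(2) by simp
  from measurable_compose[OF measurable_Pair[OF assms(1) this] hermite_integrand_measurable]
  show ?thesis by simp
qed

lemma sigma_finite_lborel_pow: "sigma_finite_measure (lborel_pow k)"
proof -
  interpret finite_product_sigma_finite "\<lambda>_. lborel :: real measure" "{..<k}" by standard auto
  show ?thesis by standard
qed

text \<open>By Tonelli the squared norm is the double integral over \<open>s\<close> and \<open>r\<close> of the \<open>k\<close>-th power of
  the one-dimensional overlap of the two factors, which is at most a multiple of
  \<open>\<bar>s - r\<bar> powr (2 * a + 1)\<close>; the exponent \<open>k * (2 * a + 1)\<close> exceeds \<open>-1\<close> because \<open>H > 1/2\<close>.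
  The minimum in \<open>a\<close> keeps \<open>2 * a + 1\<close> negative when \<open>d \<ge> 1/2\<close>; the exponential absorbs the lost power.\<close>

lemma nn_integral_hermite_integrand_square_finite:
  assumes k: "k \<ge> 1" and H: "H > 1 / 2" and lam: "lam > 0"
  defines "d \<equiv> hermite_exponent k H"
  shows "(\<integral>\<^sup>+y. (\<integral>\<^sup>+s. ennreal (hermite_integrand k d lam y s) * indicator {u..v} s \<partial>lborel)\<^sup>2 \<partial>lborel_pow k) < \<infinity>"
proof -
  interpret product_sigma_finite "\<lambda>_. lborel :: real measure" by standard
  interpret P: sigma_finite_measure "lborel_pow k" by (rule sigma_finite_lborel_pow)
  interpret PL: pair_sigma_finite "lborel_pow k" "lborel :: real measure" by standard
  \<comment> \<open>The second entry of the minimum lies strictly between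
    \<open>1/2 - 1/(2*k)\<close>, which \<open>a + 1\<close> must exceed to give
    \<open>- 1 < \<beta>\<close>, and \<open>1/2\<close>, below which
    \<open>2 * a + 1 < 0\<close>.\<close>
  define a where "a = min d (1 / 2 - 1 / (4 * real k)) - 1"
  define \<beta> where "\<beta> = real k * (2 * a + 1)"
  have kpos: "real k \<ge> 1" using k by simp
  have dk: "1 / 2 - 1 / (2 * real k) < d"
  proof -
    have "(1 - H) / real k < (1 / 2) / real k" using H kpos by (intro divide_strict_right_mono) auto
    then show ?thesis by (simp add: d_def hermite_exponent_def)
  qed
  have low: "1 / 2 - 1 / (2 * real k) < a + 1"
    using dk kpos by (simp add: a_def field_simps)
  have "0 \<le> 1 / 2 - 1 / (2 * real k)" using kpos by (simp add: field_simps)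
  then have a1: "- 1 < a" using low by simp
  have "a + 1 \<le> 1 / 2 - 1 / (4 * real k)" by (simp add: a_def)
  moreover have "0 < 1 / (4 * real k)" using kpos by simp
  ultimately have a2: "2 * a + 1 < 0" by linarith
  have "- 1 / real k < 2 * a + 1" using low by (simp add: field_simps)
  then have \<beta>: "- 1 < \<beta>" using kpos by (simp add: \<beta>_def field_simps)
  have ad: "0 \<le> d - 1 - a" by (simp add: a_def)
  obtain C where C: "C > 0" "\<And>x. x > 0 \<Longrightarrow> x powr (d - 1 - a) * exp (- lam * x) \<le> C"
    using powr_mult_exp_bounded[OF ad lam] by blast
  define e where "e x = pos_powr x (d - 1) * exp (- lam * pos_part x)" for x
  have e0: "0 \<le> e x" for x by (simp add: e_def)
  have [measurable]: "e \<in> borel_measurable borel" unfolding e_def[abs_def] by measurable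
  have e_le: "e x \<le> C * pos_powr x a" for x
  proof (cases "x > 0")
    case True
    have "e x = x powr a * (x powr (d - 1 - a) * exp (- lam * x))"
      using True by (simp add: e_def pos_powr_def pos_part_def mult.assoc[symmetric] powr_add[symmetric])
    also have "\<dots> \<le> x powr a * C" using C(2)[OF True] by (intro mult_left_mono) auto
    finally show ?thesis using True by (simp add: pos_powr_def mult.commute)
  qed (simp add: e_def pos_powr_def)
  define D where "D = C\<^sup>2 * (1 / (a + 1) - 1 / (2 * a + 1))"
  have "0 < 1 / (a + 1)" "1 / (2 * a + 1) < 0" using a1 a2 by auto
  then have D0: "0 \<le> 1 / (a + 1) - 1 / (2 * a + 1)" by linarith
  then have D: "0 \<le> D" by (simp add: D_def)
  have overlap: "(\<integral>\<^sup>+y. ennreal (e (s - y) * e (r - y)) \<partial>lborel) \<le> ennreal (D * \<bar>s - r\<bar> powr (2 * a + 1))"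
    if "s \<noteq> r" for s r
  proof -
    have "(\<integral>\<^sup>+y. ennreal (e (s - y) * e (r - y)) \<partial>lborel) \<le>
        (\<integral>\<^sup>+y. ennreal (C\<^sup>2) * ennreal (pos_powr (s - y) a * pos_powr (r - y) a) \<partial>lborel)"
    proof (rule nn_integral_mono)
      fix y
      have "e (s - y) * e (r - y) \<le> (C * pos_powr (s - y) a) * (C * pos_powr (r - y) a)"
        using C(1) by (intro mult_mono e_le e0) auto
      then show "ennreal (e (s - y) * e (r - y)) \<le> ennreal (C\<^sup>2) * ennreal (pos_powr (s - y) a * pos_powr (r - y) a)"
        by (subst ennreal_mult[symmetric]) (auto intro!: ennreal_leI simp: power2_eq_square mult_ac)
    qed
    also have "\<dots> = ennreal (C\<^sup>2) * (\<integral>\<^sup>+y. ennreal (pos_powr (s - y) a * pos_powr (r - y) a) \<partial>lborel)"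
      by (rule nn_integral_cmult) measurable
    also have "\<dots> \<le> ennreal (C\<^sup>2) * ennreal ((1 / (a + 1) - 1 / (2 * a + 1)) * \<bar>s - r\<bar> powr (2 * a + 1))"
      by (intro mult_left_mono nn_integral_pos_powr_product[OF a1 a2 that]) auto
    also have "\<dots> = ennreal (D * \<bar>s - r\<bar> powr (2 * a + 1))"
      using D0 by (subst ennreal_mult[symmetric]) (auto simp: D_def mult.assoc)
    finally show ?thesis .
  qed
  define p where "p y s = ennreal (hermite_integrand k d lam y s)" for y s
  have [measurable]: "(\<lambda>x. p (f x) (g x)) \<in> borel_measurable N"
    if "f \<in> measurable N (lborel_pow k)" "g \<in> borel_measurable N" for f g and N :: "'z measure"
    unfolding p_def using that by measurable
  have pe: "p y s = (\<Prod>i<k. ennreal (e (s - y i)))" for y s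
    unfolding p_def hermite_integrand_def e_def[symmetric] using e0 by (simp add: prod_ennreal)
  have pp: "(\<integral>\<^sup>+y. p y s * p y r \<partial>lborel_pow k) \<le> ennreal (D ^ k) * ennreal (\<bar>s - r\<bar> powr \<beta>)"
    if sr: "s \<noteq> r" for s r
  proof -
    have "(\<integral>\<^sup>+y. p y s * p y r \<partial>lborel_pow k) = (\<integral>\<^sup>+y. (\<Prod>i<k. ennreal (e (s - y i) * e (r - y i))) \<partial>lborel_pow k)"
      by (simp add: pe ennreal_mult e0 prod.distrib)
    also have "\<dots> = (\<Prod>i<k. \<integral>\<^sup>+y. ennreal (e (s - y) * e (r - y)) \<partial>lborel)"
      by (rule product_nn_integral_prod) auto
    also have "\<dots> \<le> (\<Prod>i<k. ennreal (D * \<bar>s - r\<bar> powr (2 * a + 1)))"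
      unfolding prod_constant by (intro power_mono overlap[OF sr]) simp
    also have "\<dots> = ennreal (D ^ k * (\<bar>s - r\<bar> powr (2 * a + 1)) ^ k)"
      using D by (simp add: ennreal_power power_mult_distrib)
    also have "(\<bar>s - r\<bar> powr (2 * a + 1)) ^ k = \<bar>s - r\<bar> powr \<beta>"
      using sr by (simp add: \<beta>_def powr_power mult.commute)
    finally show ?thesis using D by (simp add: ennreal_mult)
  qed
  let ?I = "\<lambda>s. indicator {u..v} s :: ennreal"
  have "(\<integral>\<^sup>+y. (\<integral>\<^sup>+s. p y s * ?I s \<partial>lborel)\<^sup>2 \<partial>lborel_pow k) =
      (\<integral>\<^sup>+y. (\<integral>\<^sup>+s. (\<integral>\<^sup>+r. (p y s * ?I s) * (p y r * ?I r) \<partial>lborel) \<partial>lborel) \<partial>lborel_pow k)"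
  proof (rule nn_integral_cong)
    fix y assume y: "y \<in> space (lborel_pow k)"
    have [measurable]: "p y \<in> borel_measurable borel"
      using measurable_Pair2[OF hermite_integrand_measurable y] unfolding p_def by simp
    show "(\<integral>\<^sup>+s. p y s * ?I s \<partial>lborel)\<^sup>2 = (\<integral>\<^sup>+s. (\<integral>\<^sup>+r. (p y s * ?I s) * (p y r * ?I r) \<partial>lborel) \<partial>lborel)"
      by (subst nn_integral_cmult) (simp_all add: power2_eq_square nn_integral_multc)
  qed
  also have "\<dots> = (\<integral>\<^sup>+s. (\<integral>\<^sup>+y. (\<integral>\<^sup>+r. (p y s * ?I s) * (p y r * ?I r) \<partial>lborel) \<partial>lborel_pow k) \<partial>lborel)"
    by (rule PL.Fubini'[symmetric]) measurable
  also have "\<dots> = (\<integral>\<^sup>+s. (\<integral>\<^sup>+r. (\<integral>\<^sup>+y. (p y s * ?I s) * (p y r * ?I r) \<partial>lborel_pow k) \<partial>lborel) \<partial>lborel)"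
    by (intro nn_integral_cong PL.Fubini'[symmetric]) measurable
  also have "\<dots> \<le> (\<integral>\<^sup>+s. (\<integral>\<^sup>+r. ennreal (D ^ k) * (ennreal (\<bar>s - r\<bar> powr \<beta>) * ?I r * ?I s) \<partial>lborel) \<partial>lborel)"
  \<comment> \<open>The point \<open>r = s\<close> is left out: there the right side is 0, as
    \<open>0 powr \<beta> = 0\<close>, while the overlap can be positive.\<close>
  proof (rule nn_integral_mono, rule nn_integral_mono_AE)
    fix s :: real
    show "AE r in lborel. (\<integral>\<^sup>+y. (p y s * ?I s) * (p y r * ?I r) \<partial>lborel_pow k) \<le>
        ennreal (D ^ k) * (ennreal (\<bar>s - r\<bar> powr \<beta>) * ?I r * ?I s)"
      using AE_lborel_singleton[of s]
    proof eventually_elim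
      case (elim r)
      then have "s \<noteq> r" by simp
      from pp[OF this] show ?case by (auto simp: indicator_def)
    qed
  qed
  also have "\<dots> = ennreal (D ^ k) * (\<integral>\<^sup>+s. (\<integral>\<^sup>+r. ennreal (\<bar>s - r\<bar> powr \<beta>) * ?I r \<partial>lborel) * ?I s \<partial>lborel)"
    by (simp add: nn_integral_cmult nn_integral_multc)
  also have "\<dots> < \<infinity>"
    using nn_integral_abs_powr_Icc_finite[OF \<beta>, of u v] by (simp add: ennreal_mult_less_top)
  finally show ?thesis by (simp add: p_def)
qed

context
  fixes k :: nat and H lam d :: real
  assumes k: "k \<ge> 1" and H: "H > 1 / 2" and lam: "lam > 0" and d: "d = hermite_exponent k H"
begin

text \<open>The inner integral has a finite second moment in \<open>y\<close>, so it is finite for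
  almost every \<open>y\<close>. Passing to \<open>min u v\<close> and \<open>max u v\<close> covers
  both orientations.\<close>

lemma AE_hermite_integrand_integrable:
  "AE y in lborel_pow k. interval_lebesgue_integrable lborel (ereal u) (ereal v) (hermite_integrand k d lam y)"
proof -
  define a b where "a = min u v" and "b = max u v"
  have [measurable]: "(\<lambda>y. \<integral>\<^sup>+s. ennreal (hermite_integrand k d lam y s) * indicator {a..b} s \<partial>lborel)
      \<in> borel_measurable (lborel_pow k)"
    by measurable
  have "(\<lambda>y. (\<integral>\<^sup>+s. ennreal (hermite_integrand k d lam y s) * indicator {a..b} s \<partial>lborel)\<^sup>2)
      \<in> borel_measurable (lborel_pow k)"
    unfolding power2_eq_square by measurable
  then have "AE y in lborel_pow k. (\<integral>\<^sup>+s. ennreal (hermite_integrand k d lam y s) * indicator {a..b} s \<partial>lborel)\<^sup>2 \<noteq> \<infinity>"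
    using nn_integral_hermite_integrand_square_finite[OF k H lam, of a b]
    unfolding d by (intro nn_integral_PInf_AE) simp_all
  moreover have "AE y in lborel_pow k. y \<in> space (lborel_pow k)" by simp
  ultimately show ?thesis
  proof eventually_elim
    case (elim y)
    have [measurable]: "hermite_integrand k d lam y \<in> borel_measurable borel"
      using measurable_Pair2[OF hermite_integrand_measurable elim(2)] by simp
    have "(\<integral>\<^sup>+s. ennreal (hermite_integrand k d lam y s) * indicator {a..b} s \<partial>lborel) < \<infinity>"
      using elim(1) by (auto simp: less_top power2_eq_square ennreal_mult_eq_top_iff)
    then have "set_integrable lborel {a..b} (hermite_integrand k d lam y)"
      unfolding set_integrable_def
      by (intro integrableI_bounded)
        (auto simp: hermite_integrand_nonneg ennreal_mult' ennreal_indicator mult.commute)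
    then show ?case
      unfolding interval_lebesgue_integrable_def
      by (auto simp: a_def b_def intro: set_integrable_subset)
  qed
qed

lemma hermite_kernel_measurable: "hermite_kernel k d lam u v \<in> borel_measurable (lborel_pow k)"
proof -
  show ?thesis
    unfolding hermite_kernel_def[abs_def] interval_lebesgue_integral_def set_lebesgue_integral_def
    by (cases "u \<le> v") simp_all
qed

lemma square_integrable_hermite_kernel: "square_integrable (lborel_pow k) (hermite_kernel k d lam u v)"
  unfolding square_integrable_iff_nn_integral
proof
  define a b where "a = min u v" and "b = max u v"
  have le: "ennreal ((hermite_kernel k d lam u v y)\<^sup>2) \<le>
      (\<integral>\<^sup>+s. ennreal (hermite_integrand k d lam y s) * indicator {a..b} s \<partial>lborel)\<^sup>2"
    if y: "y \<in> space (lborel_pow k)" for y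
  proof -
    have [measurable]: "hermite_integrand k d lam y \<in> borel_measurable borel"
      using measurable_Pair2[OF hermite_integrand_measurable y] by simp
    let ?f = "\<lambda>s. indicator {a<..<b} s * hermite_integrand k d lam y s"
    have "\<bar>hermite_kernel k d lam u v y\<bar> = (LINT s|lborel. ?f s)"
    proof -
      have "0 \<le> (LINT s|lborel. ?f s)" by (intro integral_nonneg_AE) (auto simp: hermite_integrand_nonneg)
      then show ?thesis
        by (cases "u \<le> v") (auto simp: hermite_kernel_def interval_lebesgue_integral_def
            set_lebesgue_integral_def a_def b_def min_def max_def)
    qed
    also have "\<dots> = enn2real (\<integral>\<^sup>+s. ennreal (?f s) \<partial>lborel)"
      by (rule integral_eq_nn_integral) (auto simp: hermite_integrand_nonneg)
    \<comment> \<open>Only an inequality: where the right side is infinite, the kernel has its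
      default value 0.\<close>
    finally have "ennreal \<bar>hermite_kernel k d lam u v y\<bar> \<le> (\<integral>\<^sup>+s. ennreal (?f s) \<partial>lborel)"
      by (simp add: ennreal_enn2real_if)
    also have "\<dots> \<le> (\<integral>\<^sup>+s. ennreal (hermite_integrand k d lam y s) * indicator {a..b} s \<partial>lborel)"
      by (intro nn_integral_mono) (auto simp: indicator_def)
    finally have "(ennreal \<bar>hermite_kernel k d lam u v y\<bar>)\<^sup>2 \<le>
       (\<integral>\<^sup>+s. ennreal (hermite_integrand k d lam y s) * indicator {a..b} s \<partial>lborel)\<^sup>2"
      by (intro power_mono) auto
    then show ?thesis by (simp add: ennreal_power)
  qed
  have "(\<integral>\<^sup>+y. ennreal ((hermite_kernel k d lam u v y)\<^sup>2) \<partial>lborel_pow k) \<le>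
     (\<integral>\<^sup>+y. (\<integral>\<^sup>+s. ennreal (hermite_integrand k d lam y s) * indicator {a..b} s \<partial>lborel)\<^sup>2 \<partial>lborel_pow k)"
    by (intro nn_integral_mono le)
  also have "\<dots> < \<infinity>"
    unfolding d by (rule nn_integral_hermite_integrand_square_finite[OF k H lam])
  finally show "(\<integral>\<^sup>+y. ennreal ((hermite_kernel k d lam u v y)\<^sup>2) \<partial>lborel_pow k) < \<infinity>" .
qed (rule hermite_kernel_measurable)

text \<open>Adding adjacent interval integrals uses integrability over the hull of the three end
  points, which holds off a null set of \<open>y\<close>.\<close>

lemma AE_hermite_kernel_diff:
  "AE y in lborel_pow k. hermite_kernel k d lam u w y - hermite_kernel k d lam u v y = hermite_kernel k d lam v w y"
  using AE_hermite_integrand_integrable[of "min u (min v w)" "max u (max v w)"]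
proof eventually_elim
  case (elim y)
  have *: "min (ereal u) (min (ereal v) (ereal w)) = ereal (min u (min v w))"
    "max (ereal u) (max (ereal v) (ereal w)) = ereal (max u (max v w))"
    by (simp_all add: min_def max_def)
  have "hermite_kernel k d lam u v y + hermite_kernel k d lam v w y = hermite_kernel k d lam u w y"
    unfolding hermite_kernel_def by (rule interval_integral_sum, unfold *, rule elim)
  then show ?case by simp
qed

end

section \<open>Translation and scaling of the kernel\<close>

lemma interval_lebesgue_integral_affine:
  fixes f :: "real \<Rightarrow> real"
  assumes c: "c > 0"
  shows "(LBINT s=ereal (c * u + h)..ereal (c * v + h). f s) = c * (LBINT s=ereal u..ereal v. f (c * s + h))"
proof -
  have *: "(LINT s|lborel. indicator {c * u + h<..<c * v + h} s * f s) =
      c * (LINT s|lborel. indicator {u<..<v} s * f (c * s + h))" for u v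
  proof -
    have "(LINT s|lborel. indicator {c * u + h<..<c * v + h} s * f s) =
        c * (LINT s|lborel. indicator {c * u + h<..<c * v + h} (h + c * s) * f (h + c * s))"
      using lborel_integral_real_affine[of c "\<lambda>s. indicator {c * u + h<..<c * v + h} s * f s" h] c by simp
    also have "(\<lambda>s. indicator {c * u + h<..<c * v + h} (h + c * s) * f (h + c * s)) =
        (\<lambda>s. indicator {u<..<v} s * f (c * s + h))"
      using c by (auto simp: indicator_def fun_eq_iff add.commute)
    finally show ?thesis .
  qed
  show ?thesis
    using c by (cases "u \<le> v") (auto simp: interval_lebesgue_integral_def set_lebesgue_integral_def *)
qed

text \<open>The integrand depends on the differences \<open>s - y i\<close> only. The form
  \<open>1 * x i + h\<close> is the one that \<open>is_wiener_ito_affine\<close> produces for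
  \<open>c = 1\<close>.\<close>

lemma hermite_kernel_translate:
  "hermite_kernel k d lam (u + h) (v + h) (\<lambda>i\<in>{..<k}. 1 * x i + h) = hermite_kernel k d lam u v x"
  using interval_lebesgue_integral_affine[of 1 u h v "hermite_integrand k d lam (\<lambda>i\<in>{..<k}. 1 * x i + h)"]
  by (simp add: hermite_kernel_def hermite_integrand_def)

text \<open>Each of the \<open>k\<close> factors releases \<open>c powr (d - 1)\<close> and the
  substitution in \<open>s\<close> one more \<open>c\<close>, while the exponential turns
  \<open>lam\<close> into \<open>c * lam\<close>.\<close>

lemma hermite_kernel_scale:
  assumes c: "c > 0"
  shows "hermite_kernel k d lam (c * u) (c * v) (\<lambda>i\<in>{..<k}. c * x i + 0) =
    c powr (1 + real k * (d - 1)) * hermite_kernel k d (c * lam) u v x"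
proof -
  let ?T = "\<lambda>i\<in>{..<k}. c * x i + 0"
  have one: "pos_powr (c * z) (d - 1) * exp (- lam * pos_part (c * z)) =
      c powr (d - 1) * (pos_powr z (d - 1) * exp (- (c * lam) * pos_part z))" for z
    using c by (auto simp: pos_powr_def pos_part_def powr_mult zero_less_mult_iff mult_ac)
  have "hermite_integrand k d lam ?T (c * s + 0) = c powr (real k * (d - 1)) * hermite_integrand k d (c * lam) x s" for s
  proof -
    have "hermite_integrand k d lam ?T (c * s + 0) =
       (\<Prod>i<k. pos_powr (c * (s - x i)) (d - 1) * exp (- lam * pos_part (c * (s - x i))))"
      unfolding hermite_integrand_def by (intro prod.cong) (auto simp: right_diff_distrib)
    also have "\<dots> = (c powr (d - 1)) ^ k * hermite_integrand k d (c * lam) x s"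
      unfolding one by (simp add: hermite_integrand_def prod.distrib)
    also have "(c powr (d - 1)) ^ k = c powr (real k * (d - 1))"
      using c by (simp add: powr_power mult.commute)
    finally show ?thesis .
  qed
  then show ?thesis
    using interval_lebesgue_integral_affine[OF c, of u 0 v "hermite_integrand k d lam ?T"] c
    by (simp add: hermite_kernel_def powr_add)
qed

theorem proposition1:
  fixes M :: "'a measure" and B :: "real \<Rightarrow> 'a \<Rightarrow> real"
    and k :: nat and H lam :: real
  assumes "two_sided_brownian_motion M B"
    and "k \<ge> 1" and "H > 1 / 2" and "lam > 0"
  shows "stationary_increments M (tempered_hermite M B k H lam) \<and>
    (\<forall>c>0. fdd_equal M (\<lambda>t. tempered_hermite M B k H lam (c * t))
                     M (\<lambda>t \<omega>. c powr H * tempered_hermite M B k H (c * lam) t \<omega>))"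
proof -
  note BM = two_sided_brownian_motion_increments[OF assms(1)]
  interpret brownian_increments M B by (rule BM)
  define d where "d = hermite_exponent k H"
  define K where "K l t = hermite_kernel k d l 0 t" for l t
  define Z where "Z l t = tempered_hermite M B k H l t" for l t
  have Z: "is_wiener_ito M B k (K l t) (Z l t)" if "l > 0" for l t
    unfolding Z_def K_def tempered_hermite_def tempered_hermite_kernel_eq d_def[symmetric]
    by (intro is_wiener_ito_wiener_ito square_integrable_hermite_kernel[OF assms(2,3) that d_def])
  have "stationary_increments M (Z lam)"
    unfolding stationary_increments_def
  proof
    fix h
    let ?B' = "\<lambda>s \<omega>. B (1 * s + h) \<omega> / sqrt 1"
    show "fdd_equal M (\<lambda>t \<omega>. Z lam (t + h) \<omega> - Z lam h \<omega>) M (\<lambda>t \<omega>. Z lam t \<omega> - Z lam 0 \<omega>)"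
    \<comment> \<open>The left process is read as the integrals of \<open>K lam t\<close> against
      the shifted motion, the right one as the integrals of the same kernels against
      \<open>B\<close>.\<close>
    proof (rule wiener_ito_fdd_equal[OF _ BM])
      show "brownian_increments M ?B'" by (rule brownian_increments_affine) simp
      fix t
      have "is_wiener_ito M B k (\<lambda>y. K lam (t + h) y - K lam h y) (\<lambda>\<omega>. Z lam (t + h) \<omega> - Z lam h \<omega>)"
        by (intro is_wiener_ito_diff Z assms(4))
      then have "is_wiener_ito M B k (hermite_kernel k d lam (0 + h) (t + h)) (\<lambda>\<omega>. Z lam (t + h) \<omega> - Z lam h \<omega>)"
      proof (rule is_wiener_ito_cong_AE)
        show "AE y in lborel_pow k. K lam (t + h) y - K lam h y = hermite_kernel k d lam (0 + h) (t + h) y"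
          unfolding K_def add_0_left by (rule AE_hermite_kernel_diff[OF assms(2-4) d_def])
      qed (rule hermite_kernel_measurable[OF assms(2-4) d_def])
      from is_wiener_ito_affine[OF BM this, of 1 h]
      show "is_wiener_ito M ?B' k (K lam t) (\<lambda>\<omega>. Z lam (t + h) \<omega> - Z lam h \<omega>)"
        unfolding hermite_kernel_translate K_def by simp
      \<comment> \<open>\<open>Z lam 0\<close> is a chosen version, so it is known to vanish almost
        surely only; it is absorbed at the level of kernels.\<close>
      have "K lam 0 = (\<lambda>_. 0)" by (simp add: K_def hermite_kernel_def fun_eq_iff)
      then show "is_wiener_ito M B k (K lam t) (\<lambda>\<omega>. Z lam t \<omega> - Z lam 0 \<omega>)"
        using is_wiener_ito_diff[OF Z Z, OF assms(4) assms(4), of t 0] by simp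
    qed
  qed
  moreover have "fdd_equal M (\<lambda>t. Z lam (c * t)) M (\<lambda>t \<omega>. c powr H * Z (c * lam) t \<omega>)" if c: "c > 0" for c
  proof (rule wiener_ito_fdd_equal[OF _ BM])
    let ?B' = "\<lambda>s \<omega>. B (c * s + 0) \<omega> / sqrt c"
    show B': "brownian_increments M ?B'" by (rule brownian_increments_affine[OF c])
    fix t
    have "1 + real k * (d - 1) + real k / 2 = H"
      using assms(2) by (simp add: d_def hermite_exponent_def field_simps)
    then have "c powr H = c powr (1 + real k * (d - 1)) * c powr (real k / 2)"
      by (simp flip: powr_add)
    also have "c powr (real k / 2) = sqrt c ^ k"
      using c by (simp add: powr_half_sqrt[symmetric] powr_power)
    finally have cH: "c powr H = c powr (1 + real k * (d - 1)) * sqrt c ^ k" .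
    have "is_wiener_ito M ?B' k (\<lambda>x. c powr (1 + real k * (d - 1)) * K (c * lam) t x)
        (\<lambda>\<omega>. (1 / sqrt c ^ k) * Z lam (c * t) \<omega>)"
      using is_wiener_ito_affine[OF BM Z[OF assms(4), of "c * t"] c, of 0]
      unfolding K_def using hermite_kernel_scale[OF c, of k d lam 0 t] by simp
    \<comment> \<open>This cancels the factor that the change of time left on
      \<open>Z lam (c * t)\<close> and completes the factor of the kernel to
      \<open>c powr H\<close>.\<close>
    from is_wiener_ito_cmult[OF B' this, of "sqrt c ^ k"]
    show "is_wiener_ito M ?B' k (\<lambda>x. c powr H * K (c * lam) t x) (Z lam (c * t))"
      using c by (simp add: cH mult_ac)
    show "is_wiener_ito M B k (\<lambda>x. c powr H * K (c * lam) t x) (\<lambda>\<omega>. c powr H * Z (c * lam) t \<omega>)"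
      using assms(4) c by (intro is_wiener_ito_cmult[OF BM] Z) simp
  qed
  ultimately show ?thesis unfolding Z_def by simp
qed

end
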